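(* Let $M$ be a compact $n$-dimensional differentiable manifold without boundary, $T\in(0,\infty)$, and let $(g_t)_{t\in[0,T]}$ be a solution of the Ricci flow $\partial_t g_t=-\mathrm{Ric}_t$ on $M\times[0,T]$. Suppose that $0\le\mathrm{Ric}_t\le k$ for all $t\in(0,T]$, for some constant $k>0$. Let $u:M\times[0,T]\to\mathbb R$ be a smooth positive function satisfying the heat equation $\partial_t u=\tfrac12\Delta u$ on $M\times[0,T]$. Then $$\frac{|\nabla u|^2}{u^2}-\frac{\Delta u}{u}\le kn+\frac{2n}{t}$$ holds at every $(x,t)\in M\times(0,T]$.
   Context: $\mathrm{Ric}_t$ is the Ricci curvature tensor of $g_t$; note the normalization $\partial_t g_t=-\mathrm{Ric}_t$ (probabilistic convention) of the Ricci flow. The gradient $\nabla$, the norm $|\cdot|$ and the Laplacian $\Delta$ at time $t$ are taken with respect to $g_t$. The bound $0\le\mathrm{Ric}_t\le k$ means $0\le\mathrm{Ric}_t(X,X)\le k\,g_t(X,X)$ for all tangent vectors $X$. *)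

theory Defs
  imports "HOL-Analysis.Analysis"
begin

section \<open>Smooth maps\<close>

text \<open>\<open>Ck_on k W f\<close> is meant for open \<open>W\<close>.\<close>

primrec Ck_on ::
  "nat \<Rightarrow> 'a::real_normed_vector set \<Rightarrow> ('a \<Rightarrow> 'b::real_normed_vector) \<Rightarrow> bool" where
  "Ck_on 0 W f \<longleftrightarrow> continuous_on W f"
| "Ck_on (Suc k) W f \<longleftrightarrow>
     (\<forall>x\<in>W. f differentiable (at x)) \<and>
     (\<forall>v. Ck_on k W (\<lambda>x. frechet_derivative f (at x) v))"

text \<open>Smoothness on an arbitrary set means local extendability to smooth maps on open sets.
  For a set of the form \<open>V \<times> {0..T}\<close> with \<open>V\<close> open this is smoothness up to the boundary.\<close>

definition smooth_on ::
  "'a::real_normed_vector set \<Rightarrow> ('a \<Rightarrow> 'b::real_normed_vector) \<Rightarrow> bool" where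
  "smooth_on S f \<longleftrightarrow>
     (\<forall>x\<in>S. \<exists>W F. open W \<and> x \<in> W \<and> (\<forall>k. Ck_on k W F) \<and> (\<forall>y\<in>W \<inter> S. F y = f y))"


section \<open>Manifolds and tangent vectors\<close>

text \<open>The manifold is the whole type \<open>'m\<close>, its dimension is \<open>CARD('n)\<close>.\<close>

type_synonym ('m, 'n) chart = "'m set \<times> ('m \<Rightarrow> real ^ 'n)"

abbreviation chart_dom :: "('m, 'n) chart \<Rightarrow> 'm set" where
  "chart_dom c \<equiv> fst c"

abbreviation chart_map :: "('m, 'n) chart \<Rightarrow> 'm \<Rightarrow> real ^ 'n" where
  "chart_map c \<equiv> snd c"

abbreviation chart_im :: "('m, 'n) chart \<Rightarrow> (real ^ 'n) set" where
  "chart_im c \<equiv> chart_map c ` chart_dom c"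

definition chart_inv :: "('m, 'n) chart \<Rightarrow> real ^ 'n \<Rightarrow> 'm" where
  "chart_inv c = inv_into (chart_dom c) (chart_map c)"

definition is_chart :: "('m::topological_space, 'n::finite) chart \<Rightarrow> bool" where
  "is_chart c \<longleftrightarrow> open (chart_dom c) \<and> open (chart_im c) \<and>
     homeomorphism (chart_dom c) (chart_im c) (chart_map c) (chart_inv c)"

definition smooth_atlas :: "('m::topological_space, 'n::finite) chart set \<Rightarrow> bool" where
  "smooth_atlas A \<longleftrightarrow>
     (\<forall>c\<in>A. is_chart c) \<and> (\<Union>c\<in>A. chart_dom c) = UNIV \<and>
     (\<forall>c\<in>A. \<forall>d\<in>A. smooth_on (chart_map c ` (chart_dom c \<inter> chart_dom d))
                              (chart_map d \<circ> chart_inv c))"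

text \<open>A compact Hausdorff space with a smooth atlas is automatically second countable, and
  charts onto open subsets of \<open>real ^ 'n\<close> exclude a boundary.\<close>

definition compact_manifold :: "('m::t2_space, 'n::finite) chart set \<Rightarrow> bool" where
  "compact_manifold A \<longleftrightarrow> compact (UNIV :: 'm set) \<and> smooth_atlas A"

text \<open>Tangent vectors at \<open>p\<close> are the directional derivatives at \<open>p\<close>. They act on the functions
  that are differentiable at \<open>p\<close>, and are set to 0 on all others, so that the operators
  obtained from different charts around \<open>p\<close> coincide.\<close>

type_synonym 'm tangent_vector = "('m \<Rightarrow> real) \<Rightarrow> real"

definition coord_vector ::
  "('m, 'n::finite) chart \<Rightarrow> 'm \<Rightarrow> real ^ 'n \<Rightarrow> 'm tangent_vector" where
  "coord_vector c p v f =
     (if (f \<circ> chart_inv c) differentiable (at (chart_map c p))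
      then frechet_derivative (f \<circ> chart_inv c) (at (chart_map c p)) v else 0)"

definition tangent_space :: "('m, 'n::finite) chart set \<Rightarrow> 'm \<Rightarrow> 'm tangent_vector set" where
  "tangent_space A p = {coord_vector c p v | c v. c \<in> A \<and> p \<in> chart_dom c}"

definition coord_basis ::
  "('m, 'n::finite) chart \<Rightarrow> 'n \<Rightarrow> 'm \<Rightarrow> 'm tangent_vector" where
  "coord_basis c i p = coord_vector c p (axis i 1)"

definition partial ::
  "('m, 'n::finite) chart \<Rightarrow> 'n \<Rightarrow> ('m \<Rightarrow> real) \<Rightarrow> 'm \<Rightarrow> real" where
  "partial c i f p = coord_basis c i p f"

definition component ::
  "('m, 'n::finite) chart \<Rightarrow> 'n \<Rightarrow> 'm tangent_vector \<Rightarrow> real" where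
  "component c i X = X (\<lambda>q. chart_map c q $ i)"

definition smooth_on_interval ::
  "('m, 'n::finite) chart set \<Rightarrow> real \<Rightarrow> ('m \<Rightarrow> real \<Rightarrow> real) \<Rightarrow> bool" where
  "smooth_on_interval A T u \<longleftrightarrow>
     (\<forall>c\<in>A. smooth_on (chart_im c \<times> {0..T}) (\<lambda>(y, t). u (chart_inv c y) t))"


section \<open>Riemannian metrics\<close>

type_synonym 'm metric_field = "'m \<Rightarrow> 'm tangent_vector \<Rightarrow> 'm tangent_vector \<Rightarrow> real"

definition inner_product_field ::
  "('m, 'n::finite) chart set \<Rightarrow> 'm metric_field \<Rightarrow> bool" where
  "inner_product_field A g \<longleftrightarrow>
     (\<forall>p. \<forall>X\<in>tangent_space A p. \<forall>Y\<in>tangent_space A p.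
        g p X Y = g p Y X \<and>
        (\<forall>Z\<in>tangent_space A p. \<forall>a b.
           g p (\<lambda>f. a * X f + b * Y f) Z = a * g p X Z + b * g p Y Z)) \<and>
     (\<forall>p. \<forall>X\<in>tangent_space A p. X \<noteq> (\<lambda>f. 0) \<longrightarrow> 0 < g p X X)"

definition metric_norm :: "'m metric_field \<Rightarrow> 'm \<Rightarrow> 'm tangent_vector \<Rightarrow> real" where
  "metric_norm g p X = sqrt (g p X X)"

definition gradient ::
  "('m, 'n::finite) chart set \<Rightarrow> 'm metric_field \<Rightarrow> ('m \<Rightarrow> real) \<Rightarrow> 'm \<Rightarrow> 'm tangent_vector" where
  "gradient A g f p =
     (THE Y. Y \<in> tangent_space A p \<and> (\<forall>X\<in>tangent_space A p. g p Y X = X f))"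

definition metric_coeff ::
  "('m, 'n::finite) chart \<Rightarrow> 'm metric_field \<Rightarrow> 'n \<Rightarrow> 'n \<Rightarrow> 'm \<Rightarrow> real" where
  "metric_coeff c g i j p = g p (coord_basis c i p) (coord_basis c j p)"

definition metric_family ::
  "('m, 'n::finite) chart set \<Rightarrow> real \<Rightarrow> (real \<Rightarrow> 'm metric_field) \<Rightarrow> bool" where
  "metric_family A T g \<longleftrightarrow>
     (\<forall>t\<in>{0..T}. inner_product_field A (g t)) \<and>
     (\<forall>c\<in>A. \<forall>i j. smooth_on (chart_im c \<times> {0..T})
        (\<lambda>(y, t). metric_coeff c (g t) i j (chart_inv c y)))"

definition inverse_metric_coeff ::
  "('m, 'n::finite) chart \<Rightarrow> 'm metric_field \<Rightarrow> 'n \<Rightarrow> 'n \<Rightarrow> 'm \<Rightarrow> real" where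
  "inverse_metric_coeff c g i j p = matrix_inv (\<chi> a b. metric_coeff c g a b p) $ i $ j"


section \<open>Levi-Civita connection, curvature and Laplacian\<close>

text \<open>These are given by their classical expressions in the coordinates of a chart \<open>c\<close>.
  The values of \<open>ricci\<close> and \<open>laplacian\<close> at \<open>p\<close> are the same for all charts around \<open>p\<close>.\<close>

text \<open>\<open>christoffel c g k i j\<close> is \<open>\<Gamma>\<^sup>k\<^sub>i\<^sub>j\<close>, i.e. \<open>\<nabla>\<^sub>i \<partial>\<^sub>j = (\<Sum>k. \<Gamma>\<^sup>k\<^sub>i\<^sub>j \<partial>\<^sub>k)\<close>.\<close>

definition christoffel ::
  "('m, 'n::finite) chart \<Rightarrow> 'm metric_field \<Rightarrow> 'n \<Rightarrow> 'n \<Rightarrow> 'n \<Rightarrow> 'm \<Rightarrow> real" where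
  "christoffel c g k i j p =
     (1/2) * (\<Sum>l\<in>UNIV. inverse_metric_coeff c g k l p *
        (partial c i (metric_coeff c g j l) p + partial c j (metric_coeff c g i l) p
         - partial c l (metric_coeff c g i j) p))"

text \<open>\<open>riemann c g l k i j\<close> is the coefficient of \<open>\<partial>\<^sub>l\<close> in \<open>R(\<partial>\<^sub>i, \<partial>\<^sub>j) \<partial>\<^sub>k\<close>, where
  \<open>R(X, Y) Z = \<nabla>\<^sub>X \<nabla>\<^sub>Y Z - \<nabla>\<^sub>Y \<nabla>\<^sub>X Z - \<nabla>\<^bsub>[X, Y]\<^esub> Z\<close>. The Ricci tensor is
  \<open>Ric(Y, Z) = tr (X \<mapsto> R(X, Y) Z)\<close>.\<close>

definition riemann ::
  "('m, 'n::finite) chart \<Rightarrow> 'm metric_field \<Rightarrow> 'n \<Rightarrow> 'n \<Rightarrow> 'n \<Rightarrow> 'n \<Rightarrow> 'm \<Rightarrow> real" where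
  "riemann c g l k i j p =
     partial c i (christoffel c g l j k) p - partial c j (christoffel c g l i k) p
     + (\<Sum>m\<in>UNIV. christoffel c g l i m p * christoffel c g m j k p
                  - christoffel c g l j m p * christoffel c g m i k p)"

definition ricci ::
  "('m, 'n::finite) chart \<Rightarrow> 'm metric_field \<Rightarrow> 'm \<Rightarrow> 'm tangent_vector \<Rightarrow> 'm tangent_vector \<Rightarrow> real"
  where
  "ricci c g p Y Z =
     (\<Sum>j\<in>UNIV. \<Sum>k\<in>UNIV. (\<Sum>i\<in>UNIV. riemann c g i k i j p) * component c j Y * component c k Z)"

definition hessian ::
  "('m, 'n::finite) chart \<Rightarrow> 'm metric_field \<Rightarrow> ('m \<Rightarrow> real) \<Rightarrow> 'n \<Rightarrow> 'n \<Rightarrow> 'm \<Rightarrow> real" where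
  "hessian c g f i j p =
     partial c i (partial c j f) p - (\<Sum>k\<in>UNIV. christoffel c g k i j p * partial c k f p)"

definition laplacian ::
  "('m, 'n::finite) chart \<Rightarrow> 'm metric_field \<Rightarrow> ('m \<Rightarrow> real) \<Rightarrow> 'm \<Rightarrow> real" where
  "laplacian c g f p =
     (\<Sum>i\<in>UNIV. \<Sum>j\<in>UNIV. inverse_metric_coeff c g i j p * hessian c g f i j p)"


section \<open>Ricci flow and heat equation\<close>

text \<open>Time derivatives are one-sided at the end points of \<open>{0..T}\<close>.\<close>

definition ricci_flow ::
  "('m, 'n::finite) chart set \<Rightarrow> real \<Rightarrow> (real \<Rightarrow> 'm metric_field) \<Rightarrow> bool" where
  "ricci_flow A T g \<longleftrightarrow> metric_family A T g \<and>
     (\<forall>c\<in>A. \<forall>x\<in>chart_dom c. \<forall>t\<in>{0..T}. \<forall>X\<in>tangent_space A x. \<forall>Y\<in>tangent_space A x.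
        ((\<lambda>s. g s x X Y) has_real_derivative - ricci c (g t) x X Y) (at t within {0..T}))"

definition heat_equation ::
  "('m, 'n::finite) chart set \<Rightarrow> real \<Rightarrow> (real \<Rightarrow> 'm metric_field) \<Rightarrow> ('m \<Rightarrow> real \<Rightarrow> real) \<Rightarrow> bool"
  where
  "heat_equation A T g u \<longleftrightarrow>
     (\<forall>c\<in>A. \<forall>x\<in>chart_dom c. \<forall>t\<in>{0..T}.
        ((\<lambda>s. u x s) has_real_derivative (1/2) * laplacian c (g t) (\<lambda>y. u y t) x)
          (at t within {0..T}))"

end

(* Put f = ln u. The left-hand side is F = -\<Delta>f, and the heat equation reads
   2 f_t = \<Delta>f + |\<nabla>f|^2. Along the flow the Laplacian of a fixed function changes by <Ric, Hess> only:
   the term with the time derivative of the Christoffel symbols vanishes by the contracted Bianchi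
   identity. With Bochner's formula this gives
     2 F_t = \<Delta>F + 2 <\<nabla>f, \<nabla>F> - 2 (|Hess f|^2 + <Ric, Hess f> + Ric(\<nabla>f, \<nabla>f)),
   and |Hess f|^2 + <Ric, Hess f> \<ge> (|Hess f|^2 - |Ric|^2) / 2 \<ge> (F^2 - k^2 n^2) / (2 n). So at a maximum
   of (t - \<epsilon>) (F - k n) over M \<times> [\<epsilon>, T] this function is at most 2 n; let \<epsilon> tend to 0.
   Evaluating the Laplacian by the heat equation shows that F does not depend on the chart.

   The tensor calculus only uses that functions form a commutative ring with commuting derivations,
   a connection that is torsion-free and metric, and the flow equation; it is applied to germs of
   smooth functions of space and time. *)
theory Submission
  imports Defs
begin

section \<open>Tensor calculus over a ring with derivations\<close>

text \<open>The evolution equation involves fourth space derivatives of ln u, and it is needed also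
  at the final time \<open>T\<close>, where only earlier times are available. Identities between
  functions must therefore be differentiated repeatedly, up to a boundary in time. As identities
  between germs that look only into the past they can be differentiated freely, with no domain or
  smoothness conditions left over. The price is that a commutative ring offers no division: factors
  2 are carried along instead of being cancelled, the reciprocal of u enters as a germ, and so does
  the 1/2 of the Christoffel symbols. The bound comes from comparison with an ordinary differential
  equation. With K = k n, at a spatial maximum 2 n F' \<le> K^2 - F^2 = - (F - K) (F + K), so y = F
  - K satisfies y' \<le> - y^2 / (2 n) where y > 0, and 2 n / t is the solution that starts from
  infinity. The weight t - \<epsilon> in place of t keeps the search for a maximum inside positive
  times, since a germ needs a past.\<close>

lemma sum_swap12:
  fixes f :: "'n::finite \<Rightarrow> 'n \<Rightarrow> 'a::comm_monoid_add"
  shows "(\<Sum>i\<in>UNIV. \<Sum>j\<in>UNIV. f i j) = (\<Sum>i\<in>UNIV. \<Sum>j\<in>UNIV. f j i)"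
  by (rule sum.swap)

lemma sum3_swap12:
  fixes f :: "'n::finite \<Rightarrow> 'n \<Rightarrow> 'n \<Rightarrow> 'a::comm_monoid_add"
  shows "(\<Sum>i\<in>UNIV. \<Sum>j\<in>UNIV. \<Sum>k\<in>UNIV. f i j k) = (\<Sum>i\<in>UNIV. \<Sum>j\<in>UNIV. \<Sum>k\<in>UNIV. f j i k)"
  by (rule sum.swap)

lemma sum3_swap23:
  fixes f :: "'n::finite \<Rightarrow> 'n \<Rightarrow> 'n \<Rightarrow> 'a::comm_monoid_add"
  shows "(\<Sum>i\<in>UNIV. \<Sum>j\<in>UNIV. \<Sum>k\<in>UNIV. f i j k) = (\<Sum>i\<in>UNIV. \<Sum>j\<in>UNIV. \<Sum>k\<in>UNIV. f i k j)"
  by (rule sum.cong[OF refl sum.swap])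

lemma sum3_swap13:
  fixes f :: "'n::finite \<Rightarrow> 'n \<Rightarrow> 'n \<Rightarrow> 'a::comm_monoid_add"
  shows "(\<Sum>i\<in>UNIV. \<Sum>j\<in>UNIV. \<Sum>k\<in>UNIV. f i j k) = (\<Sum>i\<in>UNIV. \<Sum>j\<in>UNIV. \<Sum>k\<in>UNIV. f k j i)"
  by (subst sum3_swap12, subst sum3_swap23, subst sum3_swap12, rule refl)

locale derivation =
  fixes D :: "'a::comm_ring_1 \<Rightarrow> 'a"
  assumes add: "D (x + y) = D x + D y"
    and mult: "D (x * y) = D x * y + x * D y"
begin

lemma zero: "D 0 = 0"
  using add[of 0 0] by simp

lemma one: "D 1 = 0"
  using mult[of 1 1] by simp

lemma minus: "D (- x) = - D x"
  using add[of x "- x"] zero by (simp add: eq_neg_iff_add_eq_0 add.commute)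

lemma diff: "D (x - y) = D x - D y"
  using add[of x "- y"] minus by simp

lemma sum: "D (\<Sum>i\<in>I. f i) = (\<Sum>i\<in>I. D (f i))"
  by (induction I rule: infinite_finite_induct) (auto simp: zero add)

lemma two: "D (2 * x) = 2 * D x"
  by (simp only: mult_2 add)

lemma const_two: "D 2 = 0"
  using add[of 1 1] one by simp

lemma delta: "D (if P then 1 else 0) = 0"
  by (simp add: one zero)

lemmas rules = zero one minus diff sum const_two two add mult

end

text \<open>The elements of the ring \<open>'a\<close> play the role of functions near a point of a coordinate
  chart, \<open>d i\<close> that of the \<open>i\<close>-th coordinate derivative. \<open>G l i j\<close> is \<open>\<Gamma>^l_ij\<close>.
  Only torsion-freeness and compatibility with the metric are needed about it.\<close>

locale metric_ring =
  fixes d :: "'n::finite \<Rightarrow> 'a::comm_ring_1 \<Rightarrow> 'a"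
    and g gi :: "'n \<Rightarrow> 'n \<Rightarrow> 'a"
    and G :: "'n \<Rightarrow> 'n \<Rightarrow> 'n \<Rightarrow> 'a"
  assumes deriv: "derivation (d i)"
    and comm: "d i (d j x) = d j (d i x)"
    and g_sym: "g i j = g j i"
    and gi_sym: "gi i j = gi j i"
    and inv: "(\<Sum>j\<in>UNIV. gi i j * g j k) = (if i = k then 1 else 0)"
    and G_sym: "G l i j = G l j i"
    and compat: "d i (g j k) = (\<Sum>l\<in>UNIV. G l i j * g l k) + (\<Sum>l\<in>UNIV. G l i k * g j l)"
begin

lemmas dr = derivation.rules[OF deriv]

text \<open>Transposing \<open>inv\<close> turns the left inverse into a right inverse, because both
  matrices are symmetric.\<close>

lemma inv': "(\<Sum>j\<in>UNIV. g i j * gi j k) = (if i = k then 1 else 0)"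
  proof -
  have "(\<Sum>j\<in>UNIV. g i j * gi j k) = (\<Sum>j\<in>UNIV. gi k j * g j i)"
    by (intro sum.cong refl) (metis g_sym gi_sym mult.commute)
  then show ?thesis
    using inv[of k i] by auto
qed

lemma raise_lower: "(\<Sum>j\<in>UNIV. gi i j * (\<Sum>k\<in>UNIV. g j k * x k)) = x i"
proof -
  have "(\<Sum>j\<in>UNIV. gi i j * (\<Sum>k\<in>UNIV. g j k * x k)) = (\<Sum>j\<in>UNIV. \<Sum>k\<in>UNIV. gi i j * g j k * x k)"
    by (simp add: sum_distrib_left mult.assoc)
  also have "\<dots> = (\<Sum>k\<in>UNIV. (\<Sum>j\<in>UNIV. gi i j * g j k) * x k)"
    by (subst sum.swap) (simp add: sum_distrib_right)
  also have "\<dots> = x i"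
    by (simp add: inv if_distrib[of "\<lambda>a. a * _"] cong: if_cong)
  finally show ?thesis .
qed

text \<open>Differentiate \<open>gi g = 1\<close> and multiply by \<open>gi\<close> from the right.
  The derivation is arbitrary because the formula serves both the coordinate derivatives and the
  time derivative.\<close>

lemma derivation_inverse:
  assumes "derivation D"
  shows "D (gi a e) = - (\<Sum>b\<in>UNIV. \<Sum>c\<in>UNIV. gi a b * D (g b c) * gi c e)"
proof -
  interpret D: derivation D by fact
  have 1: "(\<Sum>b\<in>UNIV. D (gi a b) * g b c) = - (\<Sum>b\<in>UNIV. gi a b * D (g b c))" for c
  proof -
    have "D (\<Sum>b\<in>UNIV. gi a b * g b c) = 0"
      by (simp only: inv D.delta)
    then show ?thesis
      by (simp add: D.sum D.mult sum.distrib eq_neg_iff_add_eq_0)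
  qed
  have "(\<Sum>c\<in>UNIV. (\<Sum>b\<in>UNIV. D (gi a b) * g b c) * gi c e)
      = (\<Sum>b\<in>UNIV. D (gi a b) * (\<Sum>c\<in>UNIV. g b c * gi c e))"
    unfolding sum_distrib_left sum_distrib_right mult.assoc by (rule sum.swap)
  also have "\<dots> = D (gi a e)"
    by (simp add: inv' if_distrib[of "\<lambda>a. _ * a"] cong: if_cong)
  finally have "D (gi a e) = (\<Sum>c\<in>UNIV. - (\<Sum>b\<in>UNIV. gi a b * D (g b c)) * gi c e)"
    by (simp only: 1)
  also have "\<dots> = - (\<Sum>c\<in>UNIV. \<Sum>b\<in>UNIV. gi a b * D (g b c) * gi c e)"
    by (simp add: sum_negf sum_distrib_right)
  finally show ?thesis
    by (simp only: sum.swap[of "\<lambda>c b. gi a b * D (g b c) * gi c e"])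
qed

text \<open>The inverse metric is parallel. Metric compatibility is substituted into
  \<open>derivation_inverse\<close>; in each of the two resulting terms one product of
  \<open>gi\<close> with \<open>g\<close> collapses.\<close>

lemma d_inverse:
  "d k (gi a e) = - (\<Sum>l\<in>UNIV. G a k l * gi l e) - (\<Sum>l\<in>UNIV. G e k l * gi a l)"
proof -
  have "(\<Sum>b\<in>UNIV. \<Sum>c\<in>UNIV. gi a b * d k (g b c) * gi c e)
     = (\<Sum>b\<in>UNIV. \<Sum>c\<in>UNIV. gi a b * (\<Sum>l\<in>UNIV. G l k b * g l c) * gi c e)
     + (\<Sum>b\<in>UNIV. \<Sum>c\<in>UNIV. gi a b * (\<Sum>l\<in>UNIV. G l k c * g b l) * gi c e)"
    by (simp add: compat sum.distrib algebra_simps)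
  also have "(\<Sum>b\<in>UNIV. \<Sum>c\<in>UNIV. gi a b * (\<Sum>l\<in>UNIV. G l k b * g l c) * gi c e)
     = (\<Sum>b\<in>UNIV. gi a b * (\<Sum>c\<in>UNIV. gi e c * (\<Sum>l\<in>UNIV. g c l * G l k b)))"
    by (simp add: sum_distrib_left sum_distrib_right gi_sym[of e] g_sym mult_ac)
  also have "\<dots> = (\<Sum>l\<in>UNIV. G e k l * gi a l)"
    by (simp add: raise_lower mult.commute)
  also have "(\<Sum>b\<in>UNIV. \<Sum>c\<in>UNIV. gi a b * (\<Sum>l\<in>UNIV. G l k c * g b l) * gi c e)
     = (\<Sum>c\<in>UNIV. (\<Sum>b\<in>UNIV. gi a b * (\<Sum>l\<in>UNIV. g b l * G l k c)) * gi c e)"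
    by (subst sum.swap) (simp add: sum_distrib_left sum_distrib_right mult_ac)
  also have "\<dots> = (\<Sum>l\<in>UNIV. G a k l * gi l e)"
    by (simp add: raise_lower)
  finally show ?thesis
    by (simp add: derivation_inverse[OF deriv])
qed

section \<open>Covariant derivatives and metric traces\<close>

definition cov1 :: "'n \<Rightarrow> ('n \<Rightarrow> 'a) \<Rightarrow> 'n \<Rightarrow> 'a" where
  "cov1 k \<alpha> i = d k (\<alpha> i) - (\<Sum>m\<in>UNIV. G m k i * \<alpha> m)"

definition cov2 :: "'n \<Rightarrow> ('n \<Rightarrow> 'n \<Rightarrow> 'a) \<Rightarrow> 'n \<Rightarrow> 'n \<Rightarrow> 'a" where
  "cov2 k S i j = d k (S i j) - (\<Sum>m\<in>UNIV. G m k i * S m j) - (\<Sum>m\<in>UNIV. G m k j * S i m)"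

definition tr :: "('n \<Rightarrow> 'n \<Rightarrow> 'a) \<Rightarrow> 'a" where
  "tr S = (\<Sum>i\<in>UNIV. \<Sum>j\<in>UNIV. gi i j * S i j)"

lemma tr_cong: "(\<And>i j. S i j = S' i j) \<Longrightarrow> tr S = tr S'"
  by (simp add: tr_def)

lemma tr_add: "tr (\<lambda>i j. S i j + S' i j) = tr S + tr S'"
  and tr_diff: "tr (\<lambda>i j. S i j - S' i j) = tr S - tr S'"
  and tr_minus: "tr (\<lambda>i j. - S i j) = - tr S"
  and tr_scale: "tr (\<lambda>i j. c * S i j) = c * tr S"
  and tr_scale': "tr (\<lambda>i j. S i j * c) = tr S * c"
  by (simp_all add: tr_def sum.distrib sum_subtractf sum_negf sum_distrib_left sum_distrib_right
      distrib_left right_diff_distrib mult_ac)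

lemma tr_sum: "tr (\<lambda>i j. \<Sum>m\<in>I. S m i j) = (\<Sum>m\<in>I. tr (S m))"
  proof -
  have "tr (\<lambda>i j. 0) = 0" by (simp add: tr_def)
  then show ?thesis
    by (induction I rule: infinite_finite_induct) (simp_all add: tr_add)
qed

lemma tr_transpose: "tr (\<lambda>i j. S j i) = tr S"
  unfolding tr_def by (subst sum_swap12) (simp add: gi_sym)

text \<open>Contraction with a parallel tensor commutes with covariant differentiation: the
  Christoffel terms produced by \<open>d_inverse\<close> become, after renaming indices, those of
  \<open>cov2\<close>.\<close>

lemma d_tr: "d k (tr S) = tr (cov2 k S)"
proof -
  have "d k (tr S) = tr (\<lambda>i j. d k (S i j))
      - (\<Sum>i\<in>UNIV. \<Sum>j\<in>UNIV. \<Sum>l\<in>UNIV. G i k l * gi l j * S i j)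
      - (\<Sum>i\<in>UNIV. \<Sum>j\<in>UNIV. \<Sum>l\<in>UNIV. G j k l * gi i l * S i j)"
    by (simp add: tr_def dr d_inverse sum.distrib sum_subtractf left_diff_distrib sum_distrib_right sum_negf)
  also have "(\<Sum>i\<in>UNIV. \<Sum>j\<in>UNIV. \<Sum>l\<in>UNIV. G i k l * gi l j * S i j) = tr (\<lambda>i j. \<Sum>m\<in>UNIV. G m k i * S m j)"
    unfolding tr_def by (subst sum3_swap13) (simp add: sum_distrib_left mult_ac)
  also have "(\<Sum>i\<in>UNIV. \<Sum>j\<in>UNIV. \<Sum>l\<in>UNIV. G j k l * gi i l * S i j) = tr (\<lambda>i j. \<Sum>m\<in>UNIV. G m k j * S i m)"
    unfolding tr_def by (subst sum3_swap23) (simp add: sum_distrib_left mult_ac)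
  finally show ?thesis
    by (simp add: cov2_def[abs_def] tr_diff)
qed

lemma cov2_mult: "cov2 k (\<lambda>i j. \<alpha> i * \<beta> j) i j = cov1 k \<alpha> i * \<beta> j + \<alpha> i * cov1 k \<beta> j"
  by (simp add: cov1_def cov2_def dr sum_distrib_left sum_distrib_right algebra_simps)

text \<open>In \<open>cov2 l (S k)\<close> the index \<open>k\<close> is only a label. The extra
  Christoffel term makes it a tensor index, so this is the covariant derivative of a tensor with
  three lower indices, in direction \<open>l\<close>.\<close>

definition cov3 :: "'n \<Rightarrow> ('n \<Rightarrow> 'n \<Rightarrow> 'n \<Rightarrow> 'a) \<Rightarrow> 'n \<Rightarrow> 'n \<Rightarrow> 'n \<Rightarrow> 'a" where
  "cov3 l S k i j = cov2 l (S k) i j - (\<Sum>m\<in>UNIV. G m l k * S m i j)"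

lemma cov1_tr: "cov1 l (\<lambda>k. tr (S k)) k = tr (cov3 l S k)"
  by (simp add: cov1_def cov3_def[abs_def] d_tr tr_diff tr_sum tr_scale)

lemma cov3_mult: "cov3 l (\<lambda>k i j. S k i * \<beta> j) k i j = cov2 l S k i * \<beta> j + S k i * cov1 l \<beta> j"
  by (simp add: cov1_def cov2_def cov3_def dr sum_distrib_left sum_distrib_right algebra_simps)

section \<open>Curvature, its symmetries and the Bianchi identities\<close>

text \<open>\<open>R l k i j\<close> is the coefficient of \<open>\<partial>_l\<close> in \<open>R(\<partial>_i, \<partial>_j) \<partial>_k\<close>.\<close>

definition R :: "'n \<Rightarrow> 'n \<Rightarrow> 'n \<Rightarrow> 'n \<Rightarrow> 'a" where
  "R l k i j = d i (G l j k) - d j (G l i k)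
     + (\<Sum>m\<in>UNIV. G l i m * G m j k - G l j m * G m i k)"

definition Ric :: "'n \<Rightarrow> 'n \<Rightarrow> 'a" where
  "Ric j k = (\<Sum>i\<in>UNIV. R i k i j)"

lemma R_antisym: "R l k i j = - R l k j i"
  by (simp add: R_def sum_subtractf)

text \<open>This is [d_i, d_j] g_pk = 0, expanded by metric compatibility. The local
  \<open>L\<close> are the Christoffel symbols of the first kind; \<open>LG\<close> makes the
  surplus quadratic terms cancel.\<close>

lemma R_lower_antisym: "(\<Sum>m\<in>UNIV. g p m * R m k i j) = - (\<Sum>m\<in>UNIV. g k m * R m p i j)"
proof -
  define L where "L k i j = (\<Sum>m\<in>UNIV. g k m * G m i j)" for k i j
  have dg: "d i (g j k) = L k i j + L j i k" for i j k
    by (simp add: compat L_def mult.commute g_sym[of k])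
  have dL: "d i (L l j k) = (\<Sum>m\<in>UNIV. L m i l * G m j k) + (\<Sum>m\<in>UNIV. L l i m * G m j k)
      + (\<Sum>m\<in>UNIV. g l m * d i (G m j k))" for i j k l
    by (simp add: L_def[of l j k] dr dg sum.distrib algebra_simps)
  have LG: "(\<Sum>m\<in>UNIV. L m i l * G m j k) = (\<Sum>m\<in>UNIV. L m j k * G m i l)" for i j k l
    unfolding L_def sum_distrib_right
    by (subst sum_swap12) (simp add: g_sym mult_ac)
  have LR: "(\<Sum>m\<in>UNIV. g p m * R m k i j) =
     (\<Sum>m\<in>UNIV. g p m * d i (G m j k)) - (\<Sum>m\<in>UNIV. g p m * d j (G m i k))
     + (\<Sum>m\<in>UNIV. L p i m * G m j k) - (\<Sum>m\<in>UNIV. L p j m * G m i k)" for p k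
  proof -
    have *: "(\<Sum>m\<in>UNIV. g p m * (\<Sum>q\<in>UNIV. G m i q * G q j k)) = (\<Sum>m\<in>UNIV. L p i m * G m j k)" for i j
      unfolding L_def sum_distrib_right sum_distrib_left
      by (subst sum_swap12) (simp add: mult_ac)
    show ?thesis
      by (simp add: R_def sum_subtractf sum.distrib distrib_left right_diff_distrib *)
  qed
  have "d i (d j (g p k)) = d j (d i (g p k))"
    by (rule comm)
  then show ?thesis
    unfolding LR
    by (simp add: dg dr dL LG[of i _ j] eq_neg_iff_add_eq_0) (simp add: algebra_simps)
qed

text \<open>Raise and lower the index \<open>m\<close>, then use the antisymmetry in the lowered
  pair: the metric contraction becomes the one that defines \<open>Ric\<close>, with a minus sign.
  Both the Bochner formula and the contracted Bianchi identity need curvature contracted in this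
  way.\<close>

lemma tr_R: "tr (\<lambda>k l. R m l k i) = - (\<Sum>p\<in>UNIV. gi m p * Ric i p)"
proof -
  have "tr (\<lambda>k l. R m l k i) = tr (\<lambda>k l. \<Sum>p\<in>UNIV. gi m p * (\<Sum>q\<in>UNIV. g p q * R q l k i))"
    by (simp add: raise_lower)
  also have "\<dots> = - (\<Sum>p\<in>UNIV. gi m p * tr (\<lambda>k l. \<Sum>q\<in>UNIV. g l q * R q p k i))"
    by (subst R_lower_antisym) (simp add: tr_sum tr_scale tr_minus sum_negf)
  also have "(\<lambda>p. tr (\<lambda>k l. \<Sum>q\<in>UNIV. g l q * R q p k i)) = Ric i"
    by (simp add: tr_def raise_lower Ric_def fun_eq_iff)
  finally show ?thesis by (simp add: fun_eq_iff)
qed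

definition covR :: "'n \<Rightarrow> 'n \<Rightarrow> 'n \<Rightarrow> 'n \<Rightarrow> 'n \<Rightarrow> 'a" where
  "covR m l k i j = d m (R l k i j) + (\<Sum>p\<in>UNIV. G l m p * R p k i j) - (\<Sum>p\<in>UNIV. G p m k * R l p i j)
     - (\<Sum>p\<in>UNIV. G p m i * R l k p j) - (\<Sum>p\<in>UNIV. G p m j * R l k i p)"

text \<open>The part \<open>b\<close> of the covariant derivative acts only on the endomorphism
  indices \<open>l\<close>, \<open>k\<close>. The Christoffel terms for the two form indices cancel
  in the cyclic sum because the connection is torsion-free.\<close>

lemma bianchi: "covR m l k i j + covR i l k j m + covR j l k m i = 0"
proof -
  define b where "b m i j = d m (R l k i j) + (\<Sum>p\<in>UNIV. G l m p * R p k i j) - (\<Sum>p\<in>UNIV. G p m k * R l p i j)"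
    for m i j
  define q where "q i j l k = (\<Sum>p\<in>UNIV. G l i p * G p j k)" for i j k l
  have Rq: "R l k i j = d i (G l j k) - d j (G l i k) + q i j l k - q j i l k" for l k i j
    by (simp add: R_def q_def sum_subtractf)
  have dq: "d m (q i j l k) = (\<Sum>p\<in>UNIV. d m (G l i p) * G p j k) + (\<Sum>p\<in>UNIV. d m (G p j k) * G l i p)" for m i j
    by (simp add: q_def dr sum.distrib mult.commute)
  have qG: "(\<Sum>p\<in>UNIV. G l m p * q i j p k) = (\<Sum>p\<in>UNIV. G p j k * q m i l p)" for m i j
    unfolding q_def sum_distrib_left by (subst sum_swap12) (simp add: mult_ac)
  have s: "covR m l k i j = b m i j - (\<Sum>p\<in>UNIV. G p m i * R l k p j) + (\<Sum>p\<in>UNIV. G p m j * R l k p i)" for m i j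
    by (simp add: covR_def b_def R_antisym[of l k i] sum_negf)
  \<comment> \<open>The Bianchi identity for the curvature of a matrix of connection forms: second
    derivatives cancel by \<open>comm\<close>, and the cubic terms by associativity of the matrix
    product, which is \<open>qG\<close>.\<close>
  have b0: "b m i j + b i j m + b j m i = 0"
    unfolding b_def Rq
    by (simp add: dr dq distrib_left right_diff_distrib sum.distrib sum_subtractf qG mult.commute comm[of j m]  comm[of i m] comm[of j i])
  have "covR m l k i j + covR i l k j m + covR j l k m i = b m i j + b i j m + b j m i"
    by (simp add: s G_sym[of _ i m] G_sym[of _ j m] G_sym[of _ j i])
  then show ?thesis using b0 by simp
qed

text \<open>In the contraction of an upper with a lower index the two Christoffel corrections for
  these indices cancel.\<close>

lemma cov2_Ric_trace: "(\<Sum>j\<in>UNIV. covR i j k j m) = cov2 i Ric m k"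
proof -
  have "(\<Sum>j\<in>UNIV. \<Sum>p\<in>UNIV. G j i p * R p k j m) = (\<Sum>j\<in>UNIV. \<Sum>p\<in>UNIV. G p i j * R j k p m)"
    by (rule sum_swap12)
  moreover have "(\<Sum>j\<in>UNIV. \<Sum>p\<in>UNIV. G p i l * R j q j p) = (\<Sum>p\<in>UNIV. G p i l * Ric p q)" for l q
    unfolding Ric_def sum_distrib_left by (rule sum_swap12)
  moreover have "(\<Sum>j\<in>UNIV. \<Sum>p\<in>UNIV. G p i l * R j p j q) = (\<Sum>p\<in>UNIV. G p i l * Ric q p)" for l q
    unfolding Ric_def sum_distrib_left by (rule sum_swap12)
  ultimately show ?thesis
    by (simp add: covR_def cov2_def sum.distrib sum_subtractf) (simp add: Ric_def dr)
qed

text \<open>Contract the upper index in \<open>bianchi\<close> with one of the form indices. Two of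
  the three terms become derivatives of \<open>Ric\<close>, the second with a minus sign from the
  antisymmetry of the form indices; the third remains a divergence.\<close>

lemma bianchi_traced: "cov2 i Ric m k - cov2 m Ric i k + (\<Sum>j\<in>UNIV. covR j j k m i) = 0"
proof -
  have "(\<Sum>j\<in>UNIV. covR m j k i j) = - (\<Sum>j\<in>UNIV. covR m j k j i)"
  proof -
    have "covR m l k i j = - covR m l k j i" for l j
      unfolding covR_def by (simp add: R_antisym[of _ _ i] R_antisym[of _ _ _ j] dr sum_negf)
    then show ?thesis by (simp add: sum_negf)
  qed
  moreover have "(\<Sum>j\<in>UNIV. covR i j k j m + covR j j k m i + covR m j k i j) = 0"
    by (simp add: bianchi)
  ultimately show ?thesis
    by (simp add: sum.distrib cov2_Ric_trace algebra_simps)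
qed

text \<open>Divergence of a mixed tensor whose first index is upper. The metric trace of the
  curvature and the raised Ricci tensor are the same mixed tensor; computing its divergence from
  each expression is what evaluates the third term of \<open>bianchi_traced\<close>.\<close>

definition dvg :: "('n \<Rightarrow> 'n \<Rightarrow> 'a) \<Rightarrow> 'n \<Rightarrow> 'a" where
  "dvg P m = (\<Sum>j\<in>UNIV. d j (P j m) + (\<Sum>p\<in>UNIV. G j j p * P p m) - (\<Sum>p\<in>UNIV. G p j m * P j p))"

lemma dvg_tr_R: "dvg (\<lambda>j m. tr (\<lambda>i k. R j k m i)) m = tr (\<lambda>i k. \<Sum>j\<in>UNIV. covR j j k m i)"
proof -
  have "d j (tr (\<lambda>i k. R j k m i)) = tr (\<lambda>i k. d j (R j k m i)
         - (\<Sum>p\<in>UNIV. G p j k * R j p m i) - (\<Sum>p\<in>UNIV. G p j i * R j k m p))" for j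
    by (simp add: d_tr cov2_def[abs_def] diff_diff_eq add.commute)
  then show ?thesis
    by (simp add: dvg_def covR_def tr_sum tr_add tr_diff tr_scale sum.distrib sum_subtractf)
qed

text \<open>Raising an index commutes with the divergence, again because \<open>gi\<close> is
  parallel.\<close>

lemma dvg_raise: "dvg (\<lambda>j m. \<Sum>p\<in>UNIV. gi j p * S m p) m = tr (\<lambda>j p. cov2 j S m p)"
proof -
  have 1: "d j (\<Sum>p\<in>UNIV. gi j p * S m p) = (\<Sum>p\<in>UNIV. gi j p * d j (S m p))
     - (\<Sum>p\<in>UNIV. \<Sum>l\<in>UNIV. G j j l * gi l p * S m p) - (\<Sum>p\<in>UNIV. \<Sum>l\<in>UNIV. G p j l * gi j l * S m p)" for j
    by (simp add: dr d_inverse sum.distrib sum_subtractf left_diff_distrib sum_distrib_right sum_negf)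
  have 2: "(\<Sum>p\<in>UNIV. \<Sum>l\<in>UNIV. G j j l * gi l p * S m p) = (\<Sum>l\<in>UNIV. G j j l * (\<Sum>p\<in>UNIV. gi l p * S m p))" for j
    unfolding sum_distrib_left mult.assoc by (rule sum_swap12)
  have 3: "(\<Sum>p\<in>UNIV. \<Sum>l\<in>UNIV. G p j l * gi j l * S m p) = (\<Sum>p\<in>UNIV. gi j p * (\<Sum>l\<in>UNIV. G l j p * S m l))" for j
    unfolding sum_distrib_left by (subst sum_swap12) (simp add: mult_ac)
  have 4: "(\<Sum>p\<in>UNIV. G p j m * (\<Sum>l\<in>UNIV. gi j l * S p l)) = (\<Sum>p\<in>UNIV. gi j p * (\<Sum>l\<in>UNIV. G l j m * S l p))" for j
    unfolding sum_distrib_left by (subst sum_swap12) (simp add: mult_ac)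
  have "tr (\<lambda>j p. cov2 j S m p) = (\<Sum>j\<in>UNIV. (\<Sum>p\<in>UNIV. gi j p * d j (S m p))
     - (\<Sum>p\<in>UNIV. gi j p * (\<Sum>l\<in>UNIV. G l j m * S l p)) - (\<Sum>p\<in>UNIV. gi j p * (\<Sum>l\<in>UNIV. G l j p * S m l)))"
    by (simp only: tr_def cov2_def right_diff_distrib sum_subtractf)
  then show ?thesis
    unfolding dvg_def 1 2 3 4 by (simp add: sum_subtractf)
qed

text \<open>Trace \<open>bianchi_traced\<close> once more: its first and third terms each give the
  divergence of \<open>Ric\<close>, its second gives the derivative of the scalar curvature.\<close>

theorem contracted_bianchi:
  "2 * tr (\<lambda>i k. cov2 i Ric m k) = d m (tr Ric)"
proof -
  have *: "tr (\<lambda>i k. R j k m i) = (\<Sum>p\<in>UNIV. gi j p * Ric m p)" for j m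
  proof -
    have "tr (\<lambda>i k. R j k m i) = - tr (\<lambda>i k. R j k i m)"
      by (subst R_antisym) (rule tr_minus)
    also have "\<dots> = (\<Sum>p\<in>UNIV. gi j p * Ric m p)"
      using tr_R[of j m] by simp
    finally show ?thesis .
  qed
  have "tr (\<lambda>i k. \<Sum>j\<in>UNIV. covR j j k m i) = dvg (\<lambda>j m. tr (\<lambda>i k. R j k m i)) m"
    by (rule dvg_tr_R[symmetric])
  also have "\<dots> = tr (\<lambda>j p. cov2 j Ric m p)"
    by (simp only: * dvg_raise)
  finally have "tr (\<lambda>i k. \<Sum>j\<in>UNIV. covR j j k m i) = tr (\<lambda>j p. cov2 j Ric m p)" .
  moreover have "tr (\<lambda>i k. cov2 i Ric m k - cov2 m Ric i k + (\<Sum>j\<in>UNIV. covR j j k m i)) = 0"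
    unfolding bianchi_traced by (simp add: tr_def)
  ultimately show ?thesis
    unfolding mult_2 by (simp add: tr_add tr_diff d_tr algebra_simps)
qed

section \<open>Hessian, Laplacian and the Bochner formula\<close>

definition Hess :: "'a \<Rightarrow> 'n \<Rightarrow> 'n \<Rightarrow> 'a" where
  "Hess f i j = cov1 i (\<lambda>j. d j f) j"

definition Lap :: "'a \<Rightarrow> 'a" where
  "Lap f = tr (Hess f)"

definition ip1 :: "('n \<Rightarrow> 'a) \<Rightarrow> ('n \<Rightarrow> 'a) \<Rightarrow> 'a" where
  "ip1 \<alpha> \<beta> = tr (\<lambda>i j. \<alpha> i * \<beta> j)"

definition ip2 :: "('n \<Rightarrow> 'n \<Rightarrow> 'a) \<Rightarrow> ('n \<Rightarrow> 'n \<Rightarrow> 'a) \<Rightarrow> 'a" where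
  "ip2 S S' = tr (\<lambda>i j. tr (\<lambda>k l. S i k * S' j l))"

text \<open>The value of S(X, X) for the vector X dual to \<open>\<alpha>\<close>, written as an
  inner product with the tensor square of \<open>\<alpha>\<close> so that it can be expanded in a
  frame like any other \<open>ip2\<close>.\<close>

definition appl :: "('n \<Rightarrow> 'n \<Rightarrow> 'a) \<Rightarrow> ('n \<Rightarrow> 'a) \<Rightarrow> 'a" where
  "appl S \<alpha> = ip2 S (\<lambda>i j. \<alpha> i * \<alpha> j)"

lemma Hess_eq: "Hess f i = cov1 i (\<lambda>j. d j f)"
  by (simp add: Hess_def fun_eq_iff)

lemma tr_tr: "tr (\<lambda>i j. tr (\<lambda>k l. F i j k l)) = tr (\<lambda>k l. tr (\<lambda>i j. F i j k l))"
  by (simp add: tr_def[of "F _ _"] tr_sum tr_scale) (simp add: tr_def)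

lemma Hess_sym: "Hess f i j = Hess f j i"
  by (simp add: Hess_def cov1_def comm[of i] G_sym[of _ i])

lemma Lap_add: "Lap (x + y) = Lap x + Lap y"
  by (simp add: Lap_def tr_add[symmetric] Hess_def[abs_def] cov1_def dr distrib_left sum.distrib algebra_simps)

lemma Lap_minus: "Lap (- x) = - Lap x"
  by (simp add: Lap_def tr_minus[symmetric] Hess_def[abs_def] cov1_def dr sum_negf)

lemma d_ip1: "d k (ip1 \<alpha> \<beta>) = ip1 (cov1 k \<alpha>) \<beta> + ip1 \<alpha> (cov1 k \<beta>)"
  by (simp add: ip1_def d_tr cov2_mult tr_add cong: tr_cong)

text \<open>The third derivatives of \<open>f\<close> and the Christoffel terms for the
  antisymmetrized pair cancel by \<open>comm\<close> and \<open>G_sym\<close>; what is left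
  multiplying the first derivatives is the curvature.\<close>

lemma ricci_identity:
  "cov2 l (Hess f) i k - cov2 i (Hess f) l k = - (\<Sum>m\<in>UNIV. R m k l i * d m f)"
proof -
  have "(\<Sum>m\<in>UNIV. G m l k * (\<Sum>p\<in>UNIV. G p i m * d p f)) = (\<Sum>p\<in>UNIV. (\<Sum>m\<in>UNIV. G p i m * G m l k) * d p f)" for i l
    unfolding sum_distrib_left sum_distrib_right by (subst sum_swap12) (simp add: mult_ac)
  then show ?thesis
    by (simp add: cov2_def Hess_def cov1_def dr R_def G_sym[of _ i l] comm[of i l] sum.distrib sum_subtractf
       left_diff_distrib right_diff_distrib distrib_right distrib_left)
qed

text \<open>Here \<open>\<omega>\<close> is half the differential of the squared gradient. Its
  covariant derivative splits into the square of the Hessian and a third-order term; commuting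
  derivatives in the latter produces the gradient of the Laplacian and, through \<open>tr_R\<close>,
  the Ricci term.\<close>

lemma bochner:
  "Lap (ip1 (\<lambda>i. d i f) (\<lambda>i. d i f)) =
     2 * (ip2 (Hess f) (Hess f) + ip1 (\<lambda>i. d i f) (\<lambda>i. d i (Lap f)) + appl Ric (\<lambda>i. d i f))"
proof -
  define \<omega> where "\<omega> k = tr (\<lambda>i j. Hess f k i * d j f)" for k
  have d1: "d k (ip1 (\<lambda>i. d i f) (\<lambda>i. d i f)) = 2 * \<omega> k" for k
  proof -
    have 1: "ip1 (Hess f k) (\<lambda>i. d i f) = \<omega> k"
      by (simp add: ip1_def \<omega>_def)
    have 2: "ip1 (\<lambda>i. d i f) (Hess f k) = \<omega> k"
      unfolding ip1_def \<omega>_def by (subst tr_transpose[symmetric]) (simp add: mult.commute)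
    show ?thesis
      by (simp only: d_ip1 Hess_eq[symmetric] mult_2 1 2)
  qed
  have c: "cov1 l \<omega> k = tr (\<lambda>i j. cov2 l (Hess f) k i * d j f) + tr (\<lambda>i j. Hess f k i * Hess f l j)" for l k
    unfolding \<omega>_def[abs_def] cov1_tr tr_cong[OF cov3_mult] tr_add Hess_eq ..
  \<comment> \<open>Symmetry of the Hessian brings \<open>i\<close> next to the outer derivative;
    then the Ricci identity exchanges \<open>k\<close> and \<open>i\<close>, so that tracing over
    \<open>k\<close>, \<open>l\<close> leaves the Laplacian under the derivative.\<close>
  have a: "cov2 k (Hess f) l i = cov2 i (Hess f) k l - (\<Sum>m\<in>UNIV. R m l k i * d m f)" for k l i
    using ricci_identity[of k f i l] Hess_sym[of f] by (simp add: cov2_def[of k] algebra_simps)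
  have "Lap (ip1 (\<lambda>i. d i f) (\<lambda>i. d i f)) = 2 * tr (\<lambda>l k. cov1 l \<omega> k)"
    by (simp add: Lap_def Hess_def[abs_def] d1) (simp add: cov1_def dr tr_def sum_distrib_left right_diff_distrib mult_ac)
  also have "tr (\<lambda>l k. cov1 l \<omega> k) = tr (\<lambda>l k. tr (\<lambda>i j. cov2 l (Hess f) k i * d j f)) + ip2 (Hess f) (Hess f)"
    by (simp add: c tr_add ip2_def) (subst (2) tr_transpose[symmetric], simp)
  also have "tr (\<lambda>l k. tr (\<lambda>i j. cov2 l (Hess f) k i * d j f)) = tr (\<lambda>i j. tr (\<lambda>l k. cov2 l (Hess f) k i) * d j f)"
    by (subst tr_tr) (simp add: tr_scale')
  also have "(\<lambda>i. tr (\<lambda>l k. cov2 l (Hess f) k i)) = (\<lambda>i. d i (Lap f) + (\<Sum>m\<in>UNIV. (\<Sum>p\<in>UNIV. gi m p * Ric i p) * d m f))"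
  proof
    fix i
    have "tr (\<lambda>l k. cov2 l (Hess f) k i) = tr (\<lambda>l k. cov2 i (Hess f) l k - (\<Sum>m\<in>UNIV. R m k l i * d m f))"
      by (intro tr_cong a)
    then show "tr (\<lambda>l k. cov2 l (Hess f) k i) = d i (Lap f) + (\<Sum>m\<in>UNIV. (\<Sum>p\<in>UNIV. gi m p * Ric i p) * d m f)"
      by (simp add: tr_diff tr_sum tr_scale' tr_R sum_negf Lap_def d_tr)
  qed
  also have "(\<lambda>i. d i (Lap f) + (\<Sum>m\<in>UNIV. (\<Sum>p\<in>UNIV. gi m p * Ric i p) * d m f))
      = (\<lambda>i. d i (Lap f) + tr (\<lambda>k l. Ric i k * d l f))"
  proof -
    have "(\<Sum>m\<in>UNIV. (\<Sum>p\<in>UNIV. gi m p * Ric i p) * d m f) = tr (\<lambda>k l. Ric i k * d l f)" for i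
      unfolding tr_def sum_distrib_right
      by (subst sum_swap12) (simp add: gi_sym mult_ac)
    then show ?thesis by simp
  qed
  also have "tr (\<lambda>i j. (d i (Lap f) + tr (\<lambda>k l. Ric i k * d l f)) * d j f)
      = ip1 (\<lambda>i. d i f) (\<lambda>i. d i (Lap f)) + appl Ric (\<lambda>i. d i f)"
  proof -
    have "tr (\<lambda>i j. d i (Lap f) * d j f) = ip1 (\<lambda>i. d i f) (\<lambda>i. d i (Lap f))"
      unfolding ip1_def by (subst tr_transpose[symmetric]) (simp add: mult.commute)
    moreover have "tr (\<lambda>i j. tr (\<lambda>k l. Ric i k * d l f) * d j f) = appl Ric (\<lambda>i. d i f)"
      by (simp add: appl_def ip2_def mult_ac tr_scale)
    ultimately show ?thesis by (simp add: distrib_right tr_add)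
  qed
  finally show ?thesis by (simp add: algebra_simps)
qed

end

section \<open>Evolution along the Ricci flow\<close>

locale ricci_flow_ring = metric_ring d g gi G
  for d :: "'n::finite \<Rightarrow> 'a::comm_ring_1 \<Rightarrow> 'a" and g gi G +
  fixes dt :: "'a \<Rightarrow> 'a"
  assumes dt_deriv: "derivation dt"
    and dt_comm: "dt (d i x) = d i (dt x)"
    and flow: "dt (g i j) = - Ric i j"
begin

lemmas dtr = derivation.rules[OF dt_deriv]

text \<open>The symmetry is inherited from the metric, since - \<open>Ric\<close> is its time
  derivative.\<close>

lemma Ric_sym: "Ric i j = Ric j i"
  using flow[of i j] flow[of j i] g_sym[of i j] by simp

lemma dt_gi: "dt (gi a e) = (\<Sum>b\<in>UNIV. \<Sum>c\<in>UNIV. gi a b * Ric b c * gi c e)"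
  by (simp add: derivation_inverse[OF dt_deriv] flow sum_negf)

text \<open>Let V be the time derivative of the connection with lowered upper index. The time
  derivative of metric compatibility expresses the covariant derivative of \<open>Ric\<close> by V.
  With A the trace of \<open>V k i j\<close> and B that of \<open>V j i k\<close>, both over i and
  j, the contracted Bianchi identity reads - 2 (A + B) = - 2 B. Hence 2 A = 0; the factor 2 stays
  because the ring has no division.\<close>

lemma tr_dt_G: "2 * tr (\<lambda>i j. dt (G m i j)) = 0"
proof -
  define V where "V k i j = (\<Sum>l\<in>UNIV. g k l * dt (G l i j))" for k i j
  have V_sym: "V k i j = V k j i" for k i j
    unfolding V_def using G_sym by metis
  have v: "cov2 i Ric j k = - V k i j - V j i k" for i j k
  proof -
    have "dt (d i (g j k)) = dt ((\<Sum>l\<in>UNIV. G l i j * g l k) + (\<Sum>l\<in>UNIV. G l i k * g j l))"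
      by (simp only: compat)
    then have "d i (Ric j k) = - V k i j - V j i k + (\<Sum>l\<in>UNIV. G l i j * Ric l k) + (\<Sum>l\<in>UNIV. G l i k * Ric j l)"
      by (simp add: dtr dt_comm flow sum.distrib V_def dr g_sym[of k] sum_negf sum_subtractf algebra_simps)
    then show ?thesis by (simp add: cov2_def)
  qed
  have "2 * tr (\<lambda>i j. V k i j) = 0" for k
  proof -
    have "tr (\<lambda>i j. V j i k) = tr (\<lambda>i j. V j k i)" by (simp add: V_sym[of _ k])
    moreover have "tr (\<lambda>i j. V i k j) = tr (\<lambda>i j. V j k i)"
      by (rule tr_transpose)
    moreover have "2 * tr (\<lambda>i j. cov2 i Ric k j) = tr (cov2 k Ric)"
      by (simp add: contracted_bianchi d_tr)
    moreover have "cov2 i Ric k j = - V k i j - V j i k" for i j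
      using v[of i j k] v[of i k j] by simp
    moreover have "tr (cov2 k Ric) = tr (\<lambda>i j. - V j k i - V i k j)"
      by (intro tr_cong v)
    ultimately show ?thesis
      by (simp add: tr_diff tr_minus algebra_simps)
  qed
  then have "2 * (\<Sum>k\<in>UNIV. gi m k * tr (\<lambda>i j. V k i j)) = 0"
    by (simp add: sum_distrib_left mult.left_commute[of 2])
  moreover have "(\<Sum>k\<in>UNIV. gi m k * tr (\<lambda>i j. V k i j)) = tr (\<lambda>i j. dt (G m i j))"
    by (simp add: V_def raise_lower flip: tr_scale tr_sum)
  ultimately show ?thesis by simp
qed

lemma dt_tr: "dt (tr S) = ip2 Ric S + tr (\<lambda>i j. dt (S i j))"
proof -
  have "(\<Sum>i\<in>UNIV. \<Sum>j\<in>UNIV. dt (gi i j) * S i j) = ip2 Ric S"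
  proof -
    have "(\<Sum>i\<in>UNIV. \<Sum>j\<in>UNIV. dt (gi i j) * S i j)
      = (\<Sum>i\<in>UNIV. \<Sum>b\<in>UNIV. \<Sum>j\<in>UNIV. \<Sum>c\<in>UNIV. gi i b * Ric b c * gi c j * S i j)"
      unfolding dt_gi sum_distrib_right by (intro sum.cong refl sum.swap)
    also have "\<dots> = (\<Sum>b\<in>UNIV. \<Sum>i\<in>UNIV. \<Sum>c\<in>UNIV. \<Sum>j\<in>UNIV. gi i b * Ric b c * gi c j * S i j)"
      by (subst sum.swap) (intro sum.cong refl sum.swap)
    also have "\<dots> = ip2 Ric S"
      by (simp add: ip2_def tr_def sum_distrib_left gi_sym mult_ac)
    finally show ?thesis .
  qed
  then show ?thesis
    by (simp add: tr_def[of S] tr_def[of "\<lambda>i j. dt (S i j)"] dtr sum.distrib)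
qed

lemma dt_Hess: "dt (Hess f i j) = Hess (dt f) i j - (\<Sum>m\<in>UNIV. dt (G m i j) * d m f)"
  by (simp add: Hess_def cov1_def dtr dt_comm sum.distrib algebra_simps)

lemma dt_Lap: "2 * dt (Lap f) = 2 * (ip2 Ric (Hess f) + Lap (dt f))"
proof -
  have "2 * (\<Sum>m\<in>UNIV. tr (\<lambda>i j. dt (G m i j)) * d m f) = (\<Sum>m\<in>UNIV. (2 * tr (\<lambda>i j. dt (G m i j))) * d m f)"
    by (simp add: sum_distrib_left mult.assoc)
  also have "\<dots> = 0" by (simp add: tr_dt_G)
  finally show ?thesis
    by (simp add: Lap_def dt_tr dt_Hess tr_diff tr_sum tr_scale' distrib_left right_diff_distrib)
qed

text \<open>Apply the Laplacian to \<open>heat\<close>: the squared gradient on its right-hand side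
  is what Bochner's formula expands, while \<open>dt_Lap\<close> contributes the product of
  \<open>Ric\<close> with the Hessian.\<close>

theorem evolution:
  assumes heat: "2 * dt f = Lap f + ip1 (\<lambda>i. d i f) (\<lambda>i. d i f)"
  shows "2 * dt (Lap f) = Lap (Lap f) + 2 * (ip2 Ric (Hess f) + ip2 (Hess f) (Hess f)
     + ip1 (\<lambda>i. d i f) (\<lambda>i. d i (Lap f)) + appl Ric (\<lambda>i. d i f))"
proof -
  have "2 * Lap (dt f) = Lap (2 * dt f)"
    by (simp only: Lap_add mult_2)
  also have "\<dots> = Lap (Lap f) + Lap (ip1 (\<lambda>i. d i f) (\<lambda>i. d i f))"
    by (simp add: heat Lap_add)
  finally show ?thesis
    by (simp add: dt_Lap distrib_left bochner)
qed

end

section \<open>Orthonormal frames\<close>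

definition form :: "('n::finite \<Rightarrow> 'n \<Rightarrow> real) \<Rightarrow> ('n \<Rightarrow> real) \<Rightarrow> ('n \<Rightarrow> real) \<Rightarrow> real" where
  "form S x y = (\<Sum>i\<in>UNIV. \<Sum>j\<in>UNIV. S i j * x i * y j)"

lemma form_linear:
  "form S (\<lambda>i. x i + x' i) y = form S x y + form S x' y"
  "form S (\<lambda>i. x i - x' i) y = form S x y - form S x' y"
  "form S (\<lambda>i. c * x i) y = c * form S x y"
  "form S x (\<lambda>i. y i + y' i) = form S x y + form S x y'"
  "form S x (\<lambda>i. y i - y' i) = form S x y - form S x y'"
  "form S x (\<lambda>i. c * y i) = c * form S x y"
  by (simp_all add: form_def sum.distrib sum_subtractf sum_distrib_left algebra_simps)

lemma form_sum: "form S (\<lambda>i. \<Sum>m\<in>I. x m i) y = (\<Sum>m\<in>I. form S (x m) y)"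
  "form S y (\<lambda>i. \<Sum>m\<in>I. x m i) = (\<Sum>m\<in>I. form S y (x m))"
proof -
  have "form S (\<lambda>i. 0) y = 0" "form S y (\<lambda>i. 0) = 0" by (simp_all add: form_def)
  then show "form S (\<lambda>i. \<Sum>m\<in>I. x m i) y = (\<Sum>m\<in>I. form S (x m) y)"
    "form S y (\<lambda>i. \<Sum>m\<in>I. x m i) = (\<Sum>m\<in>I. form S y (x m))"
    by (induction I rule: infinite_finite_induct) (simp_all add: form_linear)
qed

lemma form_sum_left: "form (\<lambda>i j. \<Sum>m\<in>I. S m i j) x y = (\<Sum>m\<in>I. form (S m) x y)"
proof -
  have "form (\<lambda>i j. 0) x y = 0" "form (\<lambda>i j. S i j + S' i j) x y = form S x y + form S' x y" for S S'
    by (simp_all add: form_def sum.distrib distrib_right)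
  then show ?thesis
    by (induction I rule: infinite_finite_induct) simp_all
qed

lemma form_sym: "(\<And>i j. S i j = S j i) \<Longrightarrow> form S x y = form S y x"
  unfolding form_def by (subst sum.swap) (simp add: mult_ac)

text \<open>Gram-Schmidt, one vector at a time. Natural numbers as indices make the induction
  possible; while fewer vectors than the dimension are present, their span is proper and a new
  direction \<open>v\<close> exists.\<close>

lemma orthonormal_sequence:
  fixes g :: "'n::finite \<Rightarrow> 'n \<Rightarrow> real"
  assumes sym: "\<And>i j. g i j = g j i" and pos: "\<And>x. x \<noteq> (\<lambda>i. 0) \<Longrightarrow> form g x x > 0"
    and "m \<le> CARD('n)"
  shows "\<exists>f :: nat \<Rightarrow> 'n \<Rightarrow> real. \<forall>a<m. \<forall>b<m. form g (f a) (f b) = (if a = b then 1 else 0)"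
  using assms(3)
proof (induction m)
  case 0
  then show ?case by simp
next
  case (Suc m)
  then obtain f :: "nat \<Rightarrow> 'n \<Rightarrow> real" where f: "\<forall>a<m. \<forall>b<m. form g (f a) (f b) = (if a = b then 1 else 0)"
    by auto
  define F where "F a = (\<chi> i. f a i)" for a
  have "span (F ` {..<m}) \<noteq> UNIV"
  proof
    assume "span (F ` {..<m}) = UNIV"
    then have "CARD('n) \<le> card (F ` {..<m})"
      using dim_le_card[of "UNIV :: (real^'n) set" "F ` {..<m}"] by simp
    also have "\<dots> \<le> m" using card_image_le[of "{..<m}" F] by simp
    finally show False using Suc.prems by simp
  qed
  then obtain v where v: "v \<notin> span (F ` {..<m})" by blast
  define c where "c a = form g (\<lambda>i. v $ i) (f a)" for a
  define w where "w i = v $ i - (\<Sum>a<m. c a * f a i)" for i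
  have "w \<noteq> (\<lambda>i. 0)"
  proof
    assume "w = (\<lambda>i. 0)"
    then have "v = (\<Sum>a<m. c a *\<^sub>R F a)"
      by (simp add: vec_eq_iff F_def w_def fun_eq_iff)
    then have "v \<in> span (F ` {..<m})"
      by (metis (no_types, lifting) imageI span_base span_scale span_sum)
    with v show False by simp
  qed
  then have w: "form g w w > 0" by (rule pos)
  have wf: "form g w (f b) = 0" if "b < m" for b
  proof -
    have "form g w (f b) = form g (\<lambda>i. v $ i) (f b) - (\<Sum>a<m. c a * form g (f a) (f b))"
      unfolding w_def by (simp add: form_linear form_sum)
    also have "(\<Sum>a<m. c a * form g (f a) (f b)) = (\<Sum>a<m. if a = b then c a else 0)"
      using that f by (intro sum.cong) auto
    finally show ?thesis using that by (simp add: c_def)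
  qed
  define q where "q = 1 / sqrt (form g w w)"
  have q: "q * (q * form g w w) = 1"
    using w real_sqrt_mult_self[of "form g w w"] by (simp add: q_def field_simps)
  define f' where "f' = f(m := (\<lambda>i. q * w i))"
  have fs: "form g x y = form g y x" for x y
    by (rule form_sym) (rule sym)
  have "form g (f' a) (f' b) = (if a = b then 1 else 0)" if "a < Suc m" "b < Suc m" for a b
    using that w wf[of a] wf[of b] fs[of "f a" w] f q
    by (cases "a = m"; cases "b = m") (auto simp: f'_def form_linear less_Suc_eq)
  then show ?case by blast
qed

text \<open>With the frame as rows of E, orthonormality reads E M E^T = 1. A one-sided inverse of a
  square matrix is two-sided, so M (E^T E) = 1, and the inverse of M must be E^T E.\<close>

lemma orthonormal_frame:
  fixes g gi :: "'n::finite \<Rightarrow> 'n \<Rightarrow> real"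
  assumes sym: "\<And>i j. g i j = g j i" and pos: "\<And>x. x \<noteq> (\<lambda>i. 0) \<Longrightarrow> form g x x > 0"
    and inv: "\<And>i k. (\<Sum>j\<in>UNIV. gi i j * g j k) = (if i = k then 1 else 0)"
  obtains e :: "'n \<Rightarrow> 'n \<Rightarrow> real" where
    "\<And>a b. form g (e a) (e b) = (if a = b then 1 else 0)"
    "\<And>i j. gi i j = (\<Sum>a\<in>UNIV. e a i * e a j)"
proof -
  obtain f :: "nat \<Rightarrow> 'n \<Rightarrow> real" where f:
    "\<forall>a<CARD('n). \<forall>b<CARD('n). form g (f a) (f b) = (if a = b then 1 else 0)"
    using orthonormal_sequence[OF sym pos, of "CARD('n)"] by auto
  obtain h :: "'n \<Rightarrow> nat" where h: "bij_betw h UNIV {..<CARD('n)}"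
    using ex_bij_betw_finite_nat[of "UNIV :: 'n set"] by (auto simp: atLeast0LessThan)
  define e where "e a = f (h a)" for a
  have e: "form g (e a) (e b) = (if a = b then 1 else 0)" for a b
  proof -
    have "h a < CARD('n)" "h b < CARD('n)" "h a = h b \<longleftrightarrow> a = b"
      using h by (auto simp: bij_betw_def inj_on_def)
    then show ?thesis using f by (simp add: e_def)
  qed
  define E where "E = (\<chi> a i. e a i)"
  define M where "M = (\<chi> i j. g i j)"
  define N where "N = (\<chi> i j. gi i j)"
  have "E ** (M ** transpose E) = mat 1"
  proof -
    have "(\<Sum>i\<in>UNIV. e a i * (\<Sum>j\<in>UNIV. g i j * e b j)) = (if a = b then 1 else 0)" for a b
      using e[of a b] by (simp add: form_def sum_distrib_left mult_ac)
    then show ?thesis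
      by (simp add: vec_eq_iff E_def M_def matrix_matrix_mult_def transpose_def mat_def)
  qed
  then have "M ** (transpose E ** E) = mat 1"
    using matrix_left_right_inverse[of E "M ** transpose E"] by (simp add: matrix_mul_assoc)
  moreover have "N ** M = mat 1"
    using inv by (simp add: vec_eq_iff M_def N_def matrix_matrix_mult_def mat_def)
  ultimately have "N = transpose E ** E"
    by (metis matrix_mul_assoc matrix_mul_lid matrix_mul_rid)
  then have "gi i j = (\<Sum>a\<in>UNIV. e a i * e a j)" for i j
    by (simp add: vec_eq_iff E_def N_def matrix_matrix_mult_def transpose_def)
  with e show ?thesis by (rule that)
qed

lemma frame_trace:
  fixes gi e :: "'n::finite \<Rightarrow> 'n \<Rightarrow> real"
  assumes gi: "\<And>i j. gi i j = (\<Sum>a\<in>UNIV. e a i * e a j)"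
  shows "(\<Sum>i\<in>UNIV. \<Sum>j\<in>UNIV. gi i j * S i j) = (\<Sum>a\<in>UNIV. form S (e a) (e a))"
proof -
  have "(\<Sum>i\<in>UNIV. \<Sum>j\<in>UNIV. gi i j * S i j) = (\<Sum>i\<in>UNIV. \<Sum>j\<in>UNIV. \<Sum>a\<in>UNIV. S i j * e a i * e a j)"
    by (simp add: gi sum_distrib_left mult_ac)
  also have "\<dots> = (\<Sum>i\<in>UNIV. \<Sum>a\<in>UNIV. \<Sum>j\<in>UNIV. S i j * e a i * e a j)"
    by (intro sum.cong refl sum.swap)
  also have "\<dots> = (\<Sum>a\<in>UNIV. form S (e a) (e a))"
    unfolding form_def by (rule sum.swap)
  finally show ?thesis .
qed

text \<open>Apply \<open>frame_trace\<close> to the inner trace and then to the outer one;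
  \<open>prod\<close> and \<open>row\<close> recognize the factors as values of \<open>S\<close> and
  \<open>S'\<close> on frame vectors.\<close>

lemma frame_inner:
  fixes gi e :: "'n::finite \<Rightarrow> 'n \<Rightarrow> real"
  assumes gi: "\<And>i j. gi i j = (\<Sum>a\<in>UNIV. e a i * e a j)"
  shows "(\<Sum>i\<in>UNIV. \<Sum>j\<in>UNIV. gi i j * (\<Sum>k\<in>UNIV. \<Sum>l\<in>UNIV. gi k l * (S i k * S' j l)))
     = (\<Sum>a\<in>UNIV. \<Sum>b\<in>UNIV. form S (e a) (e b) * form S' (e a) (e b))"
proof -
  have prod: "form (\<lambda>k l. x k * y l) u v = (\<Sum>k\<in>UNIV. x k * u k) * (\<Sum>l\<in>UNIV. y l * v l)" for x y u v :: "'n \<Rightarrow> real"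
    by (simp add: form_def sum_product mult_ac)
  have row: "(\<Sum>i\<in>UNIV. (\<Sum>k\<in>UNIV. S i k * v k) * u i) = form S u v" for S and u v :: "'n \<Rightarrow> real"
    by (simp add: form_def sum_distrib_left mult_ac)
  have "(\<Sum>i\<in>UNIV. \<Sum>j\<in>UNIV. gi i j * (\<Sum>k\<in>UNIV. \<Sum>l\<in>UNIV. gi k l * (S i k * S' j l)))
    = (\<Sum>i\<in>UNIV. \<Sum>j\<in>UNIV. gi i j * (\<Sum>b\<in>UNIV. (\<Sum>k\<in>UNIV. S i k * e b k) * (\<Sum>l\<in>UNIV. S' j l * e b l)))"
    by (simp only: frame_trace[OF gi] prod)
  also have "\<dots> = (\<Sum>a\<in>UNIV. \<Sum>b\<in>UNIV. form S (e a) (e b) * form S' (e a) (e b))"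
    by (simp only: frame_trace[OF gi] form_sum_left prod row)
  finally show ?thesis .
qed

section \<open>Trace inequalities under the curvature bound\<close>

lemma sum_diagonal_power2_le:
  fixes h :: "'n::finite \<Rightarrow> 'n \<Rightarrow> real"
  shows "(\<Sum>a\<in>UNIV. h a a)\<^sup>2 \<le> real CARD('n) * (\<Sum>a\<in>UNIV. \<Sum>b\<in>UNIV. (h a b)\<^sup>2)"
proof -
  have "(\<Sum>a\<in>UNIV. h a a)\<^sup>2 \<le> real CARD('n) * (\<Sum>a\<in>UNIV. (h a a)\<^sup>2)"
    using sum_squared_le_sum_of_squares[of "\<lambda>a. h a a" "UNIV :: 'n set"] by (simp add: mult.commute)
  also have "\<dots> \<le> real CARD('n) * (\<Sum>a\<in>UNIV. \<Sum>b\<in>UNIV. (h a b)\<^sup>2)"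
    by (intro mult_left_mono sum_mono member_le_sum) auto
  finally show ?thesis .
qed

text \<open>Entrywise, h^2 - r^2 \<le> 2 (r h + h^2) is the square (h + r)^2 \<ge> 0. The Hessian is
  bounded below by its trace via Cauchy-Schwarz, and \<open>row\<close> bounds the square norm of
  \<open>Ric\<close> by n k^2.\<close>

lemma trace_bound:
  fixes g gi e Ric H :: "'n::finite \<Rightarrow> 'n \<Rightarrow> real"
  defines "tr \<equiv> \<lambda>S. \<Sum>i\<in>UNIV. \<Sum>j\<in>UNIV. gi i j * S i j"
  defines "ip \<equiv> \<lambda>S S'. tr (\<lambda>i j. tr (\<lambda>k l. S i k * S' j l))"
  assumes e: "\<And>a b. form g (e a) (e b) = (if a = b then 1 else 0)"
    and gi: "\<And>i j. gi i j = (\<Sum>a\<in>UNIV. e a i * e a j)"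
    and sym: "\<And>i j. Ric i j = Ric j i"
    and pos: "\<And>x. 0 \<le> form Ric x x" and le: "\<And>x. form Ric x x \<le> k * form g x x" and k: "k > 0"
  shows "(tr H)\<^sup>2 - (k * real CARD('n))\<^sup>2 \<le> 2 * real CARD('n) * (ip Ric H + ip H H)"
proof -
  define n where "n = real CARD('n)"
  define h where "h a b = form H (e a) (e b)" for a b
  define r where "r a b = form Ric (e a) (e b)" for a b
  have fs: "form Ric x y = form Ric y x" for x y
    by (rule form_sym) (rule sym)
  \<comment> \<open>This replaces a diagonalization of \<open>Ric\<close>. With \<open>x\<close> the
    image of \<open>e a\<close> under \<open>Ric\<close> and N its square length, positivity on x -
    k e_a and the upper bound on x and e_a give 0 \<le> k N - 2 k N + k^3.\<close>
  have row: "(\<Sum>b\<in>UNIV. (r a b)\<^sup>2) \<le> k\<^sup>2" for a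
  proof -
    define N where "N = (\<Sum>b\<in>UNIV. (r a b)\<^sup>2)"
    define x where "x i = (\<Sum>b\<in>UNIV. r a b * e b i)" for i
    have "form g x x = (\<Sum>b\<in>UNIV. \<Sum>c\<in>UNIV. r a b * (r a c * form g (e b) (e c)))"
      unfolding x_def by (simp add: form_sum form_linear sum_distrib_left)
    also have "\<dots> = (\<Sum>b\<in>UNIV. \<Sum>c\<in>UNIV. if b = c then (r a b)\<^sup>2 else 0)"
      by (intro sum.cong refl) (simp add: e power2_eq_square)
    finally have xx: "form g x x = N"
      by (simp add: N_def)
    have ax: "form Ric (e a) x = N"
      unfolding x_def N_def by (simp add: form_sum form_linear power2_eq_square r_def)
    have "0 \<le> form Ric (\<lambda>i. x i - k * e a i) (\<lambda>i. x i - k * e a i)"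
      by (rule pos)
    also have "\<dots> = form Ric x x - 2 * k * N + k\<^sup>2 * r a a"
      by (simp add: form_linear ax fs[of x "e a"] power2_eq_square r_def algebra_simps)
    also have "\<dots> \<le> k * N - 2 * k * N + k\<^sup>2 * k"
      using le[of x] le[of "e a"] k by (intro add_mono diff_mono mult_left_mono) (auto simp: xx e r_def)
    finally have "k * N \<le> k * k\<^sup>2" by (simp add: algebra_simps)
    then show ?thesis using k by (simp add: N_def)
  qed
  have "(\<Sum>a\<in>UNIV. \<Sum>b\<in>UNIV. (r a b)\<^sup>2) \<le> n * k\<^sup>2"
    using sum_mono[of UNIV, OF row] by (simp add: n_def)
  then have R: "n * (\<Sum>a\<in>UNIV. \<Sum>b\<in>UNIV. (r a b)\<^sup>2) \<le> n * (n * k\<^sup>2)"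
    by (intro mult_left_mono) (auto simp: n_def)
  have "(tr H)\<^sup>2 \<le> n * (\<Sum>a\<in>UNIV. \<Sum>b\<in>UNIV. (h a b)\<^sup>2)"
    unfolding tr_def frame_trace[OF gi] n_def h_def[symmetric] by (rule sum_diagonal_power2_le)
  then have "(tr H)\<^sup>2 - (k * n)\<^sup>2 \<le> n * (\<Sum>a\<in>UNIV. \<Sum>b\<in>UNIV. (h a b)\<^sup>2) - n * (\<Sum>a\<in>UNIV. \<Sum>b\<in>UNIV. (r a b)\<^sup>2)"
    using R by (simp add: power_mult_distrib power2_eq_square mult_ac)
  also have "\<dots> = n * (\<Sum>a\<in>UNIV. \<Sum>b\<in>UNIV. (h a b)\<^sup>2 - (r a b)\<^sup>2)"
    by (simp add: sum_subtractf right_diff_distrib)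
  also have "\<dots> \<le> n * (\<Sum>a\<in>UNIV. \<Sum>b\<in>UNIV. 2 * (r a b * h a b + h a b * h a b))"
  proof (intro mult_left_mono sum_mono)
    fix a b
    have "0 \<le> (h a b + r a b)\<^sup>2" by simp
    then show "(h a b)\<^sup>2 - (r a b)\<^sup>2 \<le> 2 * (r a b * h a b + h a b * h a b)"
      by (simp add: power2_eq_square algebra_simps)
  qed (simp add: n_def)
  also have "\<dots> = 2 * n * (ip Ric H + ip H H)"
    unfolding ip_def tr_def frame_inner[OF gi] h_def r_def
    by (simp add: sum.distrib sum_distrib_left algebra_simps)
  finally show ?thesis by (simp add: n_def)
qed

section \<open>Smooth functions\<close>

definition csmooth :: "'a::real_normed_vector set \<Rightarrow> ('a \<Rightarrow> 'b::real_normed_vector) \<Rightarrow> bool" where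
  "csmooth W f \<longleftrightarrow> (\<forall>k. Ck_on k W f)"

abbreviation dd :: "'a::real_normed_vector \<Rightarrow> ('a \<Rightarrow> 'b::real_normed_vector) \<Rightarrow> 'a \<Rightarrow> 'b" where
  "dd v f \<equiv> \<lambda>x. frechet_derivative f (at x) v"

lemma dd_eqI: "(f has_derivative f') (at x) \<Longrightarrow> frechet_derivative f (at x) v = f' v"
  by (metis frechet_derivative_at)

text \<open>Openness makes equality on \<open>W\<close> an equality near each point, which is what
  derivatives see.\<close>

lemma Ck_on_cong:
  assumes "open W" "\<And>x. x \<in> W \<Longrightarrow> f x = g x" "Ck_on k W f"
  shows "Ck_on k W g"
  using assms
proof (induction k arbitrary: f g)
  case 0
  then show ?case by (simp cong: continuous_on_cong)
next
  case (Suc k)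
  have "g differentiable (at x) \<and> frechet_derivative f (at x) = frechet_derivative g (at x)" if x: "x \<in> W" for x
  proof -
    have "f differentiable (at x)" using Suc.prems x by simp
    then obtain D where "(f has_derivative D) (at x)" by (auto simp: differentiable_def)
    moreover from this have "(g has_derivative D) (at x)"
      using Suc.prems(1) x Suc.prems(2) by (rule has_derivative_transform_within_open)
    ultimately show ?thesis
      by (metis differentiableI frechet_derivative_at)
  qed
  note * = this
  have "Ck_on k W (dd v g)" for v
    using Suc.prems(1) by (rule Suc.IH[of "dd v f"]) (use * Suc.prems(3) in auto)
  with * show ?case by simp
qed

lemma Ck_on_subset: "Ck_on k W f \<Longrightarrow> W' \<subseteq> W \<Longrightarrow> Ck_on k W' f"
  by (induction k arbitrary: f) (auto intro: continuous_on_subset)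

lemma Ck_on_SucD: "Ck_on (Suc k) W f \<Longrightarrow> Ck_on k W f"
proof (induction k arbitrary: f)
  case 0
  then show ?case
    by (auto intro!: continuous_at_imp_continuous_on differentiable_imp_continuous_within)
next
  case (Suc k)
  then show ?case
    by (metis Ck_on.simps(2))
qed

lemma csmooth_iff:
  "csmooth W f \<longleftrightarrow> (\<forall>x\<in>W. f differentiable (at x)) \<and> (\<forall>v. csmooth W (dd v f))"
  unfolding csmooth_def by (metis Ck_on.simps(2) Ck_on_SucD)

lemma csmooth_subset: "csmooth W f \<Longrightarrow> W' \<subseteq> W \<Longrightarrow> csmooth W' f"
  by (auto simp: csmooth_def intro: Ck_on_subset)

lemma csmooth_cong: "open W \<Longrightarrow> (\<And>x. x \<in> W \<Longrightarrow> f x = g x) \<Longrightarrow> csmooth W f \<Longrightarrow> csmooth W g"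
  by (auto simp: csmooth_def intro: Ck_on_cong)

lemma csmooth_dd: "csmooth W f \<Longrightarrow> csmooth W (dd v f)"
  by (simp add: csmooth_iff[of W f])

lemma csmooth_has_derivative:
  "csmooth W f \<Longrightarrow> x \<in> W \<Longrightarrow> (f has_derivative frechet_derivative f (at x)) (at x)"
  by (simp add: csmooth_iff[of W f] frechet_derivative_works)

lemma csmooth_continuous_on: "csmooth W f \<Longrightarrow> continuous_on W f"
  using Ck_on.simps(1) csmooth_def by blast

lemma csmooth_isCont: "csmooth W f \<Longrightarrow> x \<in> W \<Longrightarrow> isCont f x"
  using csmooth_has_derivative has_derivative_continuous by blast

lemma Ck_on_const: "Ck_on k W (\<lambda>x. c)"
  by (induction k arbitrary: c) auto

lemma Ck_on_add:
  assumes "open W" "Ck_on k W f" "Ck_on k W g"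
  shows "Ck_on k W (\<lambda>x. f x + g x)"
  using assms
proof (induction k arbitrary: f g)
  case 0
  then show ?case by (auto intro: continuous_intros)
next
  case (Suc k)
  have "dd v (\<lambda>x. f x + g x) x = dd v f x + dd v g x" if "x \<in> W" for x v
    using Suc.prems that
    by (intro dd_eqI) (auto intro!: has_derivative_add simp: frechet_derivative_works[symmetric])
  note * = this
  have "Ck_on k W (dd v (\<lambda>x. f x + g x))" for v
    by (rule Ck_on_cong[OF \<open>open W\<close> _ Suc.IH[of "dd v f" "dd v g"]]) (use * Suc.prems in auto)
  with Suc.prems show ?case by auto
qed

lemma Ck_on_mult:
  fixes f g :: "'a::real_normed_vector \<Rightarrow> real"
  assumes "open W" "Ck_on k W f" "Ck_on k W g"
  shows "Ck_on k W (\<lambda>x. f x * g x)"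
  using assms
proof (induction k arbitrary: f g)
  case 0
  then show ?case by (auto intro: continuous_intros)
next
  case (Suc k)
  have *: "dd v (\<lambda>x. f x * g x) x = f x * dd v g x + dd v f x * g x" if "x \<in> W" for x v
    using Suc.prems that
    by (intro dd_eqI has_derivative_mult) (auto simp: frechet_derivative_works[symmetric])
  have 1: "Ck_on k W f" "Ck_on k W g" "Ck_on k W (dd v f)" "Ck_on k W (dd v g)" for v
    using Suc.prems(2,3)[THEN Ck_on_SucD] Suc.prems(2,3) by auto
  have 2: "Ck_on k W (\<lambda>x. f x * dd v g x + dd v f x * g x)" for v
    by (intro Ck_on_add Suc.IH \<open>open W\<close> 1)
  have "Ck_on k W (dd v (\<lambda>x. f x * g x))" for v
    by (rule Ck_on_cong[OF \<open>open W\<close> _ 2[of v]]) (use * in simp)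
  with Suc.prems show ?case by auto
qed

lemma csmooth_const: "csmooth W (\<lambda>x. c)"
  and csmooth_add: "open W \<Longrightarrow> csmooth W f \<Longrightarrow> csmooth W g \<Longrightarrow> csmooth W (\<lambda>x. f x + g x)"
  by (auto simp: csmooth_def Ck_on_const Ck_on_add)

lemma csmooth_mult:
  fixes f g :: "'a::real_normed_vector \<Rightarrow> real"
  shows "open W \<Longrightarrow> csmooth W f \<Longrightarrow> csmooth W g \<Longrightarrow> csmooth W (\<lambda>x. f x * g x)"
  by (auto simp: csmooth_def Ck_on_mult)

lemma dd_add:
  assumes "csmooth W f" "csmooth W g" "x \<in> W"
  shows "dd v (\<lambda>x. f x + g x) x = dd v f x + dd v g x"
  using assms by (intro dd_eqI has_derivative_add csmooth_has_derivative)

lemma dd_mult: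
  fixes f g :: "'a::real_normed_vector \<Rightarrow> real"
  assumes "csmooth W f" "csmooth W g" "x \<in> W"
  shows "dd v (\<lambda>x. f x * g x) x = dd v f x * g x + f x * dd v g x"
  using dd_eqI[OF has_derivative_mult[OF csmooth_has_derivative[OF assms(1,3)] csmooth_has_derivative[OF assms(2,3)]], of v]
  by simp

text \<open>The derivative of 1/f is a product of 1/f, 1/f and a derivative of f, so the reciprocal
  gains one order of smoothness from the previous order. This is why the induction runs over the
  order.\<close>

lemma csmooth_inverse:
  fixes f :: "'a::real_normed_vector \<Rightarrow> real"
  assumes "open W" "csmooth W f" "\<And>x. x \<in> W \<Longrightarrow> f x \<noteq> 0"
  shows "csmooth W (\<lambda>x. inverse (f x))"
proof -
  have d: "((\<lambda>x. inverse (f x)) has_derivative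
      (\<lambda>h. - (inverse (f x) * dd h f x * inverse (f x)))) (at x)" if "x \<in> W" for x
    using that assms by (intro Deriv.has_derivative_inverse csmooth_has_derivative)
  have "Ck_on k W (\<lambda>x. inverse (f x))" for k
  proof (induction k)
    case 0
    show ?case using d
      by (auto intro!: continuous_at_imp_continuous_on has_derivative_continuous)
  next
    case (Suc k)
    have 1: "Ck_on k W (\<lambda>x. (- 1) * (inverse (f x) * dd v f x * inverse (f x)))" for v
      using csmooth_dd[OF assms(2)] Suc assms(1)
      by (intro Ck_on_mult Ck_on_const) (auto simp: csmooth_def)
    have "Ck_on k W (dd v (\<lambda>x. inverse (f x)))" for v
      by (rule Ck_on_cong[OF assms(1) _ 1[of v]]) (use dd_eqI[OF d] in simp)
    then show ?case using d by (auto simp: differentiable_def)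
  qed
  then show ?thesis by (simp add: csmooth_def)
qed

lemma ln_has_derivative:
  fixes f :: "'a::real_normed_vector \<Rightarrow> real"
  assumes "csmooth W f" "x \<in> W" "f x > 0"
  shows "((\<lambda>x. ln (f x)) has_derivative (\<lambda>h. inverse (f x) * dd h f x)) (at x)"
  using has_derivative_ln[OF assms(3) csmooth_has_derivative[OF assms(1,2)]] by (simp add: mult.commute divide_inverse)

text \<open>No induction: the derivative is the reciprocal of \<open>f\<close> times a derivative of
  \<open>f\<close>, which is already smooth of every order.\<close>

lemma csmooth_ln:
  fixes f :: "'a::real_normed_vector \<Rightarrow> real"
  assumes "open W" "csmooth W f" "\<And>x. x \<in> W \<Longrightarrow> f x > 0"
  shows "csmooth W (\<lambda>x. ln (f x))"
proof -
  have d: "((\<lambda>x. ln (f x)) has_derivative (\<lambda>h. inverse (f x) * dd h f x)) (at x)" if "x \<in> W" for x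
    using that assms by (intro ln_has_derivative)
  have 1: "csmooth W (\<lambda>x. inverse (f x) * dd v f x)" for v
    using assms by (intro csmooth_mult csmooth_inverse csmooth_dd) (auto simp: order_less_le)
  have "csmooth W (dd v (\<lambda>x. ln (f x)))" for v
    by (rule csmooth_cong[OF assms(1) _ 1[of v]]) (use dd_eqI[OF d] in simp)
  then show ?thesis using d by (auto simp: csmooth_iff[of W "\<lambda>x. ln (f x)"] differentiable_def)
qed

lemma has_derivative_translate:
  assumes "csmooth W f" "a + x \<in> W"
  shows "((\<lambda>x. f (a + x)) has_derivative frechet_derivative f (at (a + x))) (at x)"
  by (rule has_derivative_compose[of "\<lambda>x. a + x" "\<lambda>h. h" x UNIV f, simplified])
     (auto intro!: derivative_eq_intros csmooth_has_derivative[OF assms])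

lemma csmooth_translate:
  assumes W: "open W" and "csmooth W f"
  shows "csmooth {x. a + x \<in> W} (\<lambda>x. f (a + x))"
proof -
  have o: "open {x. a + x \<in> W}"
    using open_vimage[OF W, of "\<lambda>x. a + x"] by (simp add: vimage_def continuous_on_add)
  have "csmooth W f \<Longrightarrow> Ck_on k {x. a + x \<in> W} (\<lambda>x. f (a + x))" for k
  proof (induction k arbitrary: f)
    case 0
    then show ?case
      by (auto intro!: continuous_at_imp_continuous_on has_derivative_continuous[OF has_derivative_translate[OF 0]])
  next
    case (Suc k)
    have "Ck_on k {x. a + x \<in> W} (dd v (\<lambda>x. f (a + x)))" for v
      by (rule Ck_on_cong[OF o _ Suc.IH[OF csmooth_dd[OF Suc.prems, of v]]])
         (use dd_eqI[OF has_derivative_translate[OF Suc.prems]] in simp)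
    then show ?case
      using has_derivative_translate[OF Suc.prems] by (auto simp: differentiable_def)
  qed
  then show ?thesis using assms by (simp add: csmooth_def)
qed

section \<open>Symmetry of second derivatives\<close>

lemma line_derivative:
  fixes f :: "'a::real_normed_vector \<Rightarrow> real"
  assumes "csmooth W f" "a + s *\<^sub>R v \<in> W"
  shows "((\<lambda>s. f (a + s *\<^sub>R v)) has_real_derivative dd v f (a + s *\<^sub>R v)) (at s)"
proof -
  have 1: "(f has_derivative frechet_derivative f (at (a + s *\<^sub>R v))) (at (a + s *\<^sub>R v))"
    using assms by (rule csmooth_has_derivative)
  have "((\<lambda>s. a + s *\<^sub>R v) has_derivative (\<lambda>h. h *\<^sub>R v)) (at s)"
    by (auto intro!: derivative_eq_intros)
  from has_derivative_compose[OF this 1]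
  show ?thesis
    by (simp add: has_field_derivative_def linear_cmul[OF has_derivative_linear[OF 1]] mult_commute_abs)
qed

text \<open>The mean value theorem twice: along \<open>v\<close> for the difference of
  \<open>f\<close> between opposite sides of the parallelogram, then along \<open>w\<close> for the
  derivative found there.\<close>

lemma second_difference:
  fixes f :: "'a::real_normed_vector \<Rightarrow> real"
  assumes f: "csmooth W f" and "h > 0"
    and W: "\<And>s r. 0 \<le> s \<Longrightarrow> s \<le> h \<Longrightarrow> 0 \<le> r \<Longrightarrow> r \<le> h \<Longrightarrow> x + s *\<^sub>R v + r *\<^sub>R w \<in> W"
  shows "\<exists>s r. 0 < s \<and> s < h \<and> 0 < r \<and> r < h \<and>
    f (x + h *\<^sub>R v + h *\<^sub>R w) - f (x + h *\<^sub>R v) - f (x + h *\<^sub>R w) + f x = h * h * dd w (dd v f) (x + s *\<^sub>R v + r *\<^sub>R w)"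
proof -
  define \<phi> where "\<phi> s = f (x + h *\<^sub>R w + s *\<^sub>R v) - f (x + s *\<^sub>R v)" for s
  have "(\<phi> has_real_derivative dd v f (x + h *\<^sub>R w + s *\<^sub>R v) - dd v f (x + s *\<^sub>R v)) (at s)"
    if "0 \<le> s" "s \<le> h" for s
    unfolding \<phi>_def using W[of s h] W[of s 0] that \<open>h > 0\<close>
    by (intro derivative_intros line_derivative[OF f]) (auto simp: algebra_simps)
  from MVT2[OF \<open>h > 0\<close> this] obtain s where s: "0 < s" "s < h"
    "\<phi> h - \<phi> 0 = h * (dd v f (x + h *\<^sub>R w + s *\<^sub>R v) - dd v f (x + s *\<^sub>R v))" by auto
  have "((\<lambda>r. dd v f (x + s *\<^sub>R v + r *\<^sub>R w)) has_real_derivative dd w (dd v f) (x + s *\<^sub>R v + r *\<^sub>R w)) (at r)"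
    if "0 \<le> r" "r \<le> h" for r
    using W[of s r] that s by (intro line_derivative[OF csmooth_dd[OF f]]) auto
  from MVT2[OF \<open>h > 0\<close> this] obtain r where r: "0 < r" "r < h"
    "dd v f (x + s *\<^sub>R v + h *\<^sub>R w) - dd v f (x + s *\<^sub>R v + 0 *\<^sub>R w) = h * dd w (dd v f) (x + s *\<^sub>R v + r *\<^sub>R w)" by auto
  show ?thesis
    using s r by (intro exI[of _ s] exI[of _ r]) (auto simp: \<phi>_def algebra_simps)
qed

text \<open>The second difference is symmetric in \<open>v\<close> and \<open>w\<close>, so both
  mixed derivatives take a common value at points of arbitrarily small parallelograms. If they
  differed at \<open>x\<close>, continuity would keep each within half the gap of its value
  there.\<close>

lemma dd_commute:
  fixes f :: "'a::real_normed_vector \<Rightarrow> real"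
  assumes f: "csmooth W f" and W: "open W" "x \<in> W"
  shows "dd v (dd w f) x = dd w (dd v f) x"
proof (rule ccontr)
  let ?P = "dd w (dd v f)" and ?Q = "dd v (dd w f)"
  define e where "e = \<bar>?P x - ?Q x\<bar> / 2"
  assume "?Q x \<noteq> ?P x"
  then have e: "e > 0" by (simp add: e_def)
  have "isCont ?P x" "isCont ?Q x"
    using W by (auto intro!: csmooth_isCont csmooth_dd f)
  then have "(?P \<longlongrightarrow> ?P x) (nhds x)" "(?Q \<longlongrightarrow> ?Q x) (nhds x)"
    using tendsto_at_iff_tendsto_nhds[of ?P x] tendsto_at_iff_tendsto_nhds[of ?Q x]
    by (simp_all add: isCont_def)
  then have "eventually (\<lambda>y. dist (?P y) (?P x) < e \<and> dist (?Q y) (?Q x) < e \<and> y \<in> W) (nhds x)"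
    using e W by (intro eventually_conj) (auto dest: tendstoD simp: eventually_nhds_in_open)
  then obtain d where d: "d > 0"
     "\<And>y. dist y x < d \<Longrightarrow> dist (?P y) (?P x) < e \<and> dist (?Q y) (?Q x) < e \<and> y \<in> W"
    unfolding eventually_nhds_metric by blast
  \<comment> \<open>The step size keeps the parallelogram inside the ball of radius
    \<open>d\<close>; the summand 1 covers the case that \<open>v\<close> and \<open>w\<close> are
    both 0.\<close>
  define h where "h = d / (2 * (norm v + norm w + 1))"
  have h: "h > 0" using d by (simp add: h_def add_nonneg_pos)
  have hd: "h * (norm v + norm w) < d"
  proof -
    have "h * (norm v + norm w) \<le> h * (norm v + norm w + 1)" using h by simp
    also have "\<dots> = d / 2"
    proof -
      define N where "N = norm v + norm w + 1"
      have "N > 0" by (simp add: N_def add_nonneg_pos)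
      then show ?thesis unfolding h_def N_def[symmetric] by simp
    qed
    finally show ?thesis using d by simp
  qed
  have near: "dist (x + s *\<^sub>R v + r *\<^sub>R w) x < d" if "0 \<le> s" "s \<le> h" "0 \<le> r" "r \<le> h" for s r
  proof -
    have "norm (s *\<^sub>R v + r *\<^sub>R w) \<le> s * norm v + r * norm w"
      using that norm_triangle_ineq[of "s *\<^sub>R v" "r *\<^sub>R w"] by simp
    also have "\<dots> \<le> h * (norm v + norm w)"
      unfolding distrib_left using that by (intro add_mono mult_right_mono) auto
    finally show ?thesis using hd by (simp add: dist_norm add.assoc)
  qed
  obtain s r where 1: "0 < s" "s < h" "0 < r" "r < h"
    "f (x + h *\<^sub>R v + h *\<^sub>R w) - f (x + h *\<^sub>R v) - f (x + h *\<^sub>R w) + f x = h * h * ?P (x + s *\<^sub>R v + r *\<^sub>R w)"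
    using second_difference[OF f h, of x v w] near d by blast
  obtain s' r' where 2: "0 < s'" "s' < h" "0 < r'" "r' < h"
    "f (x + h *\<^sub>R w + h *\<^sub>R v) - f (x + h *\<^sub>R w) - f (x + h *\<^sub>R v) + f x = h * h * ?Q (x + s' *\<^sub>R w + r' *\<^sub>R v)"
  proof -
    have "x + s *\<^sub>R w + r *\<^sub>R v \<in> W" if "0 \<le> s" "s \<le> h" "0 \<le> r" "r \<le> h" for s r
      using d(2)[OF near, of r s] that by (simp add: algebra_simps)
    then show ?thesis
      using second_difference[OF f h, of x w v] that by blast
  qed
  have "h * h * ?P (x + s *\<^sub>R v + r *\<^sub>R w) = h * h * ?Q (x + r' *\<^sub>R v + s' *\<^sub>R w)"
    using 1(5) 2(5) by (simp add: algebra_simps)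
  then have "?P (x + s *\<^sub>R v + r *\<^sub>R w) = ?Q (x + r' *\<^sub>R v + s' *\<^sub>R w)"
    using h by simp
  moreover have "dist (?P (x + s *\<^sub>R v + r *\<^sub>R w)) (?P x) < e" "dist (?Q (x + r' *\<^sub>R v + s' *\<^sub>R w)) (?Q x) < e"
    using d(2) near 1 2 by (meson less_imp_le)+
  moreover have False if "p = q" "dist p a < \<bar>a - b\<bar> / 2" "dist q b < \<bar>a - b\<bar> / 2" for p q a b :: real
    using dist_triangle_half_r[of p a "\<bar>a - b\<bar>" b] that by (simp add: dist_real_def)
  ultimately show False
    unfolding e_def by blast
qed

section \<open>Germs of smooth functions\<close>

text \<open>Germs at 0 of smooth functions of space and time, where only times \<open>\<le> 0\<close> count. So a
  differential equation that holds up to the final time only is an equation between germs, and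
  since smooth functions which agree for times \<open>\<le> 0\<close> have the same derivatives there,
  all partial derivatives still act on germs.\<close>

definition smooth0 :: "('e::real_normed_vector \<Rightarrow> real) \<Rightarrow> bool" where
  "smooth0 F \<longleftrightarrow> (\<exists>W. open W \<and> 0 \<in> W \<and> csmooth W F)"

definition past_eq :: "('e::real_normed_vector \<times> real \<Rightarrow> real) \<Rightarrow> ('e \<times> real \<Rightarrow> real) \<Rightarrow> bool" where
  "past_eq F F' \<longleftrightarrow> (\<exists>W. open W \<and> 0 \<in> W \<and> (\<forall>z\<in>W. snd z \<le> 0 \<longrightarrow> F z = F' z))"

lemma smooth0E2:
  assumes "smooth0 F" "smooth0 F'"
  obtains W where "open W" "0 \<in> W" "csmooth W F" "csmooth W F'"
proof -
  obtain V V' where "open V" "0 \<in> V" "csmooth V F" "open V'" "0 \<in> V'" "csmooth V' F'"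
    using assms by (auto simp: smooth0_def)
  then show ?thesis
    by (intro that[of "V \<inter> V'"]) (auto intro: csmooth_subset)
qed

lemma past_eqE2:
  assumes "past_eq F F'" "past_eq H H'"
  obtains W where "open W" "0 \<in> W" "\<And>z. z \<in> W \<Longrightarrow> snd z \<le> 0 \<Longrightarrow> F z = F' z \<and> H z = H' z"
proof -
  obtain V V' where "open V" "0 \<in> V" "\<forall>z\<in>V. snd z \<le> 0 \<longrightarrow> F z = F' z"
     "open V'" "0 \<in> V'" "\<forall>z\<in>V'. snd z \<le> 0 \<longrightarrow> H z = H' z"
    using assms by (auto simp: past_eq_def)
  then show ?thesis
    by (intro that[of "V \<inter> V'"]) auto
qed

lemma smooth0_const: "smooth0 (\<lambda>z. c)"
  by (auto simp: smooth0_def csmooth_const)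

lemma smooth0_add: "smooth0 F \<Longrightarrow> smooth0 F' \<Longrightarrow> smooth0 (\<lambda>z. F z + F' z)"
  by (erule (1) smooth0E2) (auto simp: smooth0_def intro: csmooth_add)

lemma smooth0_mult: "smooth0 F \<Longrightarrow> smooth0 F' \<Longrightarrow> smooth0 (\<lambda>z. F z * F' z)"
  by (erule (1) smooth0E2) (auto simp: smooth0_def intro: csmooth_mult)

lemma smooth0_uminus: "smooth0 F \<Longrightarrow> smooth0 (\<lambda>z. - F z)"
  using smooth0_mult[OF smooth0_const[of "- 1"]] by simp

lemma smooth0_dd: "smooth0 F \<Longrightarrow> smooth0 (dd v F)"
  by (auto simp: smooth0_def intro: csmooth_dd)

lemma past_eq_add: "past_eq F F' \<Longrightarrow> past_eq H H' \<Longrightarrow> past_eq (\<lambda>z. F z + H z) (\<lambda>z. F' z + H' z)"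
  and past_eq_mult: "past_eq F F' \<Longrightarrow> past_eq H H' \<Longrightarrow> past_eq (\<lambda>z. F z * H z) (\<lambda>z. F' z * H' z)"
  by (erule (1) past_eqE2, force simp: past_eq_def)+

lemma past_eq_uminus: "past_eq F F' \<Longrightarrow> past_eq (\<lambda>z. - F z) (\<lambda>z. - F' z)"
  by (auto simp: past_eq_def)

lemma past_eq_refl: "past_eq F F"
  by (auto simp: past_eq_def)

text \<open>At negative times the functions agree on an open set. At time 0 they may differ right
  afterwards, so the equality of derivatives is a limit from the past, by continuity of the
  derivatives.\<close>

lemma past_eq_dd:
  fixes F F' :: "'e::real_normed_vector \<times> real \<Rightarrow> real"
  assumes "smooth0 F" "smooth0 F'" "past_eq F F'"
  shows "past_eq (dd v F) (dd v F')"
proof -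
  obtain V where V: "open V" "0 \<in> V" "csmooth V F" "csmooth V F'"
    using smooth0E2[OF assms(1,2)] .
  obtain V' where V': "open V'" "0 \<in> V'" "\<forall>z\<in>V'. snd z \<le> 0 \<longrightarrow> F z = F' z"
    using assms(3) by (auto simp: past_eq_def)
  define W where "W = V \<inter> V'"
  have W: "open W" "0 \<in> W" "csmooth W F" "csmooth W F'" "\<And>z. z \<in> W \<Longrightarrow> snd z \<le> 0 \<Longrightarrow> F z = F' z"
    using V V' by (auto simp: W_def intro: csmooth_subset)
  have neg: "dd v F z = dd v F' z" if "z \<in> W" "snd z < 0" for z
  proof -
    have "open (W \<inter> {z. snd z < 0})"
      using W(1) by (intro open_Int open_Collect_less continuous_intros)
    then show ?thesis
      using frechet_derivative_transform_within_open[of F z "W \<inter> {z. snd z < 0}" F'] that W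
      by (auto simp: csmooth_iff[of W F])
  qed
  have "dd v F z = dd v F' z" if z: "z \<in> W" "snd z \<le> 0" for z
  proof -
    let ?l = "\<lambda>r. z - (0, r)"
    have "(?l \<longlongrightarrow> z - (0, 0)) (at_right 0)"
      by (intro tendsto_intros)
    then have l: "(?l \<longlongrightarrow> z) (at_right 0)"
      by (simp add: zero_prod_def[symmetric])
    have 1: "((\<lambda>r. dd v F (?l r)) \<longlongrightarrow> dd v F z) (at_right 0)"
      by (rule isCont_tendsto_compose[OF csmooth_isCont[OF csmooth_dd[OF W(3)] z(1)] l])
    have 2: "((\<lambda>r. dd v F' (?l r)) \<longlongrightarrow> dd v F' z) (at_right 0)"
      by (rule isCont_tendsto_compose[OF csmooth_isCont[OF csmooth_dd[OF W(4)] z(1)] l])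
    have "\<forall>\<^sub>F r in at_right 0. dd v F (?l r) = dd v F' (?l r)"
      using topological_tendstoD[OF l W(1) z(1)] eventually_at_right_less[of 0]
      by eventually_elim (use z in \<open>auto intro!: neg\<close>)
    from Lim_transform_eventually[OF 1 this] have "((\<lambda>r. dd v F' (?l r)) \<longlongrightarrow> dd v F z) (at_right 0)" .
    then show ?thesis
      using 2 by (rule tendsto_unique[rotated]) simp
  qed
  then show ?thesis
    using W by (auto simp: past_eq_def)
qed

text \<open>Smoothness is built into the relation, which is therefore reflexive only on smooth
  functions; this makes the quotient a partial one.\<close>

definition germ_rel :: "('e::real_normed_vector \<times> real \<Rightarrow> real) \<Rightarrow> ('e \<times> real \<Rightarrow> real) \<Rightarrow> bool" where
  "germ_rel F F' \<longleftrightarrow> smooth0 F \<and> smooth0 F' \<and> past_eq F F'"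

lemma part_equivp_germ_rel:
  "part_equivp (germ_rel :: ('e::real_normed_vector \<times> real \<Rightarrow> real) \<Rightarrow> _)"
proof (rule part_equivpI)
  show "\<exists>F :: 'e \<times> real \<Rightarrow> real. germ_rel F F"
    by (intro exI[of _ "\<lambda>z. 0"]) (simp add: germ_rel_def smooth0_const past_eq_refl)
  show "symp (germ_rel :: ('e \<times> real \<Rightarrow> real) \<Rightarrow> _)"
    by (auto simp: symp_def germ_rel_def past_eq_def)
  show "transp (germ_rel :: ('e \<times> real \<Rightarrow> real) \<Rightarrow> _)"
  proof (rule transpI)
    fix F H K :: "'e \<times> real \<Rightarrow> real"
    assume *: "germ_rel F H" "germ_rel H K"
    then obtain W where "open W" "0 \<in> W" "\<And>z. z \<in> W \<Longrightarrow> snd z \<le> 0 \<Longrightarrow> F z = H z \<and> H z = K z"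
      using past_eqE2[of F H H K] by (auto simp: germ_rel_def)
    then have "past_eq F K" unfolding past_eq_def by (intro exI[of _ W]) auto
    with * show "germ_rel F K"
      by (auto simp: germ_rel_def)
  qed
qed

quotient_type (overloaded) 'e germ = "'e::real_normed_vector \<times> real \<Rightarrow> real" / partial: germ_rel
  by (rule part_equivp_germ_rel)

instantiation germ :: (real_normed_vector) comm_ring_1
begin

lift_definition zero_germ :: "'a germ" is "\<lambda>z. 0"
  by (simp add: germ_rel_def smooth0_const past_eq_refl)

lift_definition one_germ :: "'a germ" is "\<lambda>z. 1"
  by (simp add: germ_rel_def smooth0_const past_eq_refl)

lift_definition plus_germ :: "'a germ \<Rightarrow> 'a germ \<Rightarrow> 'a germ" is "\<lambda>F H z. F z + H z"
  by (simp add: germ_rel_def smooth0_add past_eq_add)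

lift_definition times_germ :: "'a germ \<Rightarrow> 'a germ \<Rightarrow> 'a germ" is "\<lambda>F H z. F z * H z"
  by (simp add: germ_rel_def smooth0_mult past_eq_mult)

lift_definition uminus_germ :: "'a germ \<Rightarrow> 'a germ" is "\<lambda>F z. - F z"
  by (simp add: germ_rel_def smooth0_uminus past_eq_uminus)

lift_definition minus_germ :: "'a germ \<Rightarrow> 'a germ \<Rightarrow> 'a germ" is "\<lambda>F H z. F z + - H z"
  by (simp add: germ_rel_def smooth0_add smooth0_uminus past_eq_add past_eq_uminus
       del: add_uminus_conv_diff)

instance
proof
  fix a b c :: "'a germ"
  note s = germ_rel_def smooth0_add smooth0_mult smooth0_uminus smooth0_const past_eq_refl
  show "a + b + c = a + (b + c)"
    by transfer (simp add: s add.assoc)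
  show "a + b = b + a"
    by transfer (simp add: s add.commute)
  show "0 + a = a"
    by transfer (simp add: s)
  show "- a + a = 0"
    by transfer (simp add: s)
  show "a - b = a + - b"
    by transfer (simp add: s del: add_uminus_conv_diff)
  show "a * b * c = a * (b * c)"
    by transfer (simp add: s mult.assoc)
  show "a * b = b * a"
    by transfer (simp add: s mult.commute)
  show "1 * a = a"
    by transfer (simp add: s)
  show "(a + b) * c = a * c + b * c"
    by transfer (simp add: s distrib_right)
  \<comment> \<open>The two constants differ already at the base point, whose time 0 counts as
    past.\<close>
  show "(0::'a germ) \<noteq> 1"
    by transfer (force simp: germ_rel_def past_eq_def)
qed

end

section \<open>Derivatives and evaluation of germs\<close>

lift_definition gd :: "'e::real_normed_vector \<times> real \<Rightarrow> 'e germ \<Rightarrow> 'e germ" is dd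
  by (simp add: germ_rel_def smooth0_dd past_eq_dd)

lift_definition ev :: "'e::real_normed_vector germ \<Rightarrow> real" is "\<lambda>F. F 0"
  by (auto simp: germ_rel_def past_eq_def)

lemma ev_simps:
  "ev 0 = 0" "ev 1 = 1" "ev (a + b) = ev a + ev b" "ev (a * b) = ev a * ev b"
  "ev (- a) = - ev a" "ev (a - b) = ev a - ev b"
  by (transfer; simp)+

lemma ev_two: "ev 2 = 2"
  using ev_simps(3)[of 1 1] by (simp add: ev_simps)

lemma ev_sum: "ev (\<Sum>i\<in>I. f i) = (\<Sum>i\<in>I. ev (f i))"
  by (induction I rule: infinite_finite_induct) (simp_all add: ev_simps)

lemma past_eq_on:
  assumes "open W" "0 \<in> W" "\<And>z. z \<in> W \<Longrightarrow> F z = F' z"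
  shows "past_eq F F'"
  using assms by (auto simp: past_eq_def)

lemma derivation_gd: "derivation (gd v)"
proof
  fix a b :: "'e::real_normed_vector germ" and v :: "'e \<times> real"
  show "gd v (a + b) = gd v a + gd v b"
  proof transfer
    fix v and F H :: "'e \<times> real \<Rightarrow> real"
    assume "germ_rel F F" "germ_rel H H"
    then have F: "smooth0 F" "smooth0 H" by (auto simp: germ_rel_def)
    obtain W where "open W" "0 \<in> W" "csmooth W F" "csmooth W H"
      using smooth0E2[OF F] .
    then have "past_eq (dd v (\<lambda>z. F z + H z)) (\<lambda>z. dd v F z + dd v H z)"
      by (auto intro!: past_eq_on[of W] dd_add)
    then show "germ_rel (dd v (\<lambda>z. F z + H z)) (\<lambda>z. dd v F z + dd v H z)"
      by (auto simp: germ_rel_def intro!: smooth0_dd smooth0_add F)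
  qed
  show "gd v (a * b) = gd v a * b + a * gd v b"
  proof transfer
    fix v and F H :: "'e \<times> real \<Rightarrow> real"
    assume "germ_rel F F" "germ_rel H H"
    then have F: "smooth0 F" "smooth0 H" by (auto simp: germ_rel_def)
    obtain W where "open W" "0 \<in> W" "csmooth W F" "csmooth W H"
      using smooth0E2[OF F] .
    then have "past_eq (dd v (\<lambda>z. F z * H z)) (\<lambda>z. dd v F z * H z + F z * dd v H z)"
      by (auto intro!: past_eq_on[of W] dd_mult)
    then show "germ_rel (dd v (\<lambda>z. F z * H z)) (\<lambda>z. dd v F z * H z + F z * dd v H z)"
      by (auto simp: germ_rel_def intro!: smooth0_dd smooth0_add smooth0_mult F)
  qed
qed

lemma gd_commute: "gd v (gd w a) = gd w (gd v a)"
proof transfer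
  fix v w and F :: "'e::real_normed_vector \<times> real \<Rightarrow> real"
  assume "germ_rel F F"
  then obtain W where F: "smooth0 F" "open W" "0 \<in> W" "csmooth W F"
    by (auto simp: germ_rel_def smooth0_def)
  then have "past_eq (dd v (dd w F)) (dd w (dd v F))"
    by (auto intro!: past_eq_on[of W] dd_commute)
  then show "germ_rel (dd v (dd w F)) (dd w (dd v F))"
    by (auto simp: germ_rel_def intro!: smooth0_dd F)
qed

section \<open>Tangent spaces in a chart\<close>

lemma chart_facts:
  assumes "is_chart c"
  shows "open (chart_dom c)" "open (chart_im c)"
    "continuous_on (chart_dom c) (chart_map c)" "continuous_on (chart_im c) (chart_inv c)"
    "q \<in> chart_dom c \<Longrightarrow> chart_map c q \<in> chart_im c"
    "q \<in> chart_dom c \<Longrightarrow> chart_inv c (chart_map c q) = q"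
    "y \<in> chart_im c \<Longrightarrow> chart_inv c y \<in> chart_dom c"
    "y \<in> chart_im c \<Longrightarrow> chart_map c (chart_inv c y) = y"
  using assms unfolding is_chart_def homeomorphism_def by auto

text \<open>Smoothness on a set only provides a local extension; as the chart image of the overlap
  is open, the extension coincides with the transition map near the point.\<close>

lemma transition_differentiable:
  assumes A: "smooth_atlas A" and c: "c \<in> A" "d \<in> A" and p: "p \<in> chart_dom c" "p \<in> chart_dom d"
  obtains \<tau>' where "(chart_map d \<circ> chart_inv c has_derivative \<tau>') (at (chart_map c p))"
proof -
  have "is_chart c" "is_chart d" using A c by (auto simp: smooth_atlas_def)
  note cc = chart_facts[OF this(1)] and cd = chart_facts[OF this(2)]
  let ?S = "chart_map c ` (chart_dom c \<inter> chart_dom d)"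
  have "?S = chart_im c \<inter> chart_inv c -` chart_dom d"
    using cc by force
  moreover have "open (chart_im c \<inter> chart_inv c -` chart_dom d)"
    by (rule continuous_open_preimage[OF cc(4,2) cd(1)])
  ultimately have S: "open ?S" by simp
  have pS: "chart_map c p \<in> ?S" using p by auto
  obtain W F where W: "open W" "chart_map c p \<in> W" "\<forall>k. Ck_on k W F"
     "\<forall>y\<in>W \<inter> ?S. F y = (chart_map d \<circ> chart_inv c) y"
    using A c pS unfolding smooth_atlas_def smooth_on_def by blast
  have "F differentiable (at (chart_map c p))"
    using W(2,3) Ck_on.simps(2)[of 0 W F] by blast
  then obtain \<tau>' where "(F has_derivative \<tau>') (at (chart_map c p))"
    by (auto simp: differentiable_def)
  then have "(chart_map d \<circ> chart_inv c has_derivative \<tau>') (at (chart_map c p))"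
    by (rule has_derivative_transform_within_open[of _ _ _ _ "W \<inter> ?S"]) (use W S pS in auto)
  then show ?thesis by (rule that)
qed

lemma chart_change_derivative:
  assumes A: "smooth_atlas A" and c: "c \<in> A" "d \<in> A" and p: "p \<in> chart_dom c" "p \<in> chart_dom d"
    and \<tau>: "(chart_map c \<circ> chart_inv d has_derivative \<tau>') (at (chart_map d p))"
    and f: "(f \<circ> chart_inv c has_derivative f') (at (chart_map c p))"
  shows "(f \<circ> chart_inv d has_derivative (\<lambda>v. f' (\<tau>' v))) (at (chart_map d p))"
proof -
  have "is_chart c" "is_chart d" using A c by (auto simp: smooth_atlas_def)
  note cc = chart_facts[OF this(1)] and cd = chart_facts[OF this(2)]
  have S: "open (chart_im d \<inter> chart_inv d -` chart_dom c)"
    by (rule continuous_open_preimage[OF cd(4,2) cc(1)])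
  have "((f \<circ> chart_inv c) \<circ> (chart_map c \<circ> chart_inv d) has_derivative f' \<circ> \<tau>') (at (chart_map d p))"
    by (rule diff_chain_at[OF \<tau>]) (use f p cd in simp)
  then have "(f \<circ> chart_inv d has_derivative f' \<circ> \<tau>') (at (chart_map d p))"
    by (rule has_derivative_transform_within_open[OF _ S]) (use p cc cd in auto)
  then show ?thesis by (simp add: o_def)
qed

text \<open>By the chain rule a vector \<open>v\<close> in one chart is its image under the
  derivative of the transition map in the other. The inverse transition is used as well: tangent
  vectors vanish by convention on functions that are not differentiable, so differentiability must
  transfer in both directions.\<close>

lemma tangent_space_eq:
  assumes A: "smooth_atlas A" and c: "c \<in> A" and p: "p \<in> chart_dom c"
  shows "tangent_space A p = range (coord_vector c p)"
proof -
  have "coord_vector d p v \<in> range (coord_vector c p)" if d: "d \<in> A" "p \<in> chart_dom d" for d v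
  proof -
    obtain \<tau>' where \<tau>: "(chart_map c \<circ> chart_inv d has_derivative \<tau>') (at (chart_map d p))"
      using transition_differentiable[OF A d(1) c d(2) p] .
    obtain \<sigma>' where \<sigma>: "(chart_map d \<circ> chart_inv c has_derivative \<sigma>') (at (chart_map c p))"
      using transition_differentiable[OF A c d(1) p d(2)] .
    have "coord_vector d p v f = coord_vector c p (\<tau>' v) f" for f
    proof (cases "(f \<circ> chart_inv c) differentiable (at (chart_map c p))")
      case True
      then obtain f' where f': "(f \<circ> chart_inv c has_derivative f') (at (chart_map c p))"
        by (auto simp: differentiable_def)
      have "(f \<circ> chart_inv d has_derivative (\<lambda>v. f' (\<tau>' v))) (at (chart_map d p))"
        by (rule chart_change_derivative[OF A c d(1) p d(2) \<tau> f'])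
      with True f' show ?thesis
        unfolding coord_vector_def by (metis differentiableI frechet_derivative_at)
    next
      case False
      have "\<not> (f \<circ> chart_inv d) differentiable (at (chart_map d p))"
        using False chart_change_derivative[OF A d(1) c d(2) p \<sigma>] by (auto simp: differentiable_def)
      with False show ?thesis by (simp add: coord_vector_def)
    qed
    then show ?thesis by (auto simp: fun_eq_iff)
  qed
  then show ?thesis
    using c p unfolding tangent_space_def by blast
qed

text \<open>The redundant coefficients 1 and 0 give the right-hand sides the shape of the linearity
  clause in \<open>inner_product_field\<close>.\<close>

lemma coord_vector_add: "coord_vector c p (v + w) = (\<lambda>f. 1 * coord_vector c p v f + 1 * coord_vector c p w f)"
  and coord_vector_scale: "coord_vector c p (r *\<^sub>R v) = (\<lambda>f. r * coord_vector c p v f + 0 * coord_vector c p v f)"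
  by (auto simp: coord_vector_def fun_eq_iff frechet_derivative_works linear_add linear_cmul has_derivative_linear)

lemma coord_vector_sum: "coord_vector c p v f = (\<Sum>i\<in>UNIV. v $ i * coord_basis c i p f)"
proof -
  have "linear (\<lambda>v. coord_vector c p v f)"
    by (rule linearI) (simp_all add: coord_vector_add coord_vector_scale)
  from linear_sum[OF this, of "\<lambda>i. v $ i *\<^sub>R axis i 1" UNIV] linear_cmul[OF this]
  show ?thesis
    using basis_expansion[of v] by (simp add: coord_basis_def scalar_mult_eq_scaleR)
qed

lemma component_coord_vector:
  assumes "is_chart c" "p \<in> chart_dom c"
  shows "component c i (coord_vector c p v) = v $ i"
proof -
  note cc = chart_facts[OF assms(1)]
  have "((\<lambda>y. y $ i) has_derivative (\<lambda>y. y $ i)) (at (chart_map c p))"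
    by (rule bounded_linear_imp_has_derivative[OF bounded_linear_vec_nth])
  then have "((\<lambda>q. chart_map c q $ i) \<circ> chart_inv c has_derivative (\<lambda>y. y $ i)) (at (chart_map c p))"
    by (rule has_derivative_transform_within_open[OF _ cc(2)]) (use assms cc in auto)
  then show ?thesis
    unfolding component_def coord_vector_def by (metis differentiableI frechet_derivative_at)
qed

section \<open>The metric at a point in the coordinates of a chart\<close>

locale chart_metric =
  fixes A :: "('m::t2_space, 'n::finite) chart set" and c p and g :: "'m metric_field"
  assumes A: "smooth_atlas A" and c: "c \<in> A" and p: "p \<in> chart_dom c" and g: "inner_product_field A g"
begin

lemma chart: "is_chart c"
  using A c by (auto simp: smooth_atlas_def)

lemmas tangent = tangent_space_eq[OF A c p]

lemma tangent_mem: "coord_vector c p v \<in> tangent_space A p"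
  by (simp add: tangent)

lemma g_sym: "g p (coord_vector c p v) (coord_vector c p w) = g p (coord_vector c p w) (coord_vector c p v)"
  using g tangent_mem unfolding inner_product_field_def by blast

lemma g_linear: "linear (\<lambda>v. g p (coord_vector c p v) (coord_vector c p w))"
proof -
  have *: "g p (\<lambda>f. a * coord_vector c p v f + b * coord_vector c p v' f) (coord_vector c p w) =
     a * g p (coord_vector c p v) (coord_vector c p w) + b * g p (coord_vector c p v') (coord_vector c p w)"
    for a b v v'
    using g tangent_mem unfolding inner_product_field_def by blast
  show ?thesis
    by (rule linearI) (simp_all only: coord_vector_add coord_vector_scale *, simp_all)
qed

lemma g_left: "g p (coord_vector c p v) Z = (\<Sum>i\<in>UNIV. v $ i * g p (coord_basis c i p) Z)"
  if Z: "Z \<in> tangent_space A p"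
proof -
  obtain w where w: "Z = coord_vector c p w" using Z by (auto simp: tangent)
  from linear_sum[OF g_linear[of w], of "\<lambda>i. v $ i *\<^sub>R axis i 1" UNIV] linear_cmul[OF g_linear[of w]]
  show ?thesis
    using basis_expansion[of v] by (simp add: coord_basis_def scalar_mult_eq_scaleR w)
qed

abbreviation "gc i j \<equiv> metric_coeff c g i j p"

lemma gc_sym: "gc i j = gc j i"
  unfolding metric_coeff_def coord_basis_def by (rule g_sym)

lemma g_form: "g p (coord_vector c p v) (coord_vector c p w) = form gc (\<lambda>i. v $ i) (\<lambda>i. w $ i)"
proof -
  have "g p (coord_basis c i p) (coord_vector c p w) = (\<Sum>j\<in>UNIV. w $ j * gc i j)" for i
    unfolding coord_basis_def
    by (subst g_sym) (use g_left[OF tangent_mem, of w] in \<open>simp add: coord_basis_def metric_coeff_def g_sym[of "axis i 1"]\<close>)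
  then show ?thesis
    by (simp add: g_left[OF tangent_mem] form_def sum_distrib_left mult_ac)
qed

lemma coord_vector_eq_0: "coord_vector c p v = (\<lambda>f. 0) \<longleftrightarrow> v = 0"
proof
  assume *: "coord_vector c p v = (\<lambda>f. 0)"
  have "v $ i = 0" for i
    using component_coord_vector[OF chart p, of i v] by (simp add: component_def *)
  then show "v = 0" by (simp add: vec_eq_iff)
qed (simp add: coord_vector_sum fun_eq_iff)

lemma gc_pos: "x \<noteq> (\<lambda>i. 0) \<Longrightarrow> form gc x x > 0"
proof -
  assume "x \<noteq> (\<lambda>i. 0)"
  then have "coord_vector c p (\<chi> i. x i) \<noteq> (\<lambda>f. 0)"
    unfolding coord_vector_eq_0 by (auto simp: vec_eq_iff)
  then have "g p (coord_vector c p (\<chi> i. x i)) (coord_vector c p (\<chi> i. x i)) > 0"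
    using g tangent_mem unfolding inner_product_field_def by blast
  then show ?thesis by (simp add: g_form)
qed

text \<open>A vector in the kernel of the coefficient matrix would have length 0.\<close>

lemma det_nz: "det (\<chi> i j. gc i j) \<noteq> 0"
proof
  assume "det (\<chi> i j. gc i j) = 0"
  then have "\<not> invertible (\<chi> i j. gc i j)"
    by (simp add: invertible_det_nz)
  then obtain x where x: "x \<noteq> 0" "(\<chi> i j. gc i j) *v x = 0"
    by (auto simp: invertible_left_inverse matrix_left_invertible_ker)
  have "form gc (\<lambda>i. x $ i) (\<lambda>i. x $ i) = (\<Sum>i\<in>UNIV. x $ i * ((\<chi> i j. gc i j) *v x) $ i)"
    by (simp add: form_def matrix_vector_mult_def sum_distrib_left mult_ac)
  also have "\<dots> = 0" by (simp add: x)
  finally show False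
    using gc_pos[of "\<lambda>i. x $ i"] x by (auto simp: vec_eq_iff fun_eq_iff)
qed

abbreviation "gic i j \<equiv> inverse_metric_coeff c g i j p"

text \<open>Cramer's formula exhibits the inverse coefficients as quotients of polynomials in the
  metric coefficients, from which their smoothness will follow.\<close>

lemma gic_cramer:
  "gic k j = det (\<chi> i l. if l = k then (if i = j then 1 else 0) else gc i l) / det (\<chi> i l. gc i l)"
  and inv_right: "(\<Sum>j\<in>UNIV. gc i j * gic j k) = (if i = k then 1 else 0)"
  and inv_left: "(\<Sum>j\<in>UNIV. gic i j * gc j k) = (if i = k then 1 else 0)"
proof -
  let ?M = "\<chi> i j. gc i j"
  have "invertible ?M" by (simp add: invertible_det_nz det_nz)
  then have M: "?M ** matrix_inv ?M = mat 1" "matrix_inv ?M ** ?M = mat 1"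
    unfolding matrix_inv_def invertible_def by (metis (mono_tags, lifting) someI_ex)+
  show "(\<Sum>j\<in>UNIV. gc i j * gic j k) = (if i = k then 1 else 0)"
    "(\<Sum>j\<in>UNIV. gic i j * gc j k) = (if i = k then 1 else 0)" for i k
    using M by (auto simp: inverse_metric_coeff_def vec_eq_iff matrix_matrix_mult_def mat_def)
  then have "?M *v (\<chi> i. gic i j) = (\<chi> i. if i = j then 1 else 0)"
    by (simp add: matrix_vector_mult_def vec_eq_iff)
  then show "gic k j = det (\<chi> i l. if l = k then (if i = j then 1 else 0) else gc i l) / det (\<chi> i l. gc i l)"
    unfolding cramer[OF det_nz] by (simp add: vec_eq_iff cong: if_cong)
qed

lemma gic_sym: "gic i j = gic j i"
proof -
  let ?M = "\<chi> i j. gc i j" and ?N = "\<chi> i j. gic i j"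
  have "?N ** ?M = mat 1" "?M ** ?N = mat 1"
    using inv_left inv_right by (simp_all add: vec_eq_iff matrix_matrix_mult_def mat_def)
  moreover from this have "transpose ?M ** transpose ?N = mat 1"
    by (metis matrix_transpose_mul transpose_mat)
  moreover have "transpose ?M = ?M"
    by (simp add: transpose_def vec_eq_iff gc_sym)
  ultimately have "?N ** (?M ** transpose ?N) = ?N" "(?N ** ?M) ** transpose ?N = transpose ?N"
    by simp_all
  then have "transpose ?N = ?N"
    by (simp only: matrix_mul_assoc)
  then show ?thesis by (simp add: transpose_def vec_eq_iff)
qed

text \<open>The gradient is the differential with raised index, \<open>v\<close>; it is the only
  candidate because the difference of two would have length 0. Its square length is then the
  differential applied to it.\<close>

lemma gradient_norm:
  "(metric_norm g p (gradient A g f p))\<^sup>2 =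
     (\<Sum>i\<in>UNIV. \<Sum>j\<in>UNIV. gic i j * (partial c i f p * partial c j f p))"
proof -
  define v where "v = (\<chi> i. \<Sum>j\<in>UNIV. gic i j * partial c j f p)"
  have lower: "(\<Sum>i\<in>UNIV. gc k i * v $ i) = partial c k f p" for k
  proof -
    have "(\<Sum>i\<in>UNIV. gc k i * v $ i) = (\<Sum>j\<in>UNIV. (\<Sum>i\<in>UNIV. gc k i * gic i j) * partial c j f p)"
      unfolding v_def by (simp add: sum_distrib_left sum_distrib_right mult.assoc) (rule sum.swap)
    also have "\<dots> = partial c k f p"
      by (simp add: inv_right if_distrib[of "\<lambda>x. x * _"] cong: if_cong)
    finally show ?thesis .
  qed
  have Y: "g p (coord_vector c p v) (coord_vector c p w) = coord_vector c p w f" for w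
  proof -
    have "form gc (\<lambda>i. w $ i) (\<lambda>i. v $ i) = (\<Sum>k\<in>UNIV. w $ k * (\<Sum>i\<in>UNIV. gc k i * v $ i))"
      by (simp add: form_def sum_distrib_left mult_ac)
    then show ?thesis
      by (subst g_sym) (simp add: g_form lower coord_vector_sum partial_def)
  qed
  have "gradient A g f p = coord_vector c p v"
    unfolding gradient_def tangent
  proof (rule the_equality)
    show "coord_vector c p v \<in> range (coord_vector c p) \<and> (\<forall>X\<in>range (coord_vector c p). g p (coord_vector c p v) X = X f)"
      using Y by auto
  next
    fix Z assume Z: "Z \<in> range (coord_vector c p) \<and> (\<forall>X\<in>range (coord_vector c p). g p Z X = X f)"
    then obtain w where w: "Z = coord_vector c p w" by auto
    have "g p (coord_vector c p (w - v)) (coord_vector c p (w - v)) = 0"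
      using Z Y linear_diff[OF g_linear[of "w - v"], of w v] by (simp add: w)
    then have "(\<lambda>i. (w - v) $ i) = (\<lambda>i. 0)"
      using gc_pos[of "\<lambda>i. (w - v) $ i"] unfolding g_form by fastforce
    then have "w = v"
      by (simp add: vec_eq_iff fun_eq_iff)
    then show "Z = coord_vector c p v"
      by (simp add: w)
  qed
  moreover have "g p (coord_vector c p v) (coord_vector c p v) \<ge> 0"
    using gc_pos[of "\<lambda>i. v $ i"] unfolding g_form by (cases "(\<lambda>i. v $ i) = (\<lambda>i. 0)") (auto simp: form_def)
  ultimately have "(metric_norm g p (gradient A g f p))\<^sup>2 = coord_vector c p v f"
    by (simp add: metric_norm_def Y)
  then show ?thesis
    by (simp add: coord_vector_sum v_def partial_def[symmetric] sum_distrib_left sum_distrib_right mult_ac)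
qed

end

section \<open>Germs of functions on the manifold\<close>

lemma open_segment_through_0:
  fixes v :: "'a::real_normed_vector"
  assumes "open W" "0 \<in> W"
  shows "\<exists>\<delta>>0. \<forall>s. \<bar>s\<bar> < \<delta> \<longrightarrow> s *\<^sub>R v \<in> W"
proof -
  have "open ((\<lambda>s. s *\<^sub>R v) -` W)"
    using assms by (intro open_vimage continuous_intros)
  moreover have "0 \<in> (\<lambda>s. s *\<^sub>R v) -` W" using assms by simp
  ultimately obtain \<delta> where "\<delta> > 0" "\<forall>s. dist s 0 < \<delta> \<longrightarrow> s \<in> (\<lambda>s. s *\<^sub>R v) -` W"
    unfolding open_dist by blast
  then show ?thesis by (auto simp: dist_real_def)
qed

locale chart_point =
  fixes A :: "('m::t2_space, 'n::finite) chart set" and c p and t0 T :: real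
  assumes A: "smooth_atlas A" and c: "c \<in> A" and p: "p \<in> chart_dom c" and t0: "0 < t0" "t0 \<le> T"
begin

lemma chart: "is_chart c"
  using A c by (auto simp: smooth_atlas_def)

lemmas ch = chart_facts[OF chart]

abbreviation "y0 \<equiv> chart_map c p"

text \<open>The origin of \<open>F\<close> is the space-time point \<open>(y0, t0)\<close>.
  \<open>F\<close> is smooth on a full neighbourhood, even if this extends beyond time
  \<open>T\<close>; it is tied to \<open>\<Phi>\<close> only at times in the interval, so for t0 = T
  there are many such \<open>F\<close>.\<close>

definition repr :: "((real^'n) \<times> real) set \<Rightarrow> ('m \<Rightarrow> real \<Rightarrow> real) \<Rightarrow> ((real^'n) \<times> real \<Rightarrow> real) \<Rightarrow> bool" where
  "repr W \<Phi> F \<longleftrightarrow> open W \<and> 0 \<in> W \<and> csmooth W F \<and> (\<forall>z\<in>W. y0 + fst z \<in> chart_im c) \<and>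
     (\<forall>z\<in>W. t0 + snd z \<in> {0..T} \<longrightarrow> \<Phi> (chart_inv c (y0 + fst z)) (t0 + snd z) = F z)"

text \<open>\<open>sm \<Phi>\<close>: near \<open>(p, t0)\<close> the function \<open>\<Phi>\<close> is smooth up to the end of the time interval;
  \<open>gm \<Phi>\<close> is its germ in the chart \<open>c\<close>.\<close>

definition sm :: "('m \<Rightarrow> real \<Rightarrow> real) \<Rightarrow> bool" where
  "sm \<Phi> \<longleftrightarrow> (\<exists>W F. repr W \<Phi> F)"

definition gm :: "('m \<Rightarrow> real \<Rightarrow> real) \<Rightarrow> (real^'n) germ" where
  "gm \<Phi> = abs_germ (SOME F. \<exists>W. repr W \<Phi> F)"

lemma repr_smooth0: "repr W \<Phi> F \<Longrightarrow> smooth0 F"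
  by (auto simp: repr_def smooth0_def)

lemma repr_germ_rel: "repr W \<Phi> F \<Longrightarrow> germ_rel F F"
  by (auto simp: germ_rel_def past_eq_refl repr_smooth0)

lemma repr_subset: "repr W \<Phi> F \<Longrightarrow> open W' \<Longrightarrow> 0 \<in> W' \<Longrightarrow> W' \<subseteq> W \<Longrightarrow> repr W' \<Phi> F"
  by (auto simp: repr_def intro: csmooth_subset)

text \<open>Two representatives agree wherever the time lies in the interval. Times before
  \<open>t0\<close> do so once the neighbourhood is cut at - t0 in shifted time, which is where
  \<open>0 < t0\<close> enters.\<close>

lemma gm_eq:
  assumes "repr W \<Phi> F"
  shows "gm \<Phi> = abs_germ F"
proof -
  define F' where "F' = (SOME F. \<exists>W. repr W \<Phi> F)"
  have "\<exists>W. repr W \<Phi> F'" unfolding F'_def by (rule someI[of _ F]) (use assms in blast)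
  then obtain W' where F': "repr W' \<Phi> F'" by blast
  have "open (W \<inter> W' \<inter> {z. snd z > - t0})"
    using assms F' unfolding repr_def by (intro open_Int open_Collect_less continuous_intros) auto
  moreover have "0 \<in> W \<inter> W' \<inter> {z. snd z > - t0}"
    using assms F' t0 by (auto simp: repr_def)
  moreover have "F' z = F z" if "z \<in> W \<inter> W' \<inter> {z. snd z > - t0}" "snd z \<le> 0" for z
  proof -
    have "t0 + snd z \<in> {0..T}" using that t0 by auto
    with that assms F' show ?thesis unfolding repr_def by (metis IntD1 IntD2)
  qed
  ultimately have "past_eq F' F"
    unfolding past_eq_def by blast
  then have "germ_rel F' F"
    using assms F' by (auto simp: germ_rel_def repr_smooth0)
  then show ?thesis
    unfolding gm_def F'_def[symmetric] by (rule Quotient_rel_abs[OF Quotient_germ])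
qed

lemma repr_sm: "repr W \<Phi> F \<Longrightarrow> sm \<Phi>"
  by (auto simp: sm_def)

lemma sm_cong:
  assumes "\<And>q t. q \<in> chart_dom c \<Longrightarrow> t \<in> {0..T} \<Longrightarrow> \<Phi> q t = \<Psi> q t" "sm \<Phi>"
  shows "sm \<Psi>" "gm \<Psi> = gm \<Phi>"
proof -
  obtain W F where F: "repr W \<Phi> F" using assms by (auto simp: sm_def)
  then have "repr W \<Psi> F"
    using assms(1)[symmetric] ch(7) by (auto simp: repr_def)
  with F show "sm \<Psi>" "gm \<Psi> = gm \<Phi>"
    by (auto simp: gm_eq sm_def)
qed

lemma repr_op:
  assumes "repr W \<Phi> F" "repr W' \<Psi> H"
  obtains V where "repr V \<Phi> F" "repr V \<Psi> H"
  using that[of "W \<inter> W'"] repr_subset[OF assms(1), of "W \<inter> W'"] repr_subset[OF assms(2), of "W \<inter> W'"] assms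
  by (auto simp: repr_def)

lemma sm_const: "sm (\<lambda>q t. a)"
  and gm_0: "gm (\<lambda>q t. 0) = 0" and gm_1: "gm (\<lambda>q t. 1) = 1"
proof -
  define W where "W = (\<lambda>z::(real^'n) \<times> real. y0 + fst z) -` chart_im c"
  have "open W"
    unfolding W_def by (intro open_vimage ch continuous_intros)
  then have r: "repr W (\<lambda>q t. a) (\<lambda>z. a)" for a :: real
    using ch(5)[OF p] by (auto simp: repr_def W_def csmooth_const)
  then show "sm (\<lambda>q t. a)" "gm (\<lambda>q t. 0) = 0" "gm (\<lambda>q t. 1) = 1"
    by (auto simp: sm_def gm_eq[OF r] zero_germ_def one_germ_def map_fun_def)
qed

lemma sm_add: "sm \<Phi> \<Longrightarrow> sm \<Psi> \<Longrightarrow> sm (\<lambda>q t. \<Phi> q t + \<Psi> q t)"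
  and gm_add: "sm \<Phi> \<Longrightarrow> sm \<Psi> \<Longrightarrow> gm (\<lambda>q t. \<Phi> q t + \<Psi> q t) = gm \<Phi> + gm \<Psi>"
  and sm_mult: "sm \<Phi> \<Longrightarrow> sm \<Psi> \<Longrightarrow> sm (\<lambda>q t. \<Phi> q t * \<Psi> q t)"
  and gm_mult: "sm \<Phi> \<Longrightarrow> sm \<Psi> \<Longrightarrow> gm (\<lambda>q t. \<Phi> q t * \<Psi> q t) = gm \<Phi> * gm \<Psi>"
proof -
  assume "sm \<Phi>" "sm \<Psi>"
  then obtain V F H where r: "repr V \<Phi> F" "repr V \<Psi> H"
    unfolding sm_def by (metis repr_op)
  then have 1: "repr V (\<lambda>q t. \<Phi> q t + \<Psi> q t) (\<lambda>z. F z + H z)"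
    and 2: "repr V (\<lambda>q t. \<Phi> q t * \<Psi> q t) (\<lambda>z. F z * H z)"
    by (auto simp: repr_def intro: csmooth_add csmooth_mult)
  show "sm (\<lambda>q t. \<Phi> q t + \<Psi> q t)" "sm (\<lambda>q t. \<Phi> q t * \<Psi> q t)"
    using 1 2 by (auto simp: sm_def)
  show "gm (\<lambda>q t. \<Phi> q t + \<Psi> q t) = gm \<Phi> + gm \<Psi>" "gm (\<lambda>q t. \<Phi> q t * \<Psi> q t) = gm \<Phi> * gm \<Psi>"
    using r[THEN repr_germ_rel]
    by (simp_all add: gm_eq[OF 1] gm_eq[OF 2] r[THEN gm_eq] plus_germ.abs_eq times_germ.abs_eq)
qed

lemma sm_minus: "sm \<Phi> \<Longrightarrow> sm (\<lambda>q t. - \<Phi> q t)"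
  and gm_minus: "sm \<Phi> \<Longrightarrow> gm (\<lambda>q t. - \<Phi> q t) = - gm \<Phi>"
proof -
  assume s: "sm \<Phi>"
  show m: "sm (\<lambda>q t. - \<Phi> q t)"
    using sm_mult[OF sm_const[of "- 1"] s] by simp
  have "gm (\<lambda>q t. \<Phi> q t + - \<Phi> q t) = gm \<Phi> + gm (\<lambda>q t. - \<Phi> q t)"
    by (rule gm_add[OF s m])
  then show "gm (\<lambda>q t. - \<Phi> q t) = - gm \<Phi>"
    by (simp add: gm_0 eq_neg_iff_add_eq_0 add.commute)
qed

lemma sm_diff: "sm \<Phi> \<Longrightarrow> sm \<Psi> \<Longrightarrow> sm (\<lambda>q t. \<Phi> q t - \<Psi> q t)"
  and gm_diff: "sm \<Phi> \<Longrightarrow> sm \<Psi> \<Longrightarrow> gm (\<lambda>q t. \<Phi> q t - \<Psi> q t) = gm \<Phi> - gm \<Psi>"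
  using sm_add[OF _ sm_minus, of \<Phi> \<Psi>] gm_add[OF _ sm_minus, of \<Phi> \<Psi>] by (simp_all add: gm_minus)

lemma sm_sum: "(\<And>i. i \<in> I \<Longrightarrow> sm (\<Phi> i)) \<Longrightarrow> sm (\<lambda>q t. \<Sum>i\<in>I. \<Phi> i q t)"
  and gm_sum: "(\<And>i. i \<in> I \<Longrightarrow> sm (\<Phi> i)) \<Longrightarrow> gm (\<lambda>q t. \<Sum>i\<in>I. \<Phi> i q t) = (\<Sum>i\<in>I. gm (\<Phi> i))"
proof -
  have "(\<forall>i\<in>I. sm (\<Phi> i)) \<longrightarrow> sm (\<lambda>q t. \<Sum>i\<in>I. \<Phi> i q t) \<and> gm (\<lambda>q t. \<Sum>i\<in>I. \<Phi> i q t) = (\<Sum>i\<in>I. gm (\<Phi> i))"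
    by (induction I rule: infinite_finite_induct) (auto simp: sm_const gm_0 sm_add gm_add)
  then show "(\<And>i. i \<in> I \<Longrightarrow> sm (\<Phi> i)) \<Longrightarrow> sm (\<lambda>q t. \<Sum>i\<in>I. \<Phi> i q t)"
    "(\<And>i. i \<in> I \<Longrightarrow> sm (\<Phi> i)) \<Longrightarrow> gm (\<lambda>q t. \<Sum>i\<in>I. \<Phi> i q t) = (\<Sum>i\<in>I. gm (\<Phi> i))" by auto
qed

lemma sm_prod: "(\<And>i. i \<in> I \<Longrightarrow> sm (\<Phi> i)) \<Longrightarrow> sm (\<lambda>q t. \<Prod>i\<in>I. \<Phi> i q t)"
proof -
  have "(\<forall>i\<in>I. sm (\<Phi> i)) \<longrightarrow> sm (\<lambda>q t. \<Prod>i\<in>I. \<Phi> i q t)"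
    by (induction I rule: infinite_finite_induct) (auto simp: sm_const sm_mult)
  then show "(\<And>i. i \<in> I \<Longrightarrow> sm (\<Phi> i)) \<Longrightarrow> sm (\<lambda>q t. \<Prod>i\<in>I. \<Phi> i q t)" by auto
qed

lemma sm_det:
  fixes M :: "'m \<Rightarrow> real \<Rightarrow> 'k::finite \<Rightarrow> 'k \<Rightarrow> real"
  assumes "\<And>i j. sm (\<lambda>q t. M q t i j)"
  shows "sm (\<lambda>q t. det (\<chi> i j. M q t i j))"
  unfolding det_def by (simp, intro sm_sum sm_mult sm_const sm_prod assms)

lemma repr_0:
  assumes "repr W \<Phi> F"
  shows "F 0 = \<Phi> p t0"
proof -
  have "0 \<in> W" "t0 + snd (0 :: (real^'n) \<times> real) \<in> {0..T}"
    using assms t0 by (auto simp: repr_def)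
  then have "\<Phi> (chart_inv c (y0 + 0)) (t0 + 0) = F 0"
    using assms unfolding repr_def by (metis fst_zero snd_zero)
  then show ?thesis using ch(6) p by simp
qed

text \<open>Positivity or nonvanishing of \<open>\<Phi>\<close> says nothing about its extension
  beyond \<open>T\<close>; continuity at the base point forces it on a smaller neighbourhood, so
  that \<open>inverse\<close> and \<open>ln\<close> of the extension are smooth.\<close>

lemma repr_near:
  assumes "repr W \<Phi> F" "open S" "\<Phi> p t0 \<in> S"
  obtains V where "repr V \<Phi> F" "\<And>z. z \<in> V \<Longrightarrow> F z \<in> S"
proof -
  note repr_0[OF assms(1)]
  moreover have "open (W \<inter> F -` S)"
    using assms by (intro continuous_open_preimage csmooth_continuous_on) (auto simp: repr_def)
  ultimately have "repr (W \<inter> F -` S) \<Phi> F"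
    using assms by (intro repr_subset[OF assms(1)]) (auto simp: repr_def)
  then show ?thesis by (rule that) auto
qed

lemma sm_inverse:
  assumes "sm \<Phi>" "\<Phi> p t0 \<noteq> 0"
  shows "sm (\<lambda>q t. inverse (\<Phi> q t))"
proof -
  obtain W F where "repr W \<Phi> F" using assms by (auto simp: sm_def)
  then obtain V where V: "repr V \<Phi> F" "\<And>z. z \<in> V \<Longrightarrow> F z \<in> - {0}"
    using repr_near[of W \<Phi> F "- {0}"] assms by auto
  then have "repr V (\<lambda>q t. inverse (\<Phi> q t)) (\<lambda>z. inverse (F z))"
    by (auto simp: repr_def intro!: csmooth_inverse)
  then show ?thesis by (rule repr_sm)
qed

lemma sm_divide: "sm \<Phi> \<Longrightarrow> sm \<Psi> \<Longrightarrow> \<Psi> p t0 \<noteq> 0 \<Longrightarrow> sm (\<lambda>q t. \<Phi> q t / \<Psi> q t)"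
  unfolding divide_inverse by (intro sm_mult sm_inverse)

text \<open>The derivative rule is stated as a product, so that in the ring of germs no division by
  \<open>\<Phi>\<close> is needed.\<close>

lemma sm_ln:
  assumes "sm \<Phi>" "\<Phi> p t0 > 0"
  shows "sm (\<lambda>q t. ln (\<Phi> q t))" "gd v (gm \<Phi>) = gm \<Phi> * gd v (gm (\<lambda>q t. ln (\<Phi> q t)))"
proof -
  obtain W F where "repr W \<Phi> F" using assms by (auto simp: sm_def)
  then obtain V where V: "repr V \<Phi> F" "\<And>z. z \<in> V \<Longrightarrow> F z \<in> {0<..}"
    using repr_near[of W \<Phi> F "{0<..}"] assms by auto
  then have r: "repr V (\<lambda>q t. ln (\<Phi> q t)) (\<lambda>z. ln (F z))"
    by (auto simp: repr_def intro!: csmooth_ln)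
  then show "sm (\<lambda>q t. ln (\<Phi> q t))" by (rule repr_sm)
  have F: "csmooth V F" "open V" "0 \<in> V" using V by (auto simp: repr_def)
  have "past_eq (dd v F) (\<lambda>z. F z * dd v (\<lambda>z. ln (F z)) z)"
  proof (rule past_eq_on[OF F(2,3)])
    fix z assume z: "z \<in> V"
    then have "F z > 0" using V(2) by auto
    with dd_eqI[OF ln_has_derivative[OF F(1) z]] show "dd v F z = F z * dd v (\<lambda>z. ln (F z)) z"
      by simp
  qed
  moreover have "smooth0 F" "smooth0 (\<lambda>z. ln (F z))"
    using V(1) r by (auto intro: repr_smooth0)
  ultimately have "germ_rel (dd v F) (\<lambda>z. F z * dd v (\<lambda>z. ln (F z)) z)"
    by (auto simp: germ_rel_def intro!: smooth0_dd smooth0_mult)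
  then have "abs_germ (dd v F) = abs_germ (\<lambda>z. F z * dd v (\<lambda>z. ln (F z)) z)"
    by (rule Quotient_rel_abs[OF Quotient_germ])
  moreover have "germ_rel (dd v (\<lambda>z. ln (F z))) (dd v (\<lambda>z. ln (F z)))"
    using repr_smooth0[OF r] by (simp add: germ_rel_def smooth0_dd past_eq_refl)
  ultimately show "gd v (gm \<Phi>) = gm \<Phi> * gd v (gm (\<lambda>q t. ln (\<Phi> q t)))"
    using repr_germ_rel[OF V(1)] repr_germ_rel[OF r]
    by (simp add: gm_eq[OF V(1)] gm_eq[OF r] gd.abs_eq times_germ.abs_eq)
qed

lemma sm_partial: "sm \<Phi> \<Longrightarrow> sm (\<lambda>q t. partial c i (\<lambda>q. \<Phi> q t) q)"
  and gm_partial: "sm \<Phi> \<Longrightarrow> gm (\<lambda>q t. partial c i (\<lambda>q. \<Phi> q t) q) = gd (axis i 1, 0) (gm \<Phi>)"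
proof -
  assume "sm \<Phi>"
  then obtain W F where r: "repr W \<Phi> F" by (auto simp: sm_def)
  then have F: "open W" "csmooth W F" "\<And>z. z \<in> W \<Longrightarrow> y0 + fst z \<in> chart_im c"
    "\<And>z. z \<in> W \<Longrightarrow> t0 + snd z \<in> {0..T} \<Longrightarrow> \<Phi> (chart_inv c (y0 + fst z)) (t0 + snd z) = F z"
    by (auto simp: repr_def)
  have "partial c i (\<lambda>q. \<Phi> q (t0 + snd z)) (chart_inv c (y0 + fst z)) = dd (axis i 1, 0) F z"
    if z: "z \<in> W" "t0 + snd z \<in> {0..T}" for z
  proof -
    let ?V = "(\<lambda>y. (y - y0, snd z)) -` W"
    have V: "open ?V" "y0 + fst z \<in> ?V"
      using F(1) z by (auto intro!: open_vimage continuous_intros)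
    have "((\<lambda>y. (y - y0, snd z)) has_derivative (\<lambda>h. (h, 0))) (at (y0 + fst z))"
      by (auto intro!: derivative_eq_intros)
    from has_derivative_compose[OF this, of F "frechet_derivative F (at z)"] csmooth_has_derivative[OF F(2) z(1)]
    have "((\<lambda>y. F (y - y0, snd z)) has_derivative (\<lambda>h. frechet_derivative F (at z) (h, 0))) (at (y0 + fst z))"
      by simp
    then have "((\<lambda>q. \<Phi> q (t0 + snd z)) \<circ> chart_inv c has_derivative
        (\<lambda>h. frechet_derivative F (at z) (h, 0))) (at (y0 + fst z))"
      by (rule has_derivative_transform_within_open[OF _ V]) (use F(4) z in force)
    then show ?thesis
      using ch(8)[OF F(3)[OF z(1)]]
      unfolding partial_def coord_basis_def coord_vector_def by (metis differentiableI frechet_derivative_at)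
  qed
  then have r': "repr W (\<lambda>q t. partial c i (\<lambda>q. \<Phi> q t) q) (dd (axis i 1, 0) F)"
    using r by (auto simp: repr_def csmooth_dd)
  then show "sm (\<lambda>q t. partial c i (\<lambda>q. \<Phi> q t) q)" by (rule repr_sm)
  show "gm (\<lambda>q t. partial c i (\<lambda>q. \<Phi> q t) q) = gd (axis i 1, 0) (gm \<Phi>)"
    using repr_germ_rel[OF r] by (simp add: gm_eq[OF r'] gm_eq[OF r] gd.abs_eq)
qed

text \<open>\<open>\<Psi>\<close> is a derivative within the interval, possibly one-sided, while
  \<open>F\<close> has a two-sided one. Restricted to the interval they are derivatives of the same
  function, and a derivative within a nondegenerate interval is unique.\<close>

lemma sm_time_derivative:
  assumes "sm \<Phi>"
    and d: "\<And>q t. q \<in> chart_dom c \<Longrightarrow> t \<in> {0..T} \<Longrightarrow> (\<Phi> q has_real_derivative \<Psi> q t) (at t within {0..T})"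
  shows "sm \<Psi>" "gm \<Psi> = gd (0, 1) (gm \<Phi>)"
proof -
  obtain W F where r: "repr W \<Phi> F" using assms by (auto simp: sm_def)
  then have F: "open W" "csmooth W F" "\<And>z. z \<in> W \<Longrightarrow> y0 + fst z \<in> chart_im c"
    "\<And>z. z \<in> W \<Longrightarrow> t0 + snd z \<in> {0..T} \<Longrightarrow> \<Phi> (chart_inv c (y0 + fst z)) (t0 + snd z) = F z"
    by (auto simp: repr_def)
  have "\<Psi> (chart_inv c (y0 + fst z)) (t0 + snd z) = dd (0, 1) F z"
    if z: "z \<in> W" "t0 + snd z \<in> {0..T}" for z
  proof -
    let ?q = "chart_inv c (y0 + fst z)" and ?t = "t0 + snd z"
    let ?V = "(\<lambda>t. (fst z, t - t0)) -` W"
    have V: "open ?V" "?t \<in> ?V"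
      using F(1) z by (auto intro!: open_vimage continuous_intros)
    have "((\<lambda>t. (fst z, t - t0)) has_derivative (\<lambda>h. (0, h))) (at ?t)"
      by (auto intro!: derivative_eq_intros)
    from has_derivative_compose[OF this, of F "frechet_derivative F (at z)"] csmooth_has_derivative[OF F(2) z(1)]
    have *: "((\<lambda>t. F (fst z, t - t0)) has_derivative (\<lambda>h. frechet_derivative F (at z) (0, h))) (at ?t)"
      by simp
    have "(\<lambda>h. frechet_derivative F (at z) (0, h)) = (*) (dd (0, 1) F z)"
    proof
      fix h :: real
      show "frechet_derivative F (at z) (0, h) = dd (0, 1) F z * h"
        using linear_cmul[OF has_derivative_linear[OF csmooth_has_derivative[OF F(2) z(1)]], of h "(0, 1)"]
        by (simp add: mult.commute)
    qed
    with * have "((\<lambda>t. F (fst z, t - t0)) has_real_derivative dd (0, 1) F z) (at ?t)"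
      by (simp only: has_field_derivative_def)
    then have "((\<lambda>t. F (fst z, t - t0)) has_real_derivative dd (0, 1) F z) (at ?t within {0..T})"
      by (rule has_field_derivative_at_within)
    moreover have "\<forall>\<^sub>F t in at ?t within {0..T}. F (fst z, t - t0) = \<Phi> ?q t"
      unfolding eventually_at_topological
      using V F(4) by (intro exI[of _ ?V]) force
    moreover have "F (fst z, ?t - t0) = \<Phi> ?q ?t"
      using F(4)[OF z] by simp
    ultimately have "(\<Phi> ?q has_real_derivative dd (0, 1) F z) (at ?t within {0..T})"
      by (simp only: has_field_derivative_cong_eventually[of "\<lambda>t. F (fst z, t - t0)" "\<Phi> ?q"])
    moreover have "(\<Phi> ?q has_real_derivative \<Psi> ?q ?t) (at ?t within {0..T})"
      by (rule d) (use F z ch(7) in auto)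
    moreover have "at ?t within {0..T} \<noteq> bot"
      using connected_imp_perfect[of "{0..T}" ?t] z t0 by (auto simp: trivial_limit_within)
    ultimately show ?thesis
      unfolding has_real_derivative_iff_has_vector_derivative by (metis vector_derivative_unique_within)
  qed
  then have r': "repr W \<Psi> (dd (0, 1) F)"
    using r by (auto simp: repr_def csmooth_dd)
  then show "sm \<Psi>" by (rule repr_sm)
  show "gm \<Psi> = gd (0, 1) (gm \<Phi>)"
    using repr_germ_rel[OF r] by (simp add: gm_eq[OF r'] gm_eq[OF r] gd.abs_eq)
qed

lemma sm_smooth_on:
  assumes "smooth_on (chart_im c \<times> {0..T}) (\<lambda>(y, t). \<Phi> (chart_inv c y) t)"
  shows "sm \<Phi>"
proof -
  have "(y0, t0) \<in> chart_im c \<times> {0..T}" using ch(5)[OF p] t0 by auto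
  then obtain W F where W: "open W" "(y0, t0) \<in> W" "\<forall>k. Ck_on k W F"
      "\<forall>z \<in> W \<inter> (chart_im c \<times> {0..T}). F z = (case z of (y, t) \<Rightarrow> \<Phi> (chart_inv c y) t)"
    using assms unfolding smooth_on_def by blast
  let ?W = "{z. (y0, t0) + z \<in> W} \<inter> (\<lambda>z. y0 + fst z) -` chart_im c"
  have "open {z. (y0, t0) + z \<in> W}"
    using open_vimage[OF W(1), of "\<lambda>z. (y0, t0) + z"] by (simp add: vimage_def continuous_on_add)
  then have "open ?W"
    by (intro open_Int open_vimage ch continuous_intros)
  moreover have "csmooth ?W (\<lambda>z. F ((y0, t0) + z))"
    using W by (intro csmooth_subset[OF csmooth_translate[of W]]) (auto simp: csmooth_def)
  ultimately have "repr ?W \<Phi> (\<lambda>z. F ((y0, t0) + z))"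
    using W ch(5)[OF p] by (auto simp: repr_def zero_prod_def plus_prod_def)
  then show ?thesis by (rule repr_sm)
qed

lemma ev_gm: "sm \<Phi> \<Longrightarrow> ev (gm \<Phi>) = \<Phi> p t0"
  unfolding sm_def by (auto simp: gm_eq ev.abs_eq repr_germ_rel repr_0)

lemma sm_continuous:
  assumes "sm \<Phi>"
  shows "((\<lambda>(q, t). \<Phi> q t) \<longlongrightarrow> \<Phi> p t0) (at (p, t0) within UNIV \<times> {0..T})"
proof -
  obtain W F where r: "repr W \<Phi> F" using assms by (auto simp: sm_def)
  let ?m = "\<lambda>x. (chart_map c (fst x) - y0, snd x - t0)"
  have "isCont (chart_map c) p"
    using ch(3,1) p by (simp add: continuous_on_eq_continuous_at)
  then have "((\<lambda>x. chart_map c (fst x)) \<longlongrightarrow> y0) (at (p, t0) within UNIV \<times> {0..T})"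
    by (rule isCont_tendsto_compose) (auto intro!: tendsto_eq_intros)
  then have "(?m \<longlongrightarrow> (y0 - y0, t0 - t0)) (at (p, t0) within UNIV \<times> {0..T})"
    by (intro tendsto_intros) (auto intro!: tendsto_eq_intros)
  then have m: "(?m \<longlongrightarrow> 0) (at (p, t0) within UNIV \<times> {0..T})"
    by (simp add: zero_prod_def)
  have W: "open W" "0 \<in> W" and cont: "isCont F 0"
    using r csmooth_isCont[of W F 0] by (auto simp: repr_def)
  have "((\<lambda>x. F (?m x)) \<longlongrightarrow> \<Phi> p t0) (at (p, t0) within UNIV \<times> {0..T})"
    using isCont_tendsto_compose[OF cont m] by (simp add: repr_0[OF r])
  moreover have "\<forall>\<^sub>F x in at (p, t0) within UNIV \<times> {0..T}. F (?m x) = (case x of (q, t) \<Rightarrow> \<Phi> q t)"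
  proof -
    have "\<forall>\<^sub>F x in at (p, t0) within UNIV \<times> {0..T}. ?m x \<in> W"
      using m W by (rule topological_tendstoD)
    moreover have "\<forall>\<^sub>F x in at (p, t0) within UNIV \<times> {0..T}. fst x \<in> chart_dom c"
      by (rule topological_tendstoD[OF _ ch(1) p]) (auto intro!: tendsto_eq_intros)
    moreover have "\<forall>\<^sub>F x in at (p, t0) within UNIV \<times> {0..T}. x \<in> UNIV \<times> {0..T}"
      by (simp add: eventually_at_filter)
    ultimately show ?thesis
    proof eventually_elim
      case (elim x)
      then have "\<Phi> (chart_inv c (y0 + fst (?m x))) (t0 + snd (?m x)) = F (?m x)"
        using r unfolding repr_def by (metis add_diff_cancel_left' diff_add_cancel add.commute mem_Times_iff snd_conv)
      with elim show ?case by (simp add: ch(6) case_prod_unfold)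
    qed
  qed
  ultimately show ?thesis by (rule Lim_transform_eventually)
qed

section \<open>Derivatives of germs at a maximum\<close>

lemma ev_gd_gm: "repr W \<Phi> F \<Longrightarrow> ev (gd v (gm \<Phi>)) = dd v F 0"
  and ev_gd_gd_gm: "repr W \<Phi> F \<Longrightarrow> ev (gd v (gd w (gm \<Phi>))) = dd v (dd w F) 0"
proof -
  assume r: "repr W \<Phi> F"
  have "germ_rel (dd v F) (dd v F)" for v
    using repr_smooth0[OF r] by (simp add: germ_rel_def smooth0_dd past_eq_refl)
  moreover have "germ_rel (dd v (dd w F)) (dd v (dd w F))"
    using repr_smooth0[OF r] by (simp add: germ_rel_def smooth0_dd past_eq_refl)
  ultimately show "ev (gd v (gm \<Phi>)) = dd v F 0" "ev (gd v (gd w (gm \<Phi>))) = dd v (dd w F) 0"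
    using repr_germ_rel[OF r] by (simp_all add: gm_eq[OF r] gd.abs_eq ev.abs_eq)
qed

text \<open>Spatial lines stay at time \<open>t0\<close>, so on them the extension is
  \<open>\<Phi>\<close> itself. A positive second derivative would make the first derivative
  positive just after the critical point, and the mean value theorem would give a larger
  value.\<close>

lemma spatial_max:
  assumes "sm \<Phi>" and max: "\<And>q. \<Phi> q t0 \<le> \<Phi> p t0"
  shows "ev (gd (v, 0) (gm \<Phi>)) = 0" "ev (gd (v, 0) (gd (v, 0) (gm \<Phi>))) \<le> 0"
proof -
  obtain W F where r: "repr W \<Phi> F" using assms by (auto simp: sm_def)
  let ?v = "(v, 0) :: (real^'n) \<times> real"
  define h where "h s = F (s *\<^sub>R ?v)" for s
  have W: "open W" "0 \<in> W" "csmooth W F" using r by (auto simp: repr_def)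
  obtain \<delta> where \<delta>: "\<delta> > 0" "\<And>s. \<bar>s\<bar> < \<delta> \<Longrightarrow> s *\<^sub>R ?v \<in> W"
    using open_segment_through_0[OF W(1,2), of ?v] by blast
  have h1: "(h has_real_derivative dd ?v F (s *\<^sub>R ?v)) (at s)" if "\<bar>s\<bar> < \<delta>" for s
    using line_derivative[OF W(3), of 0 s ?v] \<delta> that by (simp add: h_def[abs_def])
  have h2: "((\<lambda>s. dd ?v F (s *\<^sub>R ?v)) has_real_derivative dd ?v (dd ?v F) 0) (at 0)"
    using line_derivative[OF csmooth_dd[OF W(3)], of 0 0 ?v ?v] \<delta>(2)[of 0] \<delta>(1) by (simp add: zero_prod_def[symmetric])
  have hmax: "h s \<le> h 0" if s: "\<bar>s\<bar> < \<delta>" for s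
  proof -
    have "t0 + snd (s *\<^sub>R ?v) \<in> {0..T}" using t0 by simp
    then have "h s = \<Phi> (chart_inv c (y0 + fst (s *\<^sub>R ?v))) (t0 + snd (s *\<^sub>R ?v))"
      using r \<delta>(2)[OF s] unfolding repr_def h_def by metis
    then show ?thesis
      using max by (simp add: h_def repr_0[OF r] zero_prod_def[symmetric])
  qed
  have d0: "dd ?v F 0 = 0"
    using DERIV_local_max[OF h1[of 0] \<delta>(1)] hmax \<delta>(1) by (simp add: zero_prod_def[symmetric])
  then show "ev (gd ?v (gm \<Phi>)) = 0" by (simp add: ev_gd_gm[OF r])
  show "ev (gd ?v (gd ?v (gm \<Phi>))) \<le> 0"
  proof (rule ccontr)
    assume "\<not> ?thesis"
    then have "dd ?v (dd ?v F) 0 > 0" by (simp add: ev_gd_gd_gm[OF r])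
    from DERIV_pos_inc_right[OF h2 this] obtain e where e: "e > 0"
      "\<And>s. 0 < s \<Longrightarrow> s < e \<Longrightarrow> dd ?v F (s *\<^sub>R ?v) > 0"
      using d0 by (auto simp: zero_prod_def[symmetric])
    define b where "b = min \<delta> e / 2"
    have b: "0 < b" "b < \<delta>" "b < e" using \<delta>(1) e(1) by (auto simp: b_def min_def)
    have "\<exists>z>0. z < b \<and> h b - h 0 = (b - 0) * dd ?v F (z *\<^sub>R ?v)"
      using b by (intro MVT2 h1) auto
    then obtain z where z: "0 < z" "z < b" "h b - h 0 = b * dd ?v F (z *\<^sub>R ?v)" by auto
    moreover have "dd ?v F (z *\<^sub>R ?v) > 0" using e(2) z b by auto
    ultimately have "h b > h 0" using b by (metis diff_gt_0_iff_gt mult_pos_pos)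
    then show False using hmax[of b] b by auto
  qed
qed

text \<open>Only earlier times are compared, since \<open>t0\<close> may equal \<open>T\<close>.
  Hence the time derivative of the weighted function is merely nonnegative; the product rule gives
  the stated expression.\<close>

lemma temporal_max:
  assumes "sm \<Phi>" "0 \<le> \<epsilon>" "\<epsilon> < t0"
    and max: "\<And>t. t \<in> {\<epsilon>..t0} \<Longrightarrow> (t - \<epsilon>) * (\<Phi> p t - K) \<le> (t0 - \<epsilon>) * (\<Phi> p t0 - K)"
  shows "0 \<le> (t0 - \<epsilon>) * ev (gd (0, 1) (gm \<Phi>)) + (\<Phi> p t0 - K)"
proof -
  obtain W F where r: "repr W \<Phi> F" using assms by (auto simp: sm_def)
  let ?v = "(0, 1) :: (real^'n) \<times> real"
  define h where "h s = (t0 + s - \<epsilon>) * (F (s *\<^sub>R ?v) - K)" for s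
  have W: "open W" "0 \<in> W" "csmooth W F" using r by (auto simp: repr_def)
  obtain \<delta> where \<delta>: "\<delta> > 0" "\<And>s. \<bar>s\<bar> < \<delta> \<Longrightarrow> s *\<^sub>R ?v \<in> W"
    using open_segment_through_0[OF W(1,2), of ?v] by blast
  have "((\<lambda>s. F (s *\<^sub>R ?v)) has_real_derivative dd ?v F 0) (at 0)"
    using line_derivative[OF W(3), of 0 0 ?v] W by (simp add: zero_prod_def[symmetric])
  then have h: "(h has_real_derivative (t0 - \<epsilon>) * dd ?v F 0 + (\<Phi> p t0 - K)) (at 0)"
    unfolding h_def by (auto intro!: derivative_eq_intros simp: repr_0[OF r] zero_prod_def[symmetric])
  have hmax: "h (- s) \<le> h 0" if s: "0 < s" "s < \<delta>" "s < t0 - \<epsilon>" for s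
  proof -
    have "t0 + snd ((- s) *\<^sub>R ?v) \<in> {0..T}" using t0 s assms(2) by simp
    then have "F ((- s) *\<^sub>R ?v) = \<Phi> (chart_inv c (y0 + fst ((- s) *\<^sub>R ?v))) (t0 + snd ((- s) *\<^sub>R ?v))"
      using r \<delta>(2)[of "- s"] s unfolding repr_def by (metis abs_minus_cancel abs_of_pos)
    then show ?thesis
      using max[of "t0 - s"] s ch(6)[OF p] by (simp add: h_def repr_0[OF r] zero_prod_def[symmetric])
  qed
  show ?thesis
  proof (rule ccontr)
    assume "\<not> ?thesis"
    then have "(t0 - \<epsilon>) * dd ?v F 0 + (\<Phi> p t0 - K) < 0" by (simp add: ev_gd_gm[OF r])
    from DERIV_neg_dec_left[OF h this] obtain e where e: "e > 0"
      "\<And>s. 0 < s \<Longrightarrow> s < e \<Longrightarrow> h 0 < h (0 - s)" by auto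
    define b where "b = min (min \<delta> e) (t0 - \<epsilon>) / 2"
    have "0 < b" "b < \<delta>" "b < e" "b < t0 - \<epsilon>" using \<delta>(1) e(1) assms(3) by (auto simp: b_def min_def)
    with e(2)[of b] hmax[of b] show False by simp
  qed
qed

lemma ev_gd_linear:
  shows "ev (gd (v, 0) a) = (\<Sum>i\<in>UNIV. v $ i * ev (gd (axis i 1, 0) a))"
proof -
  have lin: "linear (\<lambda>v. ev (gd (v, 0) a))"
  proof -
    obtain F where F: "germ_rel F F" "a = abs_germ F"
      using Quotient_rep_reflp[OF Quotient_germ, of a] Quotient_abs_rep[OF Quotient_germ, of a] by metis
    have "germ_rel (dd v F) (dd v F)" for v
      using F(1) by (auto simp: germ_rel_def smooth0_dd past_eq_refl)
    then have ev: "ev (gd v a) = dd v F 0" for v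
      using F by (simp add: gd.abs_eq ev.abs_eq)
    from F(1)
    have "(F has_derivative frechet_derivative F (at 0)) (at 0)"
      by (auto simp: germ_rel_def smooth0_def intro: csmooth_has_derivative)
    then have l: "linear (frechet_derivative F (at 0))"
      by (rule has_derivative_linear)
    show ?thesis
      unfolding ev
      using linear_add[OF l, of "(_, 0)" "(_, 0)"] linear_cmul[OF l, of _ "(_, 0)"]
      by (intro linearI) simp_all
  qed
  from linear_sum[OF lin, of "\<lambda>i. v $ i *\<^sub>R axis i 1" UNIV] linear_cmul[OF lin]
  show ?thesis
    using basis_expansion[of v] by (simp add: scalar_mult_eq_scaleR)
qed

text \<open>Translates second derivatives along a line into coordinate second derivatives, the form
  in which they enter the Laplacian. Commuting derivatives allows linearity to be used in both
  directions.\<close>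

lemma ev_gd_gd: "form (\<lambda>i j. ev (gd (axis i 1, 0) (gd (axis j 1, 0) a))) (\<lambda>i. v $ i) (\<lambda>i. v $ i) = ev (gd (v, 0) (gd (v, 0) a))"
proof -
  have "ev (gd (v, 0) (gd (v, 0) a)) = (\<Sum>i\<in>UNIV. v $ i * ev (gd (v, 0) (gd (axis i 1, 0) a)))"
    unfolding ev_gd_linear[of v "gd (v, 0) a"] by (simp only: gd_commute[of _ "(v, 0)"])
  also have "\<dots> = (\<Sum>i\<in>UNIV. \<Sum>j\<in>UNIV. v $ i * v $ j * ev (gd (axis j 1, 0) (gd (axis i 1, 0) a)))"
    by (subst ev_gd_linear) (simp add: sum_distrib_left mult.assoc)
  finally show ?thesis
    unfolding form_def by (subst sum.swap) (simp add: mult_ac)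
qed

end

section \<open>The curvature estimate\<close>

text \<open>The flow and the heat equation are assumed on all of space-time, because they will be
  differentiated; the curvature bound is evaluated at the single point
  \<open>(p, t0)\<close>.\<close>

locale flow_point = chart_point A c p t0 T
  for A :: "('m::t2_space, 'n::finite) chart set" and c p and t0 T :: real +
  fixes g :: "real \<Rightarrow> 'm metric_field" and u :: "'m \<Rightarrow> real \<Rightarrow> real" and k :: real
  assumes flow: "ricci_flow A T g"
    and k: "0 < k"
    and ricci_bound: "X \<in> tangent_space A p \<Longrightarrow>
           0 \<le> ricci c (g t0) p X X \<and> ricci c (g t0) p X X \<le> k * g t0 p X X"
    and u_smooth: "smooth_on_interval A T u"
    and u_pos: "\<And>x t. t \<in> {0..T} \<Longrightarrow> 0 < u x t"
    and heat: "heat_equation A T g u"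
begin

section \<open>Metric, connection and curvature as germs\<close>

lemma t0_mem: "t0 \<in> {0..T}"
  using t0 by auto

lemma metric_at: "q \<in> chart_dom c \<Longrightarrow> t \<in> {0..T} \<Longrightarrow> chart_metric A c q (g t)"
  using A c flow by unfold_locales (auto simp: ricci_flow_def metric_family_def)

abbreviation "d i \<equiv> gd (axis i 1 :: real^'n, 0 :: real)"
abbreviation "dt \<equiv> gd (0 :: real^'n, 1 :: real)"
abbreviation "Gc i j \<equiv> gm (\<lambda>q t. metric_coeff c (g t) i j q)"
abbreviation "Gi i j \<equiv> gm (\<lambda>q t. inverse_metric_coeff c (g t) i j q)"
abbreviation "Gam l i j \<equiv> gm (\<lambda>q t. christoffel c (g t) l i j q)"

lemma sm_metric: "sm (\<lambda>q t. metric_coeff c (g t) i j q)"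
  using flow c by (intro sm_smooth_on) (auto simp: ricci_flow_def metric_family_def)

lemma sm_inverse_metric: "sm (\<lambda>q t. inverse_metric_coeff c (g t) i j q)"
proof -
  have "sm (\<lambda>q t. det (\<chi> a l. if l = i then (if a = j then 1 else 0) else metric_coeff c (g t) a l q)
      / det (\<chi> a l. metric_coeff c (g t) a l q))"
  proof (intro sm_divide sm_det)
    show "sm (\<lambda>q t. if l = i then (if a = j then 1 else 0) else metric_coeff c (g t) a l q)" for a l
      by (cases "l = i") (simp_all add: sm_const sm_metric)
    show "det (\<chi> a l. metric_coeff c (g t0) a l p) \<noteq> 0"
      by (rule chart_metric.det_nz[OF metric_at[OF p t0_mem]])
  qed (rule sm_metric)
  then show ?thesis
    by (rule sm_cong(1)[rotated]) (simp add: chart_metric.gic_cramer[OF metric_at])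
qed

lemma sm_half: "sm (\<lambda>q t. 1 / 2)"
  by (rule sm_const)

lemma sm_christoffel: "sm (\<lambda>q t. christoffel c (g t) l i j q)"
  unfolding christoffel_def
  by (intro sm_mult sm_sum sm_diff sm_add sm_const sm_inverse_metric sm_partial[where \<Phi> = "\<lambda>q t. metric_coeff c (g t) _ _ q"] sm_metric)

text \<open>The factor 1/2 in \<open>christoffel\<close> and in the heat equation is represented by
  the germ of a constant, of which only this relation is used.\<close>

lemma half: "gm (\<lambda>q t. 1 / 2) * 2 = 1"
proof -
  have "gm (\<lambda>q t. 1 / 2) + gm (\<lambda>q t. 1 / 2) = gm (\<lambda>q t. 1 / 2 + 1 / 2)"
    by (rule gm_add[OF sm_half sm_half, symmetric])
  also have "\<dots> = 1" by (simp add: gm_1)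
  finally show ?thesis by (simp only: mult_2_right)
qed

lemma gm_christoffel:
  "Gam l i j = gm (\<lambda>q t. 1 / 2) * (\<Sum>m\<in>UNIV. Gi l m * (d i (Gc j m) + d j (Gc i m) - d m (Gc i j)))"
  unfolding christoffel_def
  by (simp only: gm_mult gm_sum gm_diff gm_add sm_mult sm_sum sm_diff sm_add sm_half sm_inverse_metric
      sm_partial[where \<Phi> = "\<lambda>q t. metric_coeff c (g t) _ _ q"]
      gm_partial[where \<Phi> = "\<lambda>q t. metric_coeff c (g t) _ _ q"] sm_metric)

lemma Gc_sym: "Gc i j = Gc j i"
  by (rule sm_cong(2)[OF _ sm_metric]) (simp add: chart_metric.gc_sym[OF metric_at])

lemma Gi_sym: "Gi i j = Gi j i"
  by (rule sm_cong(2)[OF _ sm_inverse_metric]) (simp add: chart_metric.gic_sym[OF metric_at])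

lemma Gi_inv: "(\<Sum>j\<in>UNIV. Gi i j * Gc j l) = (if i = l then 1 else 0)"
proof -
  have "(\<Sum>j\<in>UNIV. Gi i j * Gc j l) = gm (\<lambda>q t. \<Sum>j\<in>UNIV. inverse_metric_coeff c (g t) i j q * metric_coeff c (g t) j l q)"
    by (simp add: gm_sum gm_mult sm_mult sm_inverse_metric sm_metric)
  also have "\<dots> = gm (\<lambda>q t. if i = l then 1 else 0)"
    by (rule sm_cong(2)[OF _ sm_const]) (simp add: chart_metric.inv_left[OF metric_at])
  also have "\<dots> = (if i = l then 1 else 0)"
    by (simp add: gm_0 gm_1)
  finally show ?thesis .
qed

text \<open>These are the Christoffel symbols of the first kind: lowering cancels the inverse metric
  in \<open>gm_christoffel\<close>.\<close>

lemma Gam_lower: "(\<Sum>l\<in>UNIV. Gam l i j * Gc l m) = gm (\<lambda>q t. 1 / 2) * (d i (Gc j m) + d j (Gc i m) - d m (Gc i j))"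
proof -
  define X where "X a = d i (Gc j a) + d j (Gc i a) - d a (Gc i j)" for a
  have "(\<Sum>l\<in>UNIV. Gam l i j * Gc l m) = (\<Sum>l\<in>UNIV. \<Sum>a\<in>UNIV. gm (\<lambda>q t. 1 / 2) * (Gi a l * Gc l m * X a))"
    unfolding gm_christoffel X_def[symmetric] sum_distrib_left sum_distrib_right
    by (simp add: Gi_sym[of _ "_::'n"] mult_ac)
  also have "\<dots> = (\<Sum>a\<in>UNIV. gm (\<lambda>q t. 1 / 2) * ((\<Sum>l\<in>UNIV. Gi a l * Gc l m) * X a))"
    unfolding sum_distrib_left sum_distrib_right by (rule sum.swap)
  also have "\<dots> = gm (\<lambda>q t. 1 / 2) * X m"
    unfolding Gi_inv by (simp add: if_distrib[of "\<lambda>x. x * _"] if_distrib[of "\<lambda>x. _ * x"] cong: if_cong)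
  finally show ?thesis by (simp only: X_def)
qed

sublocale ring: metric_ring d Gc Gi Gam
proof (intro metric_ring.intro)
  show "derivation (d i)" for i by (rule derivation_gd)
  show "d i (d j x) = d j (d i x)" for i j x by (rule gd_commute)
  show "Gc i j = Gc j i" "Gi i j = Gi j i" for i j by (rule Gc_sym Gi_sym)+
  show "(\<Sum>j\<in>UNIV. Gi i j * Gc j k) = (if i = k then 1 else 0)" for i k by (rule Gi_inv)
  show "Gam l i j = Gam l j i" for l i j
    unfolding gm_christoffel Gc_sym[of i j] by (simp add: add.commute)
  \<comment> \<open>In the sum of two lowered symbols four of the six derivatives cancel, and the
    wanted one appears twice.\<close>
  show "d i (Gc j k) = (\<Sum>l\<in>UNIV. Gam l i j * Gc l k) + (\<Sum>l\<in>UNIV. Gam l i k * Gc j l)" for i j k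
  proof -
    have "(\<Sum>l\<in>UNIV. Gam l i j * Gc l k) + (\<Sum>l\<in>UNIV. Gam l i k * Gc l j) = gm (\<lambda>q t. 1 / 2) * 2 * d i (Gc j k)"
      unfolding Gam_lower Gc_sym[of k j] Gc_sym[of k i] Gc_sym[of j i]
      by (simp add: algebra_simps)
    then show ?thesis by (simp only: half mult_1 Gc_sym[of j])
  qed
qed

lemma sm_riemann: "sm (\<lambda>q t. riemann c (g t) l m i j q)"
  and gm_riemann: "gm (\<lambda>q t. riemann c (g t) l m i j q) = ring.R l m i j"
proof -
  note s = sm_christoffel sm_partial[where \<Phi> = "\<lambda>q t. christoffel c (g t) _ _ _ q", OF sm_christoffel]
  show "sm (\<lambda>q t. riemann c (g t) l m i j q)"
    unfolding riemann_def by (intro sm_mult sm_sum sm_diff sm_add s)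
  show "gm (\<lambda>q t. riemann c (g t) l m i j q) = ring.R l m i j"
    unfolding riemann_def ring.R_def
    by (simp only: gm_mult gm_sum gm_diff gm_add sm_mult sm_sum sm_diff sm_add s
      gm_partial[where \<Phi> = "\<lambda>q t. christoffel c (g t) _ _ _ q", OF sm_christoffel])
qed

abbreviation "Rc i j \<equiv> (\<lambda>q t. \<Sum>l\<in>UNIV. riemann c (g t) l j l i q)"

lemma gm_ricci: "sm (Rc i j)" "gm (Rc i j) = ring.Ric i j"
  by (simp_all add: gm_sum sm_sum sm_riemann gm_riemann ring.Ric_def)

lemma ricci_form:
  assumes "q \<in> chart_dom c"
  shows "ricci c (g t) q (coord_vector c q v) (coord_vector c q w) = form (\<lambda>i j. Rc i j q t) (\<lambda>i. v $ i) (\<lambda>i. w $ i)"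
  by (simp add: ricci_def form_def component_coord_vector[OF chart assms])

lemma ricci_basis:
  assumes "q \<in> chart_dom c"
  shows "ricci c (g t) q (coord_basis c i q) (coord_basis c j q) = Rc i j q t"
  unfolding coord_basis_def ricci_form[OF assms] form_def
  by (simp add: axis_def if_distrib[of "\<lambda>x. _ * x"] cong: if_cong)

text \<open>The flow equation is evaluated on coordinate vectors, which do not depend on
  time.\<close>

sublocale flow_ring: ricci_flow_ring d Gc Gi Gam dt
proof (intro ricci_flow_ring.intro ricci_flow_ring_axioms.intro)
  show "metric_ring d Gc Gi Gam" by unfold_locales
  show "derivation dt" by (rule derivation_gd)
  show "dt (d i x) = d i (dt x)" for i x by (rule gd_commute)
  show "dt (Gc i j) = - ring.Ric i j" for i j
  proof -
    have "((\<lambda>s. metric_coeff c (g s) i j q) has_real_derivative - Rc i j q t) (at t within {0..T})"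
      if "q \<in> chart_dom c" "t \<in> {0..T}" for q t
    proof -
      have "coord_basis c i q \<in> tangent_space A q" for i
        unfolding coord_basis_def by (rule chart_metric.tangent_mem[OF metric_at[OF that]])
      then show ?thesis
        using flow that c unfolding ricci_flow_def metric_coeff_def ricci_basis[OF that(1), symmetric] by blast
    qed
    from sm_time_derivative(2)[OF sm_metric this] have "gm (\<lambda>q t. - Rc i j q t) = dt (Gc i j)" .
    then show ?thesis
      by (simp add: gm_minus gm_ricci)
  qed
qed

section \<open>The logarithm of the solution\<close>

abbreviation "U \<equiv> gm (\<lambda>q t. u q t)"
abbreviation "f \<equiv> gm (\<lambda>q t. ln (u q t))"
abbreviation "V \<equiv> gm (\<lambda>q t. inverse (u q t))"

lemma sm_u: "sm (\<lambda>q t. u q t)"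
  using u_smooth c by (intro sm_smooth_on) (auto simp: smooth_on_interval_def)

lemma gd_u: "gd v U = U * gd v f"
  by (rule sm_ln(2)[OF sm_u u_pos[OF t0_mem]])

lemma sm_inverse_u: "sm (\<lambda>q t. inverse (u q t))"
  using u_pos[OF t0_mem, of p] by (intro sm_inverse sm_u) simp

lemma UV: "U * V = 1"
proof -
  have "gm (\<lambda>q t. u q t * inverse (u q t)) = gm (\<lambda>q t. 1)"
    by (rule sm_cong(2)[OF _ sm_const]) (use u_pos in \<open>simp add: order_less_imp_not_eq2\<close>)
  then show ?thesis by (simp add: gm_mult sm_u sm_inverse_u gm_1)
qed

lemma sm_laplacian: "sm (\<lambda>q t. laplacian c (g t) (\<lambda>q. u q t) q)"
  and gm_laplacian: "gm (\<lambda>q t. laplacian c (g t) (\<lambda>q. u q t) q) = ring.Lap U"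
proof -
  note p1 = sm_partial[where \<Phi> = "\<lambda>q t. u q t", OF sm_u]
  note p2 = sm_partial[where \<Phi> = "\<lambda>q t. partial c _ (\<lambda>q. u q t) q", OF p1]
  note s = sm_christoffel sm_inverse_metric p1 p2
  show "sm (\<lambda>q t. laplacian c (g t) (\<lambda>q. u q t) q)"
    unfolding laplacian_def hessian_def by (intro sm_mult sm_sum sm_diff sm_add s)
  show "gm (\<lambda>q t. laplacian c (g t) (\<lambda>q. u q t) q) = ring.Lap U"
    unfolding laplacian_def hessian_def ring.Lap_def ring.tr_def ring.Hess_def ring.cov1_def
    by (simp only: gm_mult gm_sum gm_diff gm_add sm_mult sm_sum sm_diff sm_add s
      gm_partial[where \<Phi> = "\<lambda>q t. u q t", OF sm_u] gm_partial[where \<Phi> = "\<lambda>q t. partial c _ (\<lambda>q. u q t) q", OF p1])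
qed

abbreviation "df \<equiv> (\<lambda>i. d i f)"

text \<open>Each derivative of u = exp f brings out a factor u, so the Hessian of u is u times the
  Hessian of f plus the square of its differential; then take the trace.\<close>

lemma Lap_U: "ring.Lap U = U * (ring.Lap f + ring.ip1 df df)"
proof -
  have "ring.Hess U i j = U * (ring.Hess f i j + d i f * d j f)" for i j
    by (simp add: ring.Hess_def ring.cov1_def gd_u ring.dr sum_distrib_left algebra_simps)
  then have "ring.tr (ring.Hess U) = ring.tr (\<lambda>i j. U * (ring.Hess f i j + d i f * d j f))"
    by (rule ring.tr_cong)
  then show ?thesis
    unfolding ring.Lap_def ring.ip1_def by (simp add: ring.tr_scale ring.tr_add)
qed

lemma heat_f: "2 * dt f = ring.Lap f + ring.ip1 df df"
proof -
  have "(u q has_real_derivative 1 / 2 * laplacian c (g t) (\<lambda>y. u y t) q) (at t within {0..T})"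
    if "q \<in> chart_dom c" "t \<in> {0..T}" for q t
    using heat that c unfolding heat_equation_def by blast
  from sm_time_derivative(2)[OF sm_u this]
  have "dt U = gm (\<lambda>q t. 1 / 2) * ring.Lap U"
    by (simp only: gm_mult[OF sm_half sm_laplacian] gm_laplacian)
  then have "V * (2 * dt U) = V * (gm (\<lambda>q t. 1 / 2) * 2 * ring.Lap U)"
    by (simp add: mult_ac)
  then have "V * (2 * dt U) = V * ring.Lap U"
    by (simp only: half mult_1)
  then have "(U * V) * (2 * dt f) = (U * V) * (ring.Lap f + ring.ip1 df df)"
    unfolding Lap_U gd_u by (simp add: mult_ac)
  then show ?thesis by (simp only: UV mult_1)
qed

text \<open>The estimated quantity in the coordinates of \<open>c\<close>. It is written with sums,
  products and reciprocals only, so that smoothness and germ can be read off factor by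
  factor.\<close>

definition Q :: "'m \<Rightarrow> real \<Rightarrow> real" where
  "Q q t = (\<Sum>i\<in>UNIV. \<Sum>j\<in>UNIV. inverse_metric_coeff c (g t) i j q *
       (partial c i (\<lambda>q. u q t) q * partial c j (\<lambda>q. u q t) q)) * (inverse (u q t) * inverse (u q t))
     - laplacian c (g t) (\<lambda>q. u q t) q * inverse (u q t)"

lemma sm_Q: "sm Q" and gm_Q: "gm Q = - ring.Lap f"
proof -
  note p1 = sm_partial[where \<Phi> = "\<lambda>q t. u q t", OF sm_u]
  note s = sm_inverse_metric p1 sm_laplacian sm_inverse_u
  show "sm Q"
    unfolding Q_def[abs_def] by (intro sm_mult sm_sum sm_diff sm_add s)
  have "gm Q = (\<Sum>i\<in>UNIV. \<Sum>j\<in>UNIV. Gi i j * (d i U * d j U)) * (V * V) - ring.Lap U * V"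
    unfolding Q_def[abs_def]
    by (simp only: gm_mult gm_sum gm_diff gm_add sm_mult sm_sum sm_diff sm_add s gm_laplacian
      gm_partial[where \<Phi> = "\<lambda>q t. u q t", OF sm_u])
  also have "(\<Sum>i\<in>UNIV. \<Sum>j\<in>UNIV. Gi i j * (d i U * d j U)) = U * U * ring.ip1 df df"
    unfolding gd_u ring.ip1_def ring.tr_def by (simp add: sum_distrib_left mult_ac)
  also have "U * U * ring.ip1 df df * (V * V) - ring.Lap U * V
      = (U * V) * ((U * V) * ring.ip1 df df) - (U * V) * (ring.Lap f + ring.ip1 df df)"
    unfolding Lap_U by (simp add: mult_ac)
  also have "\<dots> = - ring.Lap f"
    by (simp add: UV)
  finally show "gm Q = - ring.Lap f" .
qed

section \<open>The differential inequality and the maximum principle\<close>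

lemma ev_tr: "ev (ring.tr S) = (\<Sum>i\<in>UNIV. \<Sum>j\<in>UNIV. inverse_metric_coeff c (g t0) i j p * ev (S i j))"
  by (simp add: ring.tr_def ev_sum ev_simps ev_gm sm_inverse_metric)

text \<open>In \<open>evolution\<close> for - Q, the gradient term vanishes at a critical point, the
  Laplacian of - Q is nonnegative, and the Ricci term is nonnegative. What remains is bounded below
  by \<open>trace_bound\<close>, where the trace of the Hessian is - Q.\<close>

lemma ev_evolution:
  assumes crit: "\<And>i. ev (d i (gm Q)) = 0"
    and neg: "\<And>v. ev (gd (v, 0) (gd (v, 0) (gm Q))) \<le> 0"
  shows "2 * real CARD('n) * ev (dt (gm Q)) \<le> (k * real CARD('n))\<^sup>2 - (Q p t0)\<^sup>2"
proof -
  interpret m: chart_metric A c p "g t0"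
    by (rule metric_at[OF p t0_mem])
  define Ri where "Ri i j = Rc i j p t0" for i j
  define H where "H i j = ev (ring.Hess f i j)" for i j
  define \<alpha> where "\<alpha> i = ev (d i f)" for i
  obtain e :: "'n \<Rightarrow> 'n \<Rightarrow> real" where
    e: "\<And>a b. form m.gc (e a) (e b) = (if a = b then 1 else 0)"
      "\<And>i j. m.gic i j = (\<Sum>a\<in>UNIV. e a i * e a j)"
    using orthonormal_frame[OF m.gc_sym m.gc_pos m.inv_left] by blast
  have Ric: "ev (ring.Ric i j) = Ri i j" for i j
    using ev_gm[OF gm_ricci(1)[where i = i and j = j]] by (simp add: gm_ricci Ri_def)
  have Ric_sym: "Ri i j = Ri j i" for i j
    using flow_ring.Ric_sym[of i j] by (metis Ric)
  have bound: "0 \<le> form Ri x x" "form Ri x x \<le> k * form m.gc x x" for x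
    using ricci_bound[OF m.tangent_mem[of "\<chi> i. x i"]]
    by (simp_all add: ricci_form[OF p] m.g_form Ri_def[abs_def])
  have ip2: "ev (ring.ip2 S S') = (\<Sum>i\<in>UNIV. \<Sum>j\<in>UNIV. m.gic i j * (\<Sum>k\<in>UNIV. \<Sum>l\<in>UNIV. m.gic k l * (ev (S i k) * ev (S' j l))))" for S S'
    by (simp add: ring.ip2_def ev_tr ev_simps)
  have 1: "(Q p t0)\<^sup>2 - (k * real CARD('n))\<^sup>2 \<le> 2 * real CARD('n) * (ev (ring.ip2 ring.Ric (ring.Hess f)) + ev (ring.ip2 (ring.Hess f) (ring.Hess f)))"
  proof -
    have "Q p t0 = - (\<Sum>i\<in>UNIV. \<Sum>j\<in>UNIV. m.gic i j * H i j)"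
      using ev_gm[OF sm_Q] by (simp add: gm_Q ev_simps ring.Lap_def ev_tr H_def)
    then show ?thesis
      using trace_bound[OF e Ric_sym bound k, of H] by (simp add: ip2 Ric H_def)
  qed
  have 2: "ev (ring.Lap (ring.Lap f)) \<ge> 0"
  proof -
    have crit': "ev (d i (ring.Lap f)) = 0" for i
      using crit[of i] by (simp add: gm_Q ring.dr ev_simps)
    \<comment> \<open>At a critical point the Christoffel part of the Hessian drops out, so
      coordinate second derivatives suffice.\<close>
    have "ev (ring.Lap (gm Q)) = (\<Sum>i\<in>UNIV. \<Sum>j\<in>UNIV. m.gic i j * ev (d i (d j (gm Q))))"
      by (simp add: ring.Lap_def ev_tr ring.Hess_def ring.cov1_def ev_simps ev_sum crit)
    also have "\<dots> = (\<Sum>a\<in>UNIV. form (\<lambda>i j. ev (d i (d j (gm Q)))) (e a) (e a))"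
      by (rule frame_trace[OF e(2)])
    also have "\<dots> \<le> 0"
      using ev_gd_gd[of "gm Q" "\<chi> i. e _ i"] neg by (intro sum_nonpos) simp
    finally have "ev (ring.Lap (gm Q)) \<le> 0" .
    moreover have "ring.Lap (gm Q) = - ring.Lap (ring.Lap f)"
      by (simp add: gm_Q ring.Lap_minus)
    ultimately show ?thesis by (simp add: ev_simps)
  qed
  have 3: "ev (ring.ip1 df (\<lambda>i. d i (ring.Lap f))) = 0"
  proof -
    have "ev (d i (ring.Lap f)) = 0" for i
      using crit[of i] by (simp add: gm_Q ring.dr ev_simps)
    then show ?thesis by (simp add: ring.ip1_def ev_tr ev_simps)
  qed
  have 4: "ev (ring.appl ring.Ric df) \<ge> 0"
  proof -
    \<comment> \<open>Components of the differential in the orthonormal frame; the combination of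
      frame vectors with these coefficients is the gradient of f.\<close>
    define \<beta> where "\<beta> a = (\<Sum>i\<in>UNIV. \<alpha> i * e a i)" for a
    have "ev (ring.appl ring.Ric df) = (\<Sum>a\<in>UNIV. \<Sum>b\<in>UNIV. form Ri (e a) (e b) * form (\<lambda>i j. \<alpha> i * \<alpha> j) (e a) (e b))"
      unfolding ring.appl_def ip2 ev_simps Ric \<alpha>_def[symmetric] by (rule frame_inner[OF e(2)])
    also have "\<dots> = (\<Sum>a\<in>UNIV. \<Sum>b\<in>UNIV. form Ri (e a) (e b) * (\<beta> a * \<beta> b))"
      by (simp add: form_def \<beta>_def sum_product mult_ac)
    also have "\<dots> = form Ri (\<lambda>i. \<Sum>a\<in>UNIV. \<beta> a * e a i) (\<lambda>i. \<Sum>b\<in>UNIV. \<beta> b * e b i)"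
      by (simp add: form_sum form_linear sum_distrib_left mult_ac)
    also have "\<dots> \<ge> 0" by (rule bound)
    finally show ?thesis .
  qed
  have "2 * ev (dt (ring.Lap f)) = ev (2 * dt (ring.Lap f))"
    by (simp add: ev_simps ev_two)
  also have "\<dots> = ev (ring.Lap (ring.Lap f)) + 2 * (ev (ring.ip2 ring.Ric (ring.Hess f)) + ev (ring.ip2 (ring.Hess f) (ring.Hess f))
     + ev (ring.ip1 df (\<lambda>i. d i (ring.Lap f))) + ev (ring.appl ring.Ric df))"
    unfolding flow_ring.evolution[OF heat_f] by (simp add: ev_simps ev_two)
  finally have "ev (dt (ring.Lap f)) \<ge> ev (ring.ip2 ring.Ric (ring.Hess f)) + ev (ring.ip2 (ring.Hess f) (ring.Hess f))"
    using 2 3 4 by simp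
  then have "2 * real CARD('n) * ev (dt (ring.Lap f)) \<ge> (Q p t0)\<^sup>2 - (k * real CARD('n))\<^sup>2"
    using 1 by (smt (verit) mult_left_mono of_nat_0_le_iff)
  moreover have "ev (dt (gm Q)) = - ev (dt (ring.Lap f))"
    by (simp add: gm_Q flow_ring.dtr ev_simps)
  ultimately show ?thesis by simp
qed

text \<open>\<open>\<Psi>\<close> is defined on the whole manifold, as a global maximum requires,
  while derivatives are taken of the chart quantity \<open>Q\<close>; agreement on the chart domain
  gives both the same germ.\<close>

lemma max_bound:
  fixes \<Psi> :: "'m \<Rightarrow> real \<Rightarrow> real"
  assumes \<Psi>: "\<And>q t. q \<in> chart_dom c \<Longrightarrow> t \<in> {0..T} \<Longrightarrow> \<Psi> q t = Q q t"
    and space: "\<And>q. \<Psi> q t0 \<le> \<Psi> p t0"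
    and time: "\<And>t. t \<in> {\<epsilon>..t0} \<Longrightarrow> (t - \<epsilon>) * (\<Psi> p t - k * real CARD('n)) \<le> (t0 - \<epsilon>) * (\<Psi> p t0 - k * real CARD('n))"
    and \<epsilon>: "0 \<le> \<epsilon>" "\<epsilon> < t0"
  shows "(t0 - \<epsilon>) * (\<Psi> p t0 - k * real CARD('n)) \<le> 2 * real CARD('n)"
proof (rule ccontr)
  define K where "K = k * real CARD('n)"
  define n where "n = real CARD('n)"
  define F where "F = \<Psi> p t0"
  assume "\<not> ?thesis"
  then have big: "(t0 - \<epsilon>) * (F - K) > 2 * n" by (simp add: K_def n_def F_def)
  have n: "n > 0" by (simp add: n_def)
  have K: "K > 0" using k by (simp add: K_def)
  have "sm \<Psi>" "gm \<Psi> = gm Q"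
    by (rule sm_cong[OF _ sm_Q], simp add: \<Psi>)+
  have F: "F = Q p t0" using \<Psi>[OF p t0_mem] by (simp add: F_def)
  have "2 * n * ev (dt (gm Q)) \<le> K\<^sup>2 - F\<^sup>2"
    using ev_evolution spatial_max[OF \<open>sm \<Psi>\<close> space] by (simp add: \<open>gm \<Psi> = gm Q\<close> n_def K_def F)
  moreover have "0 \<le> (t0 - \<epsilon>) * ev (dt (gm Q)) + (F - K)"
    using temporal_max[OF \<open>sm \<Psi>\<close> \<epsilon> time] by (simp add: \<open>gm \<Psi> = gm Q\<close> K_def F_def)
  ultimately have "0 \<le> (t0 - \<epsilon>) * (K\<^sup>2 - F\<^sup>2) + 2 * n * (F - K)"
  proof -
    assume 1: "2 * n * ev (dt (gm Q)) \<le> K\<^sup>2 - F\<^sup>2" and 2: "0 \<le> (t0 - \<epsilon>) * ev (dt (gm Q)) + (F - K)"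
    have "0 \<le> 2 * n * ((t0 - \<epsilon>) * ev (dt (gm Q)) + (F - K))" using 2 n by simp
    also have "\<dots> = (t0 - \<epsilon>) * (2 * n * ev (dt (gm Q))) + 2 * n * (F - K)" by (simp add: algebra_simps)
    also have "\<dots> \<le> (t0 - \<epsilon>) * (K\<^sup>2 - F\<^sup>2) + 2 * n * (F - K)"
      using 1 \<epsilon> by (intro add_right_mono mult_left_mono) auto
    finally show ?thesis .
  qed
  \<comment> \<open>If the bound failed, the first factor would be positive, and the second negative
    because F + K exceeds F - K.\<close>
  also have "\<dots> = (F - K) * (2 * n - (t0 - \<epsilon>) * (F + K))"
    by (simp add: power2_eq_square algebra_simps)
  also have "\<dots> < 0"
  proof -
    have "(t0 - \<epsilon>) * (F - K) > 0" using big n by simp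
    then have "F - K > 0" using \<epsilon> by (simp add: zero_less_mult_iff)
    moreover have "(t0 - \<epsilon>) * (F + K) > 2 * n"
    proof -
      have "(t0 - \<epsilon>) * (F - K) \<le> (t0 - \<epsilon>) * (F + K)" using \<epsilon> K by (intro mult_left_mono) auto
      then show ?thesis using big by simp
    qed
    ultimately show ?thesis by (simp add: mult_pos_neg)
  qed
  finally show False by simp
qed

end

section \<open>From local estimates to the compact manifold\<close>

theorem theorem4p1:
  fixes A :: "('m::t2_space, 'n::finite) chart set"
    and g :: "real \<Rightarrow> 'm metric_field"
    and u :: "'m \<Rightarrow> real \<Rightarrow> real"
    and T k :: real
  assumes "compact_manifold A"
    and "0 < T"
    and "ricci_flow A T g"
    and "0 < k"
    and "\<And>c x t X. c \<in> A \<Longrightarrow> x \<in> chart_dom c \<Longrightarrow> t \<in> {0<..T} \<Longrightarrow> X \<in> tangent_space A x \<Longrightarrow>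
           0 \<le> ricci c (g t) x X X \<and> ricci c (g t) x X X \<le> k * g t x X X"
    and "smooth_on_interval A T u"
    and "\<And>x t. t \<in> {0..T} \<Longrightarrow> 0 < u x t"
    and "heat_equation A T g u"
  shows "\<forall>c\<in>A. \<forall>x\<in>chart_dom c. \<forall>t\<in>{0<..T}.
           (metric_norm (g t) x (gradient A (g t) (\<lambda>y. u y t) x))\<^sup>2 / (u x t)\<^sup>2
             - laplacian c (g t) (\<lambda>y. u y t) x / u x t
           \<le> k * real CARD('n) + 2 * real CARD('n) / t"
proof -
  have A: "smooth_atlas A" and comp: "compact (UNIV :: 'm set)"
    using assms(1) by (auto simp: compact_manifold_def)
  have point: "flow_point A c x t T g u k" if "c \<in> A" "x \<in> chart_dom c" "t \<in> {0<..T}" for c x t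
    using A that assms by unfold_locales auto
  have cover: "\<exists>c. c \<in> A \<and> x \<in> chart_dom c" for x
    using A unfolding smooth_atlas_def by blast
  define ch where "ch x = (SOME c. c \<in> A \<and> x \<in> chart_dom c)" for x
  have pick: "ch x \<in> A" "x \<in> chart_dom (ch x)" for x
    using someI_ex[OF cover[of x]] by (auto simp: ch_def)
  \<comment> \<open>A chart is picked at every point without any continuity; \<open>lap\<close>
    makes \<open>\<Psi>\<close> coincide with the quantity \<open>Q\<close> of one chart on its
    whole domain.\<close>
  define \<Psi> where "\<Psi> x t = (metric_norm (g t) x (gradient A (g t) (\<lambda>y. u y t) x))\<^sup>2 / (u x t)\<^sup>2
             - laplacian (ch x) (g t) (\<lambda>y. u y t) x / u x t" for x t
  \<comment> \<open>In every chart half the Laplacian of u is the time derivative of u, which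
    involves no chart.\<close>
  have lap: "laplacian c (g t) (\<lambda>y. u y t) x = laplacian d (g t) (\<lambda>y. u y t) x"
    if "c \<in> A" "x \<in> chart_dom c" "d \<in> A" "x \<in> chart_dom d" "t \<in> {0..T}" for c d x t
  proof -
    have "((\<lambda>s. u x s) has_real_derivative (1/2) * laplacian c (g t) (\<lambda>y. u y t) x) (at t within {0..T})"
      "((\<lambda>s. u x s) has_real_derivative (1/2) * laplacian d (g t) (\<lambda>y. u y t) x) (at t within {0..T})"
      using assms(8) that unfolding heat_equation_def by blast+
    moreover have "at t within {0..T} \<noteq> bot"
      using connected_imp_perfect[of "{0..T}" t] that assms(2) by (auto simp: trivial_limit_within)
    ultimately have "(1/2) * laplacian c (g t) (\<lambda>y. u y t) x = (1/2) * laplacian d (g t) (\<lambda>y. u y t) x"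
      unfolding has_real_derivative_iff_has_vector_derivative by (metis vector_derivative_unique_within)
    then show ?thesis by simp
  qed
  have \<Psi>: "\<Psi> x t = flow_point.Q c g u x t"
    if "c \<in> A" "x \<in> chart_dom c" "t \<in> {0..T}" "flow_point A c p s T g u k" for c x t p s
  proof -
    interpret chart_metric A c x "g t"
      using A that assms(3) by unfold_locales (auto simp: ricci_flow_def metric_family_def)
    show ?thesis
      unfolding flow_point.Q_def[OF that(4)] \<Psi>_def gradient_norm lap[OF pick that(1-3)]
      by (simp add: divide_inverse power2_eq_square)
  qed
  have claim: "(t - \<epsilon>) * (\<Psi> x t - k * real CARD('n)) \<le> 2 * real CARD('n)"
    if t: "t \<in> {0<..T}" and \<epsilon>: "0 < \<epsilon>" "\<epsilon> < t" for x t \<epsilon>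
  proof -
    let ?\<phi> = "\<lambda>(x, t). (t - \<epsilon>) * (\<Psi> x t - k * real CARD('n))"
    \<comment> \<open>A compact cylinder over positive times only, so that \<open>flow_point\<close>
      is available at each of its points; it reaches up to \<open>T\<close>, and \<open>t\<close> is
      some time inside.\<close>
    let ?S = "UNIV \<times> {\<epsilon>..T} :: ('m \<times> real) set"
    have "continuous_on ?S ?\<phi>"
      unfolding continuous_on_def
    proof
      fix z assume "z \<in> ?S"
      then obtain q s where z: "z = (q, s)" "s \<in> {\<epsilon>..T}" by auto
      then have s: "s \<in> {0<..T}" using \<epsilon> by auto
      interpret flow_point A "ch q" q s T g u k by (rule point[OF pick s])
      have "sm \<Psi>"
        by (rule sm_cong(1)[OF _ sm_Q]) (simp add: \<Psi>[OF pick(1) _ _ point[OF pick s]])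
      then have "((\<lambda>(x, t). \<Psi> x t) \<longlongrightarrow> \<Psi> q s) (at (q, s) within UNIV \<times> {0..T})"
        by (rule sm_continuous)
      then have "((\<lambda>(x, t). \<Psi> x t) \<longlongrightarrow> \<Psi> q s) (at (q, s) within ?S)"
        by (rule tendsto_within_subset) (use \<epsilon> in auto)
      then show "(?\<phi> \<longlongrightarrow> ?\<phi> z) (at z within ?S)"
        unfolding z case_prod_unfold by (auto intro!: tendsto_eq_intros)
    qed
    moreover have "compact ?S"
      by (intro compact_Times comp compact_Icc)
    moreover have "?S \<noteq> {}" using t \<epsilon> by auto
    ultimately obtain z where "z \<in> ?S" "\<forall>w\<in>?S. ?\<phi> w \<le> ?\<phi> z"
      using continuous_attains_sup[of ?S ?\<phi>] by blast
    then obtain q s where s: "s \<in> {\<epsilon>..T}" and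
      max: "\<And>y r. r \<in> {\<epsilon>..T} \<Longrightarrow> (r - \<epsilon>) * (\<Psi> y r - k * real CARD('n)) \<le> (s - \<epsilon>) * (\<Psi> q s - k * real CARD('n))"
      by force
    have "(s - \<epsilon>) * (\<Psi> q s - k * real CARD('n)) \<le> 2 * real CARD('n)"
    \<comment> \<open>At the bottom of the cylinder the weight vanishes and the bound is trivial;
      above it earlier times in the cylinder exist.\<close>
    proof (cases "s = \<epsilon>")
      case False
      then have s': "s \<in> {0<..T}" "\<epsilon> < s" using s \<epsilon> by auto
      interpret flow_point A "ch q" q s T g u k by (rule point[OF pick s'(1)])
      show ?thesis
      proof (rule max_bound)
        show "\<Psi> y s \<le> \<Psi> q s" for y
          using max[OF s, of y] s' by simp
        show "(r - \<epsilon>) * (\<Psi> q r - k * real CARD('n)) \<le> (s - \<epsilon>) * (\<Psi> q s - k * real CARD('n))" if "r \<in> {\<epsilon>..s}" for r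
          using that s by (intro max) auto
      qed (use \<epsilon> s' \<Psi>[OF pick(1) _ _ point[OF pick s'(1)]] in auto)
    qed simp
    then show ?thesis
      using max[of t x] t \<epsilon> by auto
  qed
  show ?thesis
  proof (intro ballI)
    fix c x t assume c: "c \<in> A" "x \<in> chart_dom c" and t: "t \<in> {0<..T}"
    \<comment> \<open>For fixed \<open>(x, t)\<close> the claim holds for all small positive
      \<epsilon>, with a right-hand side that does not depend on it.\<close>
    have "((\<lambda>\<epsilon>. (t - \<epsilon>) * (\<Psi> x t - k * real CARD('n))) \<longlongrightarrow> (t - 0) * (\<Psi> x t - k * real CARD('n))) (at_right 0)"
      by (intro tendsto_intros)
    moreover have "\<forall>\<^sub>F \<epsilon> in at_right 0. (t - \<epsilon>) * (\<Psi> x t - k * real CARD('n)) \<le> 2 * real CARD('n)"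
      using eventually_at_right_real[of 0 t] t by (auto elim!: eventually_mono intro!: claim)
    ultimately have "(t - 0) * (\<Psi> x t - k * real CARD('n)) \<le> 2 * real CARD('n)"
      by (rule tendsto_upperbound) simp
    then have "\<Psi> x t \<le> k * real CARD('n) + 2 * real CARD('n) / t"
      using t by (simp add: field_simps)
    then show "(metric_norm (g t) x (gradient A (g t) (\<lambda>y. u y t) x))\<^sup>2 / (u x t)\<^sup>2
             - laplacian c (g t) (\<lambda>y. u y t) x / u x t
           \<le> k * real CARD('n) + 2 * real CARD('n) / t"
      using lap[OF c pick, of t] t by (simp add: \<Psi>_def)
  qed
qed

end
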